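(* Let $(\varphi_t)_{t\ge0}$ be a parabolic semiflow, let $\Omega$ be its Koenigs domain and denote by $\mathcal{T}=(C_{\varphi_t})_{t\ge0}$ its associated $C_0$-semigroup acting on $H^p$ for $1\le p<\infty$. Assume that either (i) $(\varphi_t)_{t\ge0}$ is of positive hyperbolic step, $\operatorname{int}(\overline{\Omega})=\Omega$ and $\mathbb{C}\setminus\overline{\Omega}$ is connected; or (ii) $(\varphi_t)_{t\ge0}$ is of zero hyperbolic step, $\Omega$ is contained in a half-plane and $\operatorname{int}(\overline{\Omega})=\Omega$. Then $\mathcal{T}'$ is abelian and does not contain any non-trivial idempotent.
   Context: $\mathbb{D}$ is the open unit disc of $\mathbb{C}$ and $\mathbb{T}$ the unit circle. For $1\le p<\infty$, $H^p$ is the Banach space of holomorphic $f:\mathbb{D}\to\mathbb{C}$ with $\|f\|_{H^p}=\left(\sup_{0<r<1}\int_0^{2\pi}|f(re^{i\theta})|^p\,d\theta\right)^{1/p}<\infty$. For holomorphic $\varphi:\mathbb{D}\to\mathbb{D}$, $C_\varphi f=f\circ\varphi$, a bounded operator on $H^p$. $\mathcal{L}(H^p)$ is the algebra of bounded linear operators on $H^p$; $\{T\}'=\{A\in\mathcal{L}(H^p):AT=TA\}$. For the semigroup $\mathcal{T}=(C_{\varphi_t})_{t\ge0}$, $\mathcal{T}'=\bigcap_{t>0}\{C_{\varphi_t}\}'$. A non-trivial idempotent is $J\in\mathcal{L}(H^p)$ with $J^2=J$, $J\ne 0$, $J\neq \mathrm{Id}$. Semiflows. A holomorphic semiflow is a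 family $(\varphi_t)_{t\ge0}$ of holomorphic self-maps of $\mathbb{D}$ with $\varphi_0(z)=z$, $\varphi_{t+s}=\varphi_t\circ\varphi_s$ for all $t,s\geq 0$, and $\varphi_t\to\varphi_s$ uniformly on compact subsets of $\mathbb{D}$ as $t\to s$. It is elliptic if $\varphi_{t_0}(z_0)=z_0$ for some $t_0>0$ and $z_0\in\mathbb{D}$. If it is not elliptic, there is a unique $\tau\in\mathbb{T}$ (the Denjoy–Wolff point) such that $\varphi_t\to\tau$ uniformly on compact subsets as $t\to\infty$, and there is $\alpha\le 0$ such that $\varphi_t'$ has non-tangential limit $e^{t\alpha}$ at $\tau$ for all $t\geq 0$; the semiflow is hyperbolic if $\alpha<0$ and parabolic if $\alpha=0$. A parabolic semiflow is of positive hyperbolic step if for some $z\in\mathbb{D}$ the limit $\lim_{t\to+\infty}k_{\mathbb{D}}(\varphi_t(z),\varphi_{t+1}(z))$ is positive, where $k_{\mathbb{D}}$ is the hyperbolic distance in $\mathbb{D}$; otherwise it is of zero hyperbolic step. For a non-elliptic semiflow there is a univalent function $h:\mathbb{D}\to\mathbb{C}$ (the Koenigs function), unique up to an additive constant, with $\varphi_t(z)=h^{-1}(h(z)+t)$ for all $z\in\mathbb{D}$, $t\ge0$. The Koenigs domain is $\Omega=h(\mathbb{D})$. Interior and closure are taken in $\mathbb{C}$. *)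

theory Defs
  imports "HOL-Complex_Analysis.Complex_Analysis"
begin

abbreviation unit_disc :: "complex set" ("\<D>")
  where "\<D> \<equiv> ball 0 1"


subsection \<open>Hardy spaces and their bounded operators\<close>

definition circle_mean :: "real \<Rightarrow> (complex \<Rightarrow> complex) \<Rightarrow> real \<Rightarrow> real"
  where "circle_mean p f r = integral {0..2*pi} (\<lambda>\<theta>. norm (f (of_real r * cis \<theta>)) powr p)"

(* A function on the disc is represented by its extension by 0 to the whole plane, so that
   equality of elements of H^p is equality in HOL. *)
definition Hardy :: "real \<Rightarrow> (complex \<Rightarrow> complex) set"
  where "Hardy p = {f. f holomorphic_on \<D> \<and> (\<forall>z. z \<notin> \<D> \<longrightarrow> f z = 0) \<and>
                       bdd_above (circle_mean p f ` {0<..<1})}"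

definition Hardy_norm :: "real \<Rightarrow> (complex \<Rightarrow> complex) \<Rightarrow> real"
  where "Hardy_norm p f = (SUP r\<in>{0<..<1}. circle_mean p f r) powr (1 / p)"

type_synonym fun_op = "(complex \<Rightarrow> complex) \<Rightarrow> (complex \<Rightarrow> complex)"

(* Operators on H^p are likewise extended by 0 outside H^p. Equality of operators is then equality
   in HOL, and the operator product is function composition. *)
definition Hardy_ext :: "real \<Rightarrow> fun_op \<Rightarrow> fun_op"
  where "Hardy_ext p A = (\<lambda>f. if f \<in> Hardy p then A f else (\<lambda>z. 0))"

definition bounded_operators :: "real \<Rightarrow> fun_op set"
  where "bounded_operators p = {A.
     (\<forall>f\<in>Hardy p. A f \<in> Hardy p) \<and>
     (\<forall>f\<in>Hardy p. \<forall>g\<in>Hardy p. A (\<lambda>z. f z + g z) = (\<lambda>z. A f z + A g z)) \<and>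
     (\<forall>c. \<forall>f\<in>Hardy p. A (\<lambda>z. c * f z) = (\<lambda>z. c * A f z)) \<and>
     (\<exists>C. \<forall>f\<in>Hardy p. Hardy_norm p (A f) \<le> C * Hardy_norm p f) \<and>
     (\<forall>f. f \<notin> Hardy p \<longrightarrow> A f = (\<lambda>z. 0))}"

definition zero_operator :: fun_op
  where "zero_operator = (\<lambda>f z. 0)"

definition id_operator :: "real \<Rightarrow> fun_op"
  where "id_operator p = Hardy_ext p (\<lambda>f. f)"

definition composition_operator :: "real \<Rightarrow> (complex \<Rightarrow> complex) \<Rightarrow> fun_op"
  where "composition_operator p \<phi> = Hardy_ext p (\<lambda>f z. if z \<in> \<D> then f (\<phi> z) else 0)"

definition commutant :: "real \<Rightarrow> fun_op \<Rightarrow> fun_op set"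
  where "commutant p T = {A \<in> bounded_operators p. A \<circ> T = T \<circ> A}"

definition semigroup_commutant :: "real \<Rightarrow> (real \<Rightarrow> complex \<Rightarrow> complex) \<Rightarrow> fun_op set"
  where "semigroup_commutant p \<phi> = (\<Inter>t\<in>{0<..}. commutant p (composition_operator p (\<phi> t)))"

definition nontrivial_idempotent :: "real \<Rightarrow> fun_op \<Rightarrow> bool"
  where "nontrivial_idempotent p J \<longleftrightarrow>
     J \<in> bounded_operators p \<and> J \<circ> J = J \<and> J \<noteq> zero_operator \<and> J \<noteq> id_operator p"


subsection \<open>Holomorphic semiflows\<close>

(* Only the values of \<phi> t z for t \<ge> 0 and z in the disc are meaningful. *)
definition holomorphic_semiflow :: "(real \<Rightarrow> complex \<Rightarrow> complex) \<Rightarrow> bool"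
  where "holomorphic_semiflow \<phi> \<longleftrightarrow>
     (\<forall>t\<ge>0. \<phi> t holomorphic_on \<D> \<and> \<phi> t ` \<D> \<subseteq> \<D>) \<and>
     (\<forall>z\<in>\<D>. \<phi> 0 z = z) \<and>
     (\<forall>t\<ge>0. \<forall>s\<ge>0. \<forall>z\<in>\<D>. \<phi> (t + s) z = \<phi> t (\<phi> s z)) \<and>
     (\<forall>s\<ge>0. \<forall>K. compact K \<and> K \<subseteq> \<D> \<longrightarrow> uniform_limit K \<phi> (\<phi> s) (at s within {0..}))"

definition elliptic :: "(real \<Rightarrow> complex \<Rightarrow> complex) \<Rightarrow> bool"
  where "elliptic \<phi> \<longleftrightarrow> (\<exists>t\<^sub>0>0. \<exists>z\<^sub>0\<in>\<D>. \<phi> t\<^sub>0 z\<^sub>0 = z\<^sub>0)"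

definition denjoy_wolff_point :: "(real \<Rightarrow> complex \<Rightarrow> complex) \<Rightarrow> complex \<Rightarrow> bool"
  where "denjoy_wolff_point \<phi> \<tau> \<longleftrightarrow> \<tau> \<in> sphere 0 1 \<and>
     (\<forall>K. compact K \<and> K \<subseteq> \<D> \<longrightarrow> uniform_limit K \<phi> (\<lambda>z. \<tau>) at_top)"

definition stolz_region :: "complex \<Rightarrow> real \<Rightarrow> complex set"
  where "stolz_region \<tau> M = {z \<in> \<D>. norm (\<tau> - z) < M * (1 - norm z)}"

definition nontangential_limit :: "(complex \<Rightarrow> complex) \<Rightarrow> complex \<Rightarrow> complex \<Rightarrow> bool"
  where "nontangential_limit f \<tau> l \<longleftrightarrow> (\<forall>M>1. (f \<longlongrightarrow> l) (at \<tau> within stolz_region \<tau> M))"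

definition spectral_value :: "(real \<Rightarrow> complex \<Rightarrow> complex) \<Rightarrow> complex \<Rightarrow> real \<Rightarrow> bool"
  where "spectral_value \<phi> \<tau> \<alpha> \<longleftrightarrow>
     (\<forall>t\<ge>0. nontangential_limit (deriv (\<phi> t)) \<tau> (of_real (exp (t * \<alpha>))))"

definition parabolic :: "(real \<Rightarrow> complex \<Rightarrow> complex) \<Rightarrow> bool"
  where "parabolic \<phi> \<longleftrightarrow> holomorphic_semiflow \<phi> \<and> \<not> elliptic \<phi> \<and>
     (\<exists>\<tau>. denjoy_wolff_point \<phi> \<tau> \<and> spectral_value \<phi> \<tau> 0)"

definition hyperbolic_dist :: "complex \<Rightarrow> complex \<Rightarrow> real"
  where "hyperbolic_dist z w = artanh (norm ((z - w) / (1 - cnj w * z)))"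

definition positive_hyperbolic_step :: "(real \<Rightarrow> complex \<Rightarrow> complex) \<Rightarrow> bool"
  where "positive_hyperbolic_step \<phi> \<longleftrightarrow>
     (\<exists>z\<in>\<D>. \<exists>L>0. ((\<lambda>t. hyperbolic_dist (\<phi> t z) (\<phi> (t + 1) z)) \<longlongrightarrow> L) at_top)"

abbreviation zero_hyperbolic_step :: "(real \<Rightarrow> complex \<Rightarrow> complex) \<Rightarrow> bool"
  where "zero_hyperbolic_step \<phi> \<equiv> \<not> positive_hyperbolic_step \<phi>"

definition koenigs_function :: "(real \<Rightarrow> complex \<Rightarrow> complex) \<Rightarrow> (complex \<Rightarrow> complex) \<Rightarrow> bool"
  where "koenigs_function \<phi> h \<longleftrightarrow> h holomorphic_on \<D> \<and> inj_on h \<D> \<and>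
     (\<forall>t\<ge>0. \<forall>z\<in>\<D>. h z + of_real t \<in> h ` \<D> \<and> \<phi> t z = inv_into \<D> h (h z + of_real t))"

definition half_plane :: "complex set \<Rightarrow> bool"
  where "half_plane H \<longleftrightarrow> (\<exists>a b. a \<noteq> 0 \<and> H = {w. a \<bullet> w > b})"

end

(*
  In both cases the Koenigs domain lies in a half-plane, so that for a suitable affine image g of h
  the functions exp (- x g), x > 0, are bounded. They are joint eigenfunctions of the C_{phi_t} with
  one-dimensional joint eigenspaces, hence every operator of the commutant acts on them by scalars
  m x, which depend continuously on x; for an idempotent m takes values in {0, 1} and is constant.
  It remains to see that the exponentials generate H^p. A bounded operator on H^p is sequentially
  continuous for bounded pointwise limits of bounded functions: by uniform convexity of H^q, q >= 2,
  suitable averages of such a sequence converge in norm. So it suffices to generate the bounded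
  functions, which are dense, by bounded pointwise limits. The algebra generated by the exponentials
  contains F = 1 / (1 + g), hence the resolvents of F at all points off the closure K of its range,
  hence (Cauchy's formula) f o F for the Riemann maps f of simply connected neighbourhoods of K.
  As these shrink to K, the maps f o F converge to a rotation, because int K is the range of F.
*)
theory Submission
  imports Defs
begin

subsection \<open>Circle means of holomorphic functions\<close>

text \<open>The eigenfunctions exp (- x g) form a continuum without orthogonality, so the weight of
  the proof lies in their completeness. Norm closures are hard to compute with; bounded pointwise
  limits get along with products, Neumann series, Riemann sums of Cauchy integrals and Montel's
  theorem. The price is the continuity of operators for such limits. It comes from exponents q >= 2,
  where the parallelogram law gives uniform convexity; bounded functions lie in every H^q, so this
  serves all p >= 1. Density of bounded functions is the one fact that concerns H^p itself; the
  Riesz factorization f = v w with v, w in H^(2p) leads back to exponents >= 2. Boundary values of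
  H^p functions are avoided: monotone circle means and dilations f (rho z) replace them. The two
  cases reach the half-plane differently. Positive step makes Omega miss a horizontal line, and the
  complement of its closure is connected by assumption. Zero step rules out half-planes with
  horizontal boundary, and in any other one the stability of Omega under translation to the right
  makes this complement connected.\<close>

lemma riemann_sum_error:
  fixes H :: "real \<Rightarrow> 'a::euclidean_space"
  assumes cont: "continuous_on {a..a+L} H" and "L > 0" "N > 0"
    and osc: "\<And>x y. x \<in> {a..a+L} \<Longrightarrow> y \<in> {a..a+L} \<Longrightarrow> \<bar>x - y\<bar> \<le> L / real N \<Longrightarrow> norm (H x - H y) \<le> e"
  shows "norm (integral {a..a+L} H - (\<Sum>j<N. (L / real N) *\<^sub>R H (a + L * real j / real N))) \<le> L * e"
proof -
  define d where "d = L / real N"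
  have d: "d > 0" and dN: "d * real N = L" using assms by (auto simp: d_def)
  \<comment> \<open>The induction runs over the number m of pieces, with the integral taken only up
    to the right end of the last one; each piece adds an error of at most d * e.\<close>
  have "m \<le> N \<Longrightarrow> norm (integral {a..a + d * real m} H - (\<Sum>j<m. d *\<^sub>R H (a + d * real j))) \<le> d * real m * e" for m
  proof (induction m)
    case (Suc m)
    have le: "d * real (Suc m) \<le> L"
      using Suc.prems d dN by (metis less_eq_real_def mult_left_mono of_nat_le_iff)
    let ?c = "a + d * real m" and ?e = "a + d * real (Suc m)"
    have sub: "{?c..?e} \<subseteq> {a..a+L}" "{a..?e} \<subseteq> {a..a+L}" "?c \<le> ?e" "a \<le> ?c"
      using le d by (auto simp: algebra_simps add_increasing)
    have int: "H integrable_on {a..?e}" "H integrable_on {?c..?e}"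
      using sub by (auto intro!: integrable_continuous_interval continuous_on_subset[OF cont])
    have diff: "integral {?c..?e} (\<lambda>x. H x - H ?c) = integral {?c..?e} H - d *\<^sub>R H ?c"
    proof -
      have "integral {?c..?e} (\<lambda>x. H x - H ?c) = integral {?c..?e} H - integral {?c..?e} (\<lambda>x. H ?c)"
        by (rule integral_diff[OF int(2)]) auto
      also have "integral {?c..?e} (\<lambda>x. H ?c) = d *\<^sub>R H ?c"
        using sub(3) by (subst integral_const_real) (simp add: algebra_simps)
      finally show ?thesis .
    qed
    have "norm (integral {?c..?e} (\<lambda>x. H x - H ?c)) \<le> e * (?e - ?c)"
    proof (rule integral_bound)
      show "continuous_on {?c..?e} (\<lambda>x. H x - H ?c)"
        by (intro continuous_intros continuous_on_subset[OF cont] sub)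
      fix t assume t: "t \<in> {?c..?e}"
      show "norm (H t - H ?c) \<le> e"
        using t sub order_trans[OF sub(4), of t] by (intro osc) (auto simp: d_def[symmetric] algebra_simps)
    qed (use sub in auto)
    then have "norm (integral {?c..?e} H - d *\<^sub>R H ?c) \<le> d * e"
      unfolding diff by (simp add: algebra_simps)
    moreover have eq: "integral {a..?e} H = integral {a..?c} H + integral {?c..?e} H"
      using int sub by (intro Henstock_Kurzweil_Integration.integral_combine[symmetric]) auto
    moreover have "integral {a..?e} H - (\<Sum>j<Suc m. d *\<^sub>R H (a + d * real j))
       = (integral {a..?c} H - (\<Sum>j<m. d *\<^sub>R H (a + d * real j))) + (integral {?c..?e} H - d *\<^sub>R H ?c)"
      unfolding eq by simp
    ultimately have "norm (integral {a..?e} H - (\<Sum>j<Suc m. d *\<^sub>R H (a + d * real j))) \<le> d * real m * e + d * e"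
      using Suc by (metis (no_types, lifting) Suc_leD add_mono norm_triangle_le)
    then show ?case by (simp add: algebra_simps)
  qed simp
  from this[of N] show ?thesis
    by (simp add: dN) (simp add: d_def)
qed

lemma integral_periodic_shift:
  fixes H :: "real \<Rightarrow> 'a::euclidean_space"
  assumes cont: "continuous_on UNIV H" and per: "\<And>x. H (x + L) = H x" and "0 \<le> a" "a \<le> L"
  shows "integral {a..a+L} H = integral {0..L} H"
proof -
  have int: "H integrable_on {u..v}" for u v
    by (auto intro!: integrable_continuous_interval continuous_on_subset[OF cont])
  have "integral {0..a} H + integral {a..L} H = integral {0..L} H"
    "integral {a..L} H + integral {L..a+L} H = integral {a..a+L} H"
    using assms int by (intro Henstock_Kurzweil_Integration.integral_combine; auto)+
  moreover have "integral {L..a+L} H = integral {0..a} H"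
    using integral_shift_Icc_real[of 0 a H L] by (simp add: o_def per add.commute)
  ultimately show ?thesis by (metis add.commute)
qed

text \<open>Young's inequality for the exponents p / (p - 1) and p. The case p = 1 stands apart
  because its conjugate exponent is infinite.\<close>

lemma powr_young:
  fixes a b p :: real
  assumes "a \<ge> 0" "b \<ge> 0" "p \<ge> 1"
  shows "a powr (p - 1) * b \<le> (1 - 1/p) * a powr p + b powr p / p"
proof (cases "p = 1")
  case True
  then show ?thesis using assms by auto
next
  case False
  then have p: "p > 1" using assms by auto
  define q where "q = p / (p - 1)"
  have q: "q > 1" "1/p + 1/q = 1" using p by (auto simp: q_def field_simps)
  have pq: "(p - 1) * q = p" using p by (simp add: q_def)
  have iq: "a powr p / q = (1 - 1/p) * a powr p" using q(2) by (metis add_diff_cancel_left' mult.commute mult.right_neutral times_divide_eq_right)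
  then show ?thesis
    using Youngs_inequality[OF p q assms(2) powr_ge_zero[of a "p - 1"]] iq
    by (simp add: powr_powr mult.commute[of b] pq)
qed

lemma continuous_on_circle:
  assumes "continuous_on (ball 0 R) f" "0 \<le> r" "r < R"
  shows "continuous_on A (\<lambda>\<theta>. f (of_real r * cis \<theta>))"
  by (rule continuous_on_compose2[OF assms(1)]) (use assms in \<open>auto intro!: continuous_intros simp: norm_mult\<close>)

lemma continuous_on_circle_powr:
  assumes "continuous_on (ball 0 R) f" "0 \<le> r" "r < R" "p > 0"
  shows "continuous_on A (\<lambda>\<theta>. norm (f (of_real r * cis \<theta>)) powr p)"
  by (intro continuous_on_powr' continuous_on_norm continuous_on_circle[OF assms(1-3)] continuous_intros)
     (use assms in auto)

(* The Young inequality lets the maximum principle act on the scalar function that norms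
   the vector of values at z0. *)
lemma discrete_mean_mono:
  fixes w :: "nat \<Rightarrow> complex"
  assumes holf: "f holomorphic_on ball 0 R" and p: "1 \<le> p" and w: "\<And>j. norm (w j) = 1"
    and s: "0 < s" "s < R" and z0: "norm z0 \<le> s"
  obtains z where "norm z = s"
    "(\<Sum>j<n. norm (f (z0 * w j)) powr p) \<le> (\<Sum>j<n. norm (f (z * w j)) powr p)"
proof -
  define S where "S z = (\<Sum>j<n. norm (f (z * w j)) powr p)" for z
  have contf: "continuous_on (ball 0 R) f" using holf holomorphic_on_imp_continuous_on by blast
  have sub: "(\<lambda>z. z * w j) ` ball 0 R \<subseteq> ball 0 R" for j
    by (auto simp: norm_mult w)
  have "continuous_on (sphere 0 s) S"
    unfolding S_def using s p
    by (intro continuous_on_sum continuous_on_powr' continuous_on_norm continuous_on_const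
        continuous_on_compose2[OF contf]) (auto intro!: continuous_intros simp: norm_mult w)
  then obtain z1 where z1: "z1 \<in> sphere 0 s" "\<forall>z\<in>sphere 0 s. S z \<le> S z1"
    using continuous_attains_sup[of "sphere 0 s" S] s by auto
  \<comment> \<open>Dual weights: f (z0 w_j) k_j = |f (z0 w_j)|^p, while |k_j| is at most |f (z0
    w_j)|^(p - 1), the form that Young's inequality takes.\<close>
  define k where "k j = cnj (sgn (f (z0 * w j))) * of_real (norm (f (z0 * w j)) powr (p - 1))" for j
  define L where "L z = (\<Sum>j<n. f (z * w j) * k j)" for z
  have holL: "L holomorphic_on ball 0 R"
    unfolding L_def
    by (intro holomorphic_intros holomorphic_on_compose_gen[OF _ holf, unfolded o_def]) (use sub in auto)
  have Lz0: "L z0 = of_real (S z0)"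
  proof -
    have "x * (cnj (sgn x) * of_real (norm x powr (p - 1))) = of_real (norm x powr p)" for x :: complex
    proof (cases "x = 0")
      case False
      have "x * cnj (sgn x) = of_real (norm x)"
        using complex_norm_square[of x] False by (simp add: sgn_eq field_simps power2_eq_square)
      moreover have "norm x * norm x powr (p - 1) = norm x powr p"
        using False powr_mult_base[of "norm x" "p - 1"] by simp
      ultimately show ?thesis by (metis (no_types, opaque_lifting) mult.assoc of_real_mult)
    qed (use p in simp)
    then show ?thesis by (simp add: L_def S_def k_def)
  qed
  have Lz: "norm (L z) \<le> (1 - 1/p) * S z0 + S z1 / p" if "z \<in> sphere 0 s" for z
  proof -
    have "norm (L z) \<le> (\<Sum>j<n. norm (f (z * w j) * k j))"
      unfolding L_def by (rule norm_sum)
    also have "\<dots> \<le> (\<Sum>j<n. (1 - 1/p) * norm (f (z0 * w j)) powr p + norm (f (z * w j)) powr p / p)"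
    proof (rule sum_mono)
      fix j
      have "norm (k j) \<le> norm (f (z0 * w j)) powr (p - 1)"
        by (simp add: k_def norm_mult norm_sgn)
      then have "norm (f (z * w j) * k j) \<le> norm (f (z0 * w j)) powr (p - 1) * norm (f (z * w j))"
        by (simp add: norm_mult mult_right_mono mult.commute[of "norm (f (z * w j))"])
      also have "\<dots> \<le> (1 - 1/p) * norm (f (z0 * w j)) powr p + norm (f (z * w j)) powr p / p"
        by (rule powr_young) (use p in auto)
      finally show "norm (f (z * w j) * k j) \<le> (1 - 1/p) * norm (f (z0 * w j)) powr p + norm (f (z * w j)) powr p / p" .
    qed
    also have "\<dots> = (1 - 1/p) * S z0 + S z / p"
      by (simp add: S_def sum.distrib sum_distrib_left sum_divide_distrib)
    also have "\<dots> \<le> (1 - 1/p) * S z0 + S z1 / p"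
      using z1 that p by (simp add: divide_right_mono)
    finally show ?thesis .
  qed
  have "norm (L z0) \<le> (1 - 1/p) * S z0 + S z1 / p"
  proof (rule maximum_modulus_frontier[of L "cball 0 s"])
    show "L holomorphic_on interior (cball 0 s)" "continuous_on (closure (cball 0 s)) L"
      using holL s by (auto intro!: holomorphic_on_subset[OF holL]
          continuous_on_subset[OF holomorphic_on_imp_continuous_on[OF holL]])
  qed (use Lz z0 s in auto)
  moreover have "S z0 \<ge> 0" by (auto simp: S_def intro: sum_nonneg)
  \<comment> \<open>The share (1 - 1/p) S z0 moves to the left, which leaves S z0 / p <= S z1 /
    p.\<close>
  ultimately have "S z0 \<le> S z1" using p by (simp add: Lz0 field_simps)
  then show thesis using that[of z1] z1 by (auto simp: S_def)
qed

text \<open>\<open>discrete_mean_mono\<close> at the n-th roots of unity, with n growing. The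
  maximizing point has modulus s and an argument that depends on n, but the argument only shifts the
  sample points, and periodicity absorbs the shift.\<close>

lemma circle_mean_mono:
  assumes holf: "f holomorphic_on ball 0 R" and p: "1 \<le> p" and r: "0 \<le> r" "r \<le> s" "s < R"
  shows "circle_mean p f r \<le> circle_mean p f s"
proof (cases "s = 0")
  case True
  then show ?thesis using r by simp
next
  case False
  then have s: "s > 0" using r by auto
  have contf: "continuous_on (ball 0 R) f" using holf holomorphic_on_imp_continuous_on by blast
  define H where "H t \<theta> = norm (f (of_real t * cis \<theta>)) powr p" for t \<theta>
  have contH: "continuous_on A (H t)" if "0 \<le> t" "t \<le> s" for A t
    unfolding H_def by (rule continuous_on_circle_powr[OF contf]) (use that r p in auto)
  have per: "H t (x + 2*pi) = H t x" for t x
    by (simp add: H_def cis_mult[symmetric])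
  \<comment> \<open>The interval reaches 4 pi because the second Riemann sum starts at an angle a
    below 2 pi.\<close>
  have osc: "\<exists>d>0. \<forall>x\<in>{0..4*pi}. \<forall>y\<in>{0..4*pi}. \<bar>x - y\<bar> < d \<longrightarrow> norm (H t x - H t y) \<le> e"
    if "0 \<le> t" "t \<le> s" "e > 0" for t e
  proof -
    have "uniformly_continuous_on {0..4*pi} (H t)"
      by (rule compact_uniformly_continuous[OF contH]) (use that in auto)
    then show ?thesis unfolding uniformly_continuous_on_def dist_norm
      using that(3) by (metis less_eq_real_def norm_minus_commute real_norm_def)
  qed
  \<comment> \<open>Two Riemann sums, each with an error of at most 2 pi e.\<close>
  have "circle_mean p f r \<le> circle_mean p f s + 4 * pi * e" if "e > 0" for e
  proof -
    obtain d1 d2 where d: "d1 > 0" "d2 > 0"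
      and d1: "\<forall>x\<in>{0..4*pi}. \<forall>y\<in>{0..4*pi}. \<bar>x - y\<bar> < d1 \<longrightarrow> norm (H r x - H r y) \<le> e"
      and d2: "\<forall>x\<in>{0..4*pi}. \<forall>y\<in>{0..4*pi}. \<bar>x - y\<bar> < d2 \<longrightarrow> norm (H s x - H s y) \<le> e"
      using osc[of r e] osc[of s e] r s \<open>e > 0\<close> by fastforce
    obtain n :: nat where n: "n > 2 * pi / min d1 d2" using reals_Archimedean2 by blast
    have n0: "n > 0" using n d by (metis divide_pos_pos gr0I less_le_not_le min_less_iff_conj mult_pos_pos of_nat_0 pi_gt_zero zero_less_numeral order_less_trans)
    have nd: "2 * pi / real n < d1" "2 * pi / real n < d2"
      using n n0 d by (auto simp: field_simps min_def split: if_splits intro: less_le_trans)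
    define w where "w j = cis (2 * pi * real j / real n)" for j
    obtain z where z: "norm z = s" and le:
      "(\<Sum>j<n. norm (f (of_real r * w j)) powr p) \<le> (\<Sum>j<n. norm (f (z * w j)) powr p)"
      using discrete_mean_mono[OF holf p, of w s "of_real r" n] s r by (auto simp: w_def)
    define a where "a = Arg2pi z"
    have a: "0 \<le> a" "a < 2 * pi" "z = of_real s * cis a"
      using Arg2pi[of z] z by (auto simp: a_def is_Arg_def cis_conv_exp)
    have "norm (integral {0..0+2*pi} (H r) - (\<Sum>j<n. (2 * pi / real n) *\<^sub>R H r (0 + 2*pi * real j / real n))) \<le> 2*pi * e"
      by (rule riemann_sum_error[OF contH]) (use r s n0 nd d1 in auto)
    then have 1: "integral {0..2*pi} (H r) \<le> (2 * pi / real n) * (\<Sum>j<n. norm (f (of_real r * w j)) powr p) + 2*pi*e"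
      by (simp add: H_def w_def sum_distrib_left)
    have "norm (integral {a..a+2*pi} (H s) - (\<Sum>j<n. (2 * pi / real n) *\<^sub>R H s (a + 2*pi * real j / real n))) \<le> 2*pi * e"
      by (rule riemann_sum_error[OF contH]) (use r s n0 nd d2 a in auto)
    then have 2: "(2 * pi / real n) * (\<Sum>j<n. norm (f (z * w j)) powr p) \<le> integral {a..a+2*pi} (H s) + 2*pi*e"
      by (simp add: H_def w_def sum_distrib_left a(3) mult.assoc cis_mult)
    have "integral {a..a+2*pi} (H s) = integral {0..2*pi} (H s)"
      using integral_periodic_shift[of "H s" "2*pi" a] contH r s per a by auto
    moreover have "(2 * pi / real n) * (\<Sum>j<n. norm (f (of_real r * w j)) powr p) \<le> (2 * pi / real n) * (\<Sum>j<n. norm (f (z * w j)) powr p)"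
      using le by (intro mult_left_mono) auto
    ultimately show ?thesis using 1 2 unfolding circle_mean_def H_def by linarith
  qed
  then have "circle_mean p f r \<le> circle_mean p f s + e" if "e > 0" for e
    using that by (metis (no_types, opaque_lifting) divide_pos_pos mult.commute mult_pos_pos nonzero_eq_divide_eq pi_gt_zero
       order_less_irrefl zero_less_numeral)
  then show ?thesis by (rule field_le_epsilon)
qed

lemma circle_mean_nonneg: "circle_mean p f r \<ge> 0"
  unfolding circle_mean_def
  by (metis integral_nonneg not_integrable_integral order_refl powr_ge_zero)

lemma circle_in_disc: "0 \<le> r \<Longrightarrow> r < 1 \<Longrightarrow> of_real r * cis t \<in> \<D>"
  by (simp add: norm_mult)

lemma circle_mean_cong:
  assumes "\<And>z. z \<in> \<D> \<Longrightarrow> f z = g z" "0 \<le> r" "r < 1"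
  shows "circle_mean p f r = circle_mean p g r"
  unfolding circle_mean_def using assms circle_in_disc[OF assms(2,3)] by simp

lemma circle_mean_integrable:
  assumes "continuous_on \<D> f" "0 \<le> r" "r < 1" "p > 0"
  shows "(\<lambda>\<theta>. norm (f (of_real r * cis \<theta>)) powr p) integrable_on {0..2*pi}"
  by (rule integrable_continuous_interval[OF continuous_on_circle_powr[OF assms]])

text \<open>One passage from pointwise to integrated estimates for sums, products, bounded functions
  and changes of exponent; hence three exponents and a constant, with coefficient 0 for a term that
  does not occur.\<close>

lemma circle_mean_le:
  assumes cont: "continuous_on \<D> f" "continuous_on \<D> g" "continuous_on \<D> h"
    and r: "0 \<le> r" "r < 1" and p: "p > 0" "q > 0" "s > 0"
    and le: "\<And>z. z \<in> \<D> \<Longrightarrow> norm (f z) powr p \<le> a * norm (g z) powr q + b * norm (h z) powr s + c"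
  shows "circle_mean p f r \<le> a * circle_mean q g r + b * circle_mean s h r + 2 * pi * c"
proof -
  note int = circle_mean_integrable[OF cont(1) r p(1)] circle_mean_integrable[OF cont(2) r p(2)]
    circle_mean_integrable[OF cont(3) r p(3)]
  let ?g = "\<lambda>\<theta>. norm (g (of_real r * cis \<theta>)) powr q" and ?h = "\<lambda>\<theta>. norm (h (of_real r * cis \<theta>)) powr s"
  have "((\<lambda>\<theta>. a * ?g \<theta> + b * ?h \<theta> + c) has_integral
         a * circle_mean q g r + b * circle_mean s h r + (2 * pi - 0) *\<^sub>R c) {0..2*pi}"
    unfolding circle_mean_def using int(2,3) has_integral_const_real[of c 0 "2*pi"]
    by (intro has_integral_add has_integral_mult_right integrable_integral) auto
  then show ?thesis
    unfolding circle_mean_def[of p f]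
    using has_integral_le[OF integrable_integral[OF int(1)]] le[OF circle_in_disc[OF r]] by simp
qed

section \<open>Hardy functions, free of any condition off the disc\<close>

definition hardy_fun :: "real \<Rightarrow> (complex \<Rightarrow> complex) \<Rightarrow> bool" where
  "hardy_fun p f \<longleftrightarrow> f holomorphic_on \<D> \<and> bdd_above (circle_mean p f ` {0<..<1})"

text \<open>The p-th power of the Hardy norm. Working with it avoids roots and Minkowski's
  inequality, at the price of a factor 2^p for sums.\<close>

definition hsup :: "real \<Rightarrow> (complex \<Rightarrow> complex) \<Rightarrow> real" where
  "hsup p f = (SUP r\<in>{0<..<1}. circle_mean p f r)"

lemma hardy_fun_holomorphic: "hardy_fun p f \<Longrightarrow> f holomorphic_on \<D>"
  and hardy_fun_continuous: "hardy_fun p f \<Longrightarrow> continuous_on \<D> f"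
  by (auto simp: hardy_fun_def holomorphic_on_imp_continuous_on)

lemma circle_mean_le_hsup: "hardy_fun p f \<Longrightarrow> 0 < r \<Longrightarrow> r < 1 \<Longrightarrow> circle_mean p f r \<le> hsup p f"
  unfolding hsup_def hardy_fun_def by (rule cSUP_upper) auto

lemma hsup_le: "(\<And>r. 0 < r \<Longrightarrow> r < 1 \<Longrightarrow> circle_mean p f r \<le> C) \<Longrightarrow> hsup p f \<le> C"
  unfolding hsup_def by (rule cSUP_least) auto

lemma hardy_funI: "f holomorphic_on \<D> \<Longrightarrow> (\<And>r. 0 < r \<Longrightarrow> r < 1 \<Longrightarrow> circle_mean p f r \<le> C) \<Longrightarrow> hardy_fun p f"
  unfolding hardy_fun_def by (auto intro!: bdd_aboveI[of _ C])

lemma hsup_nonneg: "hardy_fun p f \<Longrightarrow> hsup p f \<ge> 0"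
  using circle_mean_le_hsup[of p f "1/2"] circle_mean_nonneg[of p f "1/2"] by simp

lemma hardy_fun_cong:
  assumes "\<And>z. z \<in> \<D> \<Longrightarrow> f z = g z"
  shows "hardy_fun p f = hardy_fun p g" "hsup p f = hsup p g"
proof -
  have "circle_mean p f ` {0<..<1} = circle_mean p g ` {0<..<1}"
    by (intro image_cong refl circle_mean_cong assms) auto
  moreover have "f holomorphic_on \<D> \<longleftrightarrow> g holomorphic_on \<D>"
    by (rule holomorphic_cong[OF refl assms])
  ultimately show "hardy_fun p f = hardy_fun p g" "hsup p f = hsup p g"
    by (auto simp: hardy_fun_def hsup_def)
qed

text \<open>Crude on purpose: a + b is at most twice the maximum. Later arguments ask only for
  smallness and boundedness.\<close>

lemma powr_add_le:
  fixes a b p :: real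
  assumes "a \<ge> 0" "b \<ge> 0" "p > 0"
  shows "(a + b) powr p \<le> 2 powr p * a powr p + 2 powr p * b powr p"
proof -
  have "(a + b) powr p \<le> (2 * max a b) powr p"
    using assms by (intro powr_mono2) auto
  also have "\<dots> = 2 powr p * max a b powr p" using assms by (simp add: powr_mult)
  also have "max a b powr p \<le> a powr p + b powr p" by (auto simp: max_def)
  finally show ?thesis by (simp add: algebra_simps)
qed

lemma hardy_fun_add:
  assumes "hardy_fun p f" "hardy_fun p g" "p > 0"
  shows "hardy_fun p (\<lambda>z. f z + g z)" "hsup p (\<lambda>z. f z + g z) \<le> 2 powr p * (hsup p f + hsup p g)"
proof -
  have le: "circle_mean p (\<lambda>z. f z + g z) r \<le> 2 powr p * (hsup p f + hsup p g)" if "0 < r" "r < 1" for r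
  proof -
    have "circle_mean p (\<lambda>z. f z + g z) r \<le> 2 powr p * circle_mean p f r + 2 powr p * circle_mean p g r + 2 * pi * 0"
    proof (rule circle_mean_le)
      fix z
      have "norm (f z + g z) powr p \<le> (norm (f z) + norm (g z)) powr p"
        using assms by (intro powr_mono2 norm_triangle_ineq) auto
      then show "norm (f z + g z) powr p \<le> 2 powr p * norm (f z) powr p + 2 powr p * norm (g z) powr p + 0"
        using powr_add_le[of "norm (f z)" "norm (g z)" p] assms by simp
    qed (use assms that in \<open>auto intro: continuous_on_add hardy_fun_continuous\<close>)
    also have "\<dots> \<le> 2 powr p * hsup p f + 2 powr p * hsup p g + 2 * pi * 0"
      using assms that by (intro add_mono mult_left_mono circle_mean_le_hsup) auto
    finally show ?thesis by (simp add: algebra_simps)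
  qed
  show "hardy_fun p (\<lambda>z. f z + g z)"
    by (rule hardy_funI[OF _ le]) (use assms in \<open>auto intro: holomorphic_on_add holomorphic_on_mult holomorphic_on_const hardy_fun_holomorphic\<close>)
  show "hsup p (\<lambda>z. f z + g z) \<le> 2 powr p * (hsup p f + hsup p g)"
    by (rule hsup_le[OF le])
qed

lemma circle_mean_scale:
  "circle_mean p (\<lambda>z. c * f z) r = norm c powr p * circle_mean p f r"
  unfolding circle_mean_def by (simp add: norm_mult powr_mult)

lemma hardy_fun_scale:
  assumes "hardy_fun p f"
  shows "hardy_fun p (\<lambda>z. c * f z)" "hsup p (\<lambda>z. c * f z) = norm c powr p * hsup p f"
proof -
  have le: "circle_mean p (\<lambda>z. c * f z) r \<le> norm c powr p * hsup p f" if "0 < r" "r < 1" for r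
    unfolding circle_mean_scale using assms that by (intro mult_left_mono circle_mean_le_hsup) auto
  show 1: "hardy_fun p (\<lambda>z. c * f z)"
    by (rule hardy_funI[OF _ le]) (use assms in \<open>auto intro: holomorphic_on_add holomorphic_on_mult holomorphic_on_const hardy_fun_holomorphic\<close>)
  show "hsup p (\<lambda>z. c * f z) = norm c powr p * hsup p f"
  proof (rule antisym)
    show "hsup p (\<lambda>z. c * f z) \<le> norm c powr p * hsup p f" by (rule hsup_le[OF le])
    show "norm c powr p * hsup p f \<le> hsup p (\<lambda>z. c * f z)"
    proof (cases "c = 0")
      case False
      have "hsup p f \<le> hsup p (\<lambda>z. c * f z) / norm c powr p"
        using circle_mean_le_hsup[OF 1] False
        by (intro hsup_le) (simp add: circle_mean_scale field_simps)
      then show ?thesis using False by (simp add: field_simps)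
    qed (use hsup_nonneg[OF 1] in simp)
  qed
qed

lemma hardy_fun_diff:
  assumes "hardy_fun p f" "hardy_fun p g" "p > 0"
  shows "hardy_fun p (\<lambda>z. f z - g z)" "hsup p (\<lambda>z. f z - g z) \<le> 2 powr p * (hsup p f + hsup p g)"
  using hardy_fun_add[OF assms(1) hardy_fun_scale(1)[OF assms(2), of "-1"] assms(3)]
    hardy_fun_scale(2)[OF assms(2), of "-1"] by auto

section \<open>Bounded holomorphic functions and comparison of exponents\<close>

definition bhol :: "(complex \<Rightarrow> complex) \<Rightarrow> bool" where
  "bhol f \<longleftrightarrow> f holomorphic_on \<D> \<and> (\<exists>M. \<forall>z\<in>\<D>. norm (f z) \<le> M)"

lemma hardy_fun_bounded:
  assumes "f holomorphic_on \<D>" "\<And>z. z \<in> \<D> \<Longrightarrow> norm (f z) \<le> M" "p > 0"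
  shows "hardy_fun p f" "hsup p f \<le> 2 * pi * M powr p"
proof -
  have le: "circle_mean p f r \<le> 2 * pi * M powr p" if "0 < r" "r < 1" for r
    using circle_mean_le[of f f f r p p p 0 0 "M powr p"] assms(3) that
      holomorphic_on_imp_continuous_on[OF assms(1)] powr_mono2[of p, OF _ norm_ge_zero assms(2)]
    by simp
  show "hardy_fun p f" "hsup p f \<le> 2 * pi * M powr p"
    by (rule hardy_funI[OF assms(1) le] hsup_le[OF le]; assumption)+
qed

lemma bhol_hardy: "bhol f \<Longrightarrow> p > 0 \<Longrightarrow> hardy_fun p f"
  unfolding bhol_def using hardy_fun_bounded by blast

lemma bhol_add: "bhol f \<Longrightarrow> bhol g \<Longrightarrow> bhol (\<lambda>z. f z + g z)"
  unfolding bhol_def by (auto intro!: holomorphic_intros) (meson add_mono norm_triangle_le)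

lemma bhol_mult: "bhol f \<Longrightarrow> bhol g \<Longrightarrow> bhol (\<lambda>z. f z * g z)"
  unfolding bhol_def by (auto intro!: holomorphic_intros simp: norm_mult)
    (meson mult_mono' norm_ge_zero)

lemma bhol_const [simp]: "bhol (\<lambda>z. c)"
  unfolding bhol_def by auto

text \<open>In place of Hoelder's inequality, the circle is cut at the threshold d: where |f| <= d
  the integrand is at most d^p, elsewhere |f|^(p - q) <= d^(p - q). A small d followed by a small
  q-mean makes the p-mean small.\<close>

lemma circle_mean_power_le:
  assumes "continuous_on \<D> f" "0 \<le> r" "r < 1" "0 < p" "p \<le> q" "d > 0"
  shows "circle_mean p f r \<le> d powr (p - q) * circle_mean q f r + 2 * pi * d powr p"
proof -
  have "circle_mean p f r \<le> d powr (p - q) * circle_mean q f r + 0 * circle_mean q f r + 2 * pi * d powr p"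
  proof (rule circle_mean_le)
    fix z
    show "norm (f z) powr p \<le> d powr (p - q) * norm (f z) powr q + 0 * norm (f z) powr q + d powr p"
    proof (cases "norm (f z) \<le> d")
      case True
      then show ?thesis using assms by (auto intro!: add_increasing powr_mono2)
    next
      case False
      then have "norm (f z) powr (p - q) \<le> d powr (p - q)"
        using assms by (intro powr_mono2') auto
      then have "norm (f z) powr (p - q) * norm (f z) powr q \<le> d powr (p - q) * norm (f z) powr q"
        by (intro mult_right_mono) auto
      then show ?thesis using False assms
        by (auto simp: powr_add[symmetric] intro!: add_increasing2)
    qed
  qed (use assms in auto)
  then show ?thesis by simp
qed

lemma hsup_power_le:
  assumes "hardy_fun q f" "0 < p" "p \<le> q" "d > 0"
  shows "hardy_fun p f" "hsup p f \<le> d powr (p - q) * hsup q f + 2 * pi * d powr p"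
proof -
  have le: "circle_mean p f r \<le> d powr (p - q) * hsup q f + 2 * pi * d powr p" if "0 < r" "r < 1" for r
  proof -
    have "circle_mean p f r \<le> d powr (p - q) * circle_mean q f r + 2 * pi * d powr p"
      by (rule circle_mean_power_le) (use assms that in \<open>auto intro: hardy_fun_continuous\<close>)
    also have "\<dots> \<le> d powr (p - q) * hsup q f + 2 * pi * d powr p"
      using circle_mean_le_hsup[OF assms(1) that] by (simp add: mult_left_mono)
    finally show ?thesis .
  qed
  show "hardy_fun p f" "hsup p f \<le> d powr (p - q) * hsup q f + 2 * pi * d powr p"
    by (rule hardy_funI[OF hardy_fun_holomorphic[OF assms(1)] le] hsup_le[OF le]; assumption)+
qed

section \<open>Cauchy's formula as a real integral, and point evaluations\<close>

lemma cauchy_circle: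
  fixes f :: "complex \<Rightarrow> complex"
  assumes holf: "f holomorphic_on ball 0 R" and z: "norm z < r" and r: "r < R"
  shows "((\<lambda>\<theta>. f (of_real r * cis \<theta>) * (of_real r * cis \<theta>) / (of_real r * cis \<theta> - z)) has_integral (2 * pi * f z)) {0..2*pi}"
proof -
  have "((\<lambda>u. f u / (u - z)) has_contour_integral (2 * of_real pi * \<i> * f z)) (circlepath 0 r)"
    by (rule Cauchy_integral_circlepath)
       (use assms in \<open>auto intro!: holomorphic_on_subset[OF holf]
          continuous_on_subset[OF holomorphic_on_imp_continuous_on[OF holf]]\<close>)
  then have "((\<lambda>t. f (of_real r * cis t) / (of_real r * cis t - z) * r * \<i> * cis t) has_integral (2 * of_real pi * \<i> * f z)) {0..2*pi}"
    unfolding circlepath_def by (subst (asm) has_contour_integral_part_circlepath_iff) auto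
  from has_integral_mult_right[OF this, of "-\<i>"] show ?thesis
    by (simp add: algebra_simps)
qed

text \<open>Cauchy's formula bounds f z by the mean of |f|, which
  \<open>circle_mean_power_le\<close> turns into the p-mean. The threshold d stays free so that a
  small mean yields a small value.\<close>

lemma point_bound:
  assumes holf: "f holomorphic_on \<D>" and z: "norm z < r" "r < 1" and p: "1 \<le> p" and d: "d > 0"
  shows "norm (f z) \<le> (d + d powr (1 - p) * circle_mean p f r) / (r - norm z)"
proof -
  have contf: "continuous_on \<D> f" by (rule holomorphic_on_imp_continuous_on[OF holf])
  have r: "0 < r" using z by (meson norm_ge_zero order_le_less_trans)
  define k where "k = 1 / (r - norm z)"
  have k: "k > 0" using z by (simp add: k_def)
  note I = cauchy_circle[OF holf z]
  have "(\<lambda>\<theta>. norm (f (of_real r * cis \<theta>)) powr 1) integrable_on {0..2*pi}"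
    by (rule circle_mean_integrable[OF contf]) (use r z in auto)
  then have I3: "(\<lambda>\<theta>. k * norm (f (of_real r * cis \<theta>))) integrable_on {0..2*pi}"
    by (simp add: integrable_on_mult_right)
  have "norm (integral {0..2*pi} (\<lambda>\<theta>. f (of_real r * cis \<theta>) * (of_real r * cis \<theta>) / (of_real r * cis \<theta> - z)))
     \<le> integral {0..2*pi} (\<lambda>\<theta>. k * norm (f (of_real r * cis \<theta>)))"
  proof (rule integral_norm_bound_integral[OF has_integral_integrable[OF I] I3])
    fix t
    have "r - norm z \<le> norm (of_real r * cis t - z)"
      using norm_triangle_ineq2[of "of_real r * cis t" z] r by (simp add: norm_mult)
    then have "r / norm (of_real r * cis t - z) \<le> 1 / (r - norm z)"
      using z r by (intro frac_le) auto
    then have "norm (f (of_real r * cis t)) * (r / norm (of_real r * cis t - z)) \<le> norm (f (of_real r * cis t)) * k"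
      unfolding k_def by (intro mult_left_mono) auto
    then show "norm (f (of_real r * cis t) * (of_real r * cis t) / (of_real r * cis t - z)) \<le> k * norm (f (of_real r * cis t))"
      using r by (simp add: norm_mult norm_divide mult.commute)
  qed
  then have "2 * pi * norm (f z) \<le> k * circle_mean 1 f r"
    using integral_unique[OF I] by (simp add: circle_mean_def norm_mult)
  also have "\<dots> \<le> k * (d powr (1 - p) * circle_mean p f r + 2 * pi * d)"
    using circle_mean_power_le[OF contf _ z(2), of 1 p d] k r p d by (intro mult_left_mono) auto
  \<comment> \<open>Inflating the first term by 2 pi >= 1 produces a factor 2 pi common to both
    sides.\<close>
  also have "\<dots> \<le> k * (2 * pi * (d powr (1 - p) * circle_mean p f r) + 2 * pi * d)"
  proof -
    have "1 * (d powr (1 - p) * circle_mean p f r) \<le> 2 * pi * (d powr (1 - p) * circle_mean p f r)"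
      using pi_gt3 circle_mean_nonneg[of p f r] by (intro mult_right_mono mult_nonneg_nonneg) auto
    then show ?thesis using k by (intro mult_left_mono) auto
  qed
  finally have "2 * pi * norm (f z) \<le> 2 * pi * (k * (d powr (1 - p) * circle_mean p f r + d))"
    by (simp add: algebra_simps)
  then have "norm (f z) \<le> k * (d powr (1 - p) * circle_mean p f r + d)"
    by (rule mult_left_le_imp_le) auto
  then show ?thesis by (simp add: k_def add.commute)
qed

lemma hardy_point_bound:
  assumes "hardy_fun p f" and z: "norm z < 1" and p: "1 \<le> p" and d: "d > 0"
  shows "norm (f z) \<le> (d + d powr (1 - p) * hsup p f) / ((1 - norm z) / 2)"
proof -
  \<comment> \<open>Halfway between |z| and 1, whence the denominator (1 - |z|) / 2.\<close>
  define r where "r = (1 + norm z) / 2"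
  have r: "norm z < r" "r < 1" "r - norm z = (1 - norm z) / 2" "0 < r"
    using z by (auto simp: r_def field_simps intro: add_pos_nonneg)
  have "norm (f z) \<le> (d + d powr (1 - p) * circle_mean p f r) / (r - norm z)"
    by (rule point_bound[OF hardy_fun_holomorphic[OF assms(1)] r(1,2) p d])
  also have "\<dots> \<le> (d + d powr (1 - p) * hsup p f) / (r - norm z)"
    using r circle_mean_le_hsup[OF assms(1) r(4,2)] by (intro divide_right_mono add_left_mono mult_left_mono) auto
  finally show ?thesis by (simp only: r)
qed

lemma hsup_tendsto_0_imp_pointwise:
  assumes "\<And>n. hardy_fun p (F n)" and lim: "(\<lambda>n. hsup p (F n)) \<longlonglongrightarrow> 0" and z: "norm z < 1" and p: "1 \<le> p"
  shows "(\<lambda>n. F n z) \<longlonglongrightarrow> 0"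
proof (rule LIMSEQ_I)
  fix e :: real assume e: "e > 0"
  \<comment> \<open>Chosen so that (d + d) / ((1 - |z|) / 2) = e.\<close>
  define d where "d = e * (1 - norm z) / 4"
  have d: "d > 0" using e z by (simp add: d_def)
  have "(\<lambda>n. d powr (1 - p) * hsup p (F n)) \<longlonglongrightarrow> 0" using tendsto_mult_right_zero[OF lim] .
  then have "\<forall>\<^sub>F n in sequentially. d powr (1 - p) * hsup p (F n) < d"
    using d by (rule order_tendstoD)
  then show "\<exists>N. \<forall>n\<ge>N. norm (F n z - 0) < e"
    unfolding eventually_sequentially
  proof (elim exE, intro exI allI impI)
    fix N n assume "\<forall>n\<ge>N. d powr (1 - p) * hsup p (F n) < d" "n \<ge> N"
    then have "(d + d powr (1 - p) * hsup p (F n)) / ((1 - norm z) / 2) < (d + d) / ((1 - norm z) / 2)"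
      using z by (intro divide_strict_right_mono) auto
    also have "\<dots> = e" using z by (simp add: d_def field_simps)
    finally show "norm (F n z - 0) < e"
      using hardy_point_bound[OF assms(1) z p d, of n] by simp
  qed
qed

lemma circle_mean_limit:
  assumes "\<And>n. continuous_on \<D> (G n)" "0 \<le> r" "r < 1" "p > 0"
    and "\<And>n z. norm z = r \<Longrightarrow> norm (G n z) \<le> B" "\<And>z. norm z = r \<Longrightarrow> (\<lambda>n. G n z) \<longlonglongrightarrow> g z"
  shows "(\<lambda>n. circle_mean p (G n) r) \<longlonglongrightarrow> circle_mean p g r"
  unfolding circle_mean_def
proof (rule dominated_convergence(2))
  show "(\<lambda>\<theta>. norm (G n (of_real r * cis \<theta>)) powr p) integrable_on {0..2*pi}" for n
    by (rule circle_mean_integrable) (use assms in auto)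
  show "(\<lambda>\<theta>. B powr p) integrable_on {0..2*pi}" by auto
  show "norm (norm (G n (of_real r * cis \<theta>)) powr p) \<le> B powr p" for n \<theta>
    using assms by (simp add: norm_mult powr_mono2)
  show "(\<lambda>n. norm (G n (of_real r * cis \<theta>)) powr p) \<longlonglongrightarrow> norm (g (of_real r * cis \<theta>)) powr p" for \<theta>
    using assms by (intro tendsto_powr' tendsto_norm tendsto_const) (auto simp: norm_mult)
qed

subsection \<open>Uniform convexity and weak limits\<close>

text \<open>After division by x + y this is t^s <= t on [0, 1], used for two fractions with sum
  1.\<close>

lemma powr_superadditive:
  fixes x y s :: real
  assumes "x \<ge> 0" "y \<ge> 0" "s \<ge> 1"
  shows "x powr s + y powr s \<le> (x + y) powr s"
proof (cases "x + y = 0")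
  case False
  then have pos: "x + y > 0" using assms by linarith
  have *: "u powr s \<le> (x + y) powr s * (u / (x + y))" if "0 \<le> u" "u \<le> x + y" for u
  proof -
    have "(u / (x + y)) powr s \<le> (u / (x + y)) powr 1"
      using that pos assms by (intro powr_mono') auto
    then have "(x + y) powr s * (u / (x + y)) powr s \<le> (x + y) powr s * (u / (x + y))"
      using that pos by (intro mult_left_mono) auto
    then show ?thesis using that pos by (simp add: powr_divide)
  qed
  have "x powr s + y powr s \<le> (x + y) powr s * (x / (x + y)) + (x + y) powr s * (y / (x + y))"
    using *[of x] *[of y] assms by simp
  also have "\<dots> = (x + y) powr s * ((x + y) / (x + y))"
    by (simp only: distrib_left add_divide_distrib)
  also have "\<dots> = (x + y) powr s" using pos by simp
  finally show ?thesis .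
qed (use assms add_nonneg_eq_0_iff[of x y] in auto)

text \<open>Young's inequality at the midpoint m acts as the tangent line there: its instances for u
  and v are added and the multiple of m^s is absorbed.\<close>

lemma powr_midpoint_convex:
  fixes u v s :: real
  assumes "u \<ge> 0" "v \<ge> 0" "s \<ge> 1"
  shows "((u + v) / 2) powr s \<le> (u powr s + v powr s) / 2"
proof -
  define m where "m = (u + v) / 2"
  have "m powr (s - 1) * u + m powr (s - 1) * v \<le> 2 * ((1 - 1/s) * m powr s) + (u powr s / s + v powr s / s)"
    using powr_young[of m u s] powr_young[of m v s] assms by (simp add: m_def)
  moreover have "m powr (s - 1) * u + m powr (s - 1) * v = 2 * m powr s"
  proof (cases "m = 0")
    case False
    then have "m powr (s - 1) * m = m powr s"
      using powr_mult_base[of m "s - 1"] assms by (simp add: m_def mult.commute)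
    moreover have "u + v = 2 * m" by (simp add: m_def)
    ultimately show ?thesis by (simp flip: distrib_left)
  qed (use assms in auto)
  ultimately have "2 * m powr s \<le> 2 * ((1 - 1/s) * m powr s) + (u powr s / s + v powr s / s)" by simp
  then have "s * (m powr s * 2) \<le> s * (u powr s + v powr s)" using assms by (simp add: field_simps)
  then have "m powr s * 2 \<le> u powr s + v powr s" by (rule mult_left_le_imp_le) (use assms in auto)
  then show ?thesis by (simp add: m_def)
qed

text \<open>The parallelogram law raised to the power s = q / 2: superadditivity on one side,
  convexity on the other. Both need s >= 1, which is where q >= 2 comes from.\<close>

lemma clarkson_pointwise:
  fixes a b :: complex
  assumes "q \<ge> 2"
  shows "norm ((a + b) / 2) powr q + norm ((a - b) / 2) powr q \<le> (norm a powr q + norm b powr q) / 2"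
proof -
  define s where "s = q / 2"
  have s: "s \<ge> 1" using assms by (simp add: s_def)
  have sq: "norm x powr q = ((norm x)\<^sup>2) powr s" for x :: complex
  proof (cases "x = 0")
    case False
    then have "(norm x)\<^sup>2 = norm x powr 2" by (simp add: powr_numeral)
    then show ?thesis by (simp only: powr_powr) (simp add: s_def)
  qed (use s in auto)
  have par: "(norm ((a + b) / 2))\<^sup>2 + (norm ((a - b) / 2))\<^sup>2 = ((norm a)\<^sup>2 + (norm b)\<^sup>2) / 2"
    by (simp add: cmod_power2 power_divide norm_divide) (simp add: power2_eq_square field_simps)
  have "norm ((a + b) / 2) powr q + norm ((a - b) / 2) powr q \<le> (((norm a)\<^sup>2 + (norm b)\<^sup>2) / 2) powr s"
    unfolding sq par[symmetric] by (rule powr_superadditive) (use s in auto)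
  also have "\<dots> \<le> (norm a powr q + norm b powr q) / 2"
    unfolding sq by (rule powr_midpoint_convex) (use s in auto)
  finally show ?thesis .
qed

text \<open>The two suprema on the left could belong to different radii. Monotonicity of the circle
  means allows a common radius, and the two suprema are then taken one after the other.\<close>

lemma hsup_clarkson:
  assumes f: "hardy_fun q f" and g: "hardy_fun q g" and q: "q \<ge> 2"
  shows "hsup q (\<lambda>z. (f z + g z) / 2) + hsup q (\<lambda>z. (f z - g z) / 2) \<le> (hsup q f + hsup q g) / 2"
    and "hardy_fun q (\<lambda>z. (f z + g z) / 2)" "hardy_fun q (\<lambda>z. (f z - g z) / 2)"
proof -
  let ?u = "\<lambda>z. (f z + g z) / 2" and ?v = "\<lambda>z. (f z - g z) / 2"
  show u: "hardy_fun q ?u" and v: "hardy_fun q ?v"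
    using hardy_fun_scale(1)[OF hardy_fun_add(1)[OF f g], of "1/2"]
      hardy_fun_scale(1)[OF hardy_fun_diff(1)[OF f g], of "1/2"] q by auto
  have "circle_mean q ?u r + circle_mean q ?v r' \<le> (hsup q f + hsup q g) / 2" if r: "0 < r" "r < 1" "0 < r'" "r' < 1" for r r'
  proof -
    \<comment> \<open>Means grow with the radius, so both are compared at the larger one.\<close>
    let ?s = "max r r'"
    have s: "0 < ?s" "?s < 1" using r by auto
    let ?n = "\<lambda>f \<theta>. norm (f (of_real ?s * cis \<theta>)) powr q"
    have int: "(?n h) integrable_on {0..2*pi}" if "hardy_fun q h" for h
      using circle_mean_integrable[OF hardy_fun_continuous[OF that]] s q by auto
    have "circle_mean q ?u r + circle_mean q ?v r' \<le> circle_mean q ?u ?s + circle_mean q ?v ?s"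
      using circle_mean_mono[OF hardy_fun_holomorphic[OF u], of q r ?s]
        circle_mean_mono[OF hardy_fun_holomorphic[OF v], of q r' ?s] r q by auto
    also have "\<dots> = integral {0..2*pi} (\<lambda>t. ?n ?u t + ?n ?v t)"
      unfolding circle_mean_def by (rule integral_add[symmetric, OF int[OF u] int[OF v]])
    also have "\<dots> \<le> integral {0..2*pi} (\<lambda>t. (?n f t + ?n g t) * (1/2))"
    proof (rule integral_le)
      show "?n ?u t + ?n ?v t \<le> (?n f t + ?n g t) * (1/2)" for t
        using clarkson_pointwise[OF q] by simp
    qed (intro integrable_add integrable_on_mult_left int f g u v)+
    also have "\<dots> = (circle_mean q f ?s + circle_mean q g ?s) / 2"
      unfolding circle_mean_def by (simp add: integral_add[OF int[OF f] int[OF g]])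
    also have "\<dots> \<le> (hsup q f + hsup q g) / 2"
      using circle_mean_le_hsup[OF f s] circle_mean_le_hsup[OF g s] by simp
    finally show ?thesis .
  qed
  note le = this
  have "hsup q ?u \<le> (hsup q f + hsup q g) / 2 - circle_mean q ?v r'" if r': "0 < r'" "r' < 1" for r'
  proof (rule hsup_le)
    show "circle_mean q ?u r \<le> (hsup q f + hsup q g) / 2 - circle_mean q ?v r'" if "0 < r" "r < 1" for r
      using le[OF that r'] by linarith
  qed
  note le = this
  have "hsup q ?v \<le> (hsup q f + hsup q g) / 2 - hsup q ?u"
  proof (rule hsup_le)
    show "circle_mean q ?v r' \<le> (hsup q f + hsup q g) / 2 - hsup q ?u" if "0 < r'" "r' < 1" for r'
      using le[OF that] by linarith
  qed
  then show "hsup q ?u + hsup q ?v \<le> (hsup q f + hsup q g) / 2" by linarith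
qed

text \<open>Midpoints alone, rather than all convex combinations, fit Clarkson's inequality and
  suffice for nearly minimal elements.\<close>

inductive_set midhull :: "(complex \<Rightarrow> complex) set \<Rightarrow> (complex \<Rightarrow> complex) set" for S where
  base: "f \<in> S \<Longrightarrow> f \<in> midhull S"
| mid: "f \<in> midhull S \<Longrightarrow> g \<in> midhull S \<Longrightarrow> (\<lambda>z. (f z + g z) / 2) \<in> midhull S"

lemma midhull_mono: "S \<subseteq> T \<Longrightarrow> midhull S \<subseteq> midhull T"
proof
  fix f assume "S \<subseteq> T" "f \<in> midhull S"
  from this(2) show "f \<in> midhull T"
    by induction (use \<open>S \<subseteq> T\<close> in \<open>auto intro: midhull.intros\<close>)
qed

lemma midhull_hardy:
  assumes "u \<in> midhull S" "\<And>f. f \<in> S \<Longrightarrow> hardy_fun q f" "\<And>f. f \<in> S \<Longrightarrow> hsup q f \<le> C" "q \<ge> 2"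
  shows "hardy_fun q u \<and> hsup q u \<le> C"
  using assms(1)
proof induction
  case (mid f g)
  then show ?case
    using hsup_clarkson[of q f g] hsup_nonneg[OF hsup_clarkson(3)[of q f g]] assms(4) by auto
qed (use assms in auto)

lemma midhull_norm_le:
  assumes "u \<in> midhull S" "\<And>f. f \<in> S \<Longrightarrow> norm (f z) \<le> e"
  shows "norm (u z) \<le> e"
  using assms(1)
proof induction
  case (mid f g)
  then have "norm (f z + g z) \<le> 2 * e" using norm_triangle_ineq[of "f z" "g z"] by linarith
  then show ?case by (simp add: norm_divide)
qed (use assms in auto)

(* Radon-Riesz by uniform convexity: elements of nearly minimal norm in the tails of the hull
   form a Cauchy sequence, whose pointwise limit is 0. *)
lemma midhull_small:
  assumes q: "q \<ge> 2" and F: "\<And>n. hardy_fun q (F n)" "\<And>n. hsup q (F n) \<le> C"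
    and lim: "\<And>z. z \<in> \<D> \<Longrightarrow> (\<lambda>n. F n z) \<longlonglongrightarrow> 0" and e: "e > 0"
  obtains u where "u \<in> midhull (range F)" "hsup q u < e"
proof -
  define T where "T N = midhull (F ` {N..})" for N :: nat
  have T: "hardy_fun q u" "hsup q u \<le> C" if "u \<in> T N" for u N
    using midhull_hardy[of u "F ` {N..}" q C] that F q by (auto simp: T_def)
  have Tne: "F N \<in> T N" for N by (auto simp: T_def intro: midhull.base)
  have Tmono: "T M \<subseteq> T N" if "N \<le> M" for M N
    unfolding T_def by (rule midhull_mono) (use that in auto)
  \<comment> \<open>The least value of \<open>hsup\<close> on the hull of the N-th tail; it grows
    with N and stays below C.\<close>
  define d where "d N = (INF u\<in>T N. hsup q u)" for N
  have bdd: "bdd_below (hsup q ` T N)" for N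
    by (rule bdd_belowI[of _ 0]) (use T(1) hsup_nonneg in auto)
  have dle: "d N \<le> hsup q u" if "u \<in> T N" for N u
    unfolding d_def by (rule cINF_lower[OF bdd that])
  have dC: "d N \<le> C" for N using dle[OF Tne] F(2) by (meson order_trans)
  have bddd: "bdd_above (range d)" using dC by (intro bdd_aboveI[of _ C]) auto
  \<comment> \<open>The final estimate is 2^q * 2 * \<eta> = e / 2.\<close>
  define \<eta> where "\<eta> = e / (2 powr q * 4)"
  have \<eta>: "\<eta> > 0" using e by (simp add: \<eta>_def)
  have near: "\<exists>u\<in>T N. hsup q u < d N + \<eta>" for N
    using cInf_lessD[of "hsup q ` T N" "d N + \<eta>"] Tne \<eta> by (auto simp: d_def)
  \<comment> \<open>So late that no tail has an infimum of d N + \<eta> or more.\<close>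
  obtain N where N: "(SUP n. d n) - \<eta> < d N"
    using less_cSUP_iff[OF _ bddd, of "(SUP n. d n) - \<eta>"] \<eta> by auto
  have dN: "d M < d N + \<eta>" for M
    using cSUP_upper[OF _ bddd, of M] N by auto
  obtain u where u: "u \<in> T N" "hsup q u < d N + \<eta>" using near by blast
  obtain v where v: "\<And>M. v M \<in> T M" "\<And>M. hsup q (v M) < d M + \<eta>" using near by metis
  have "circle_mean q u r \<le> 2 powr q * (2 * \<eta>)" if r: "0 < r" "r < 1" for r
  proof -
    \<comment> \<open>Clarkson bounds these half-differences by the average of two nearly minimal
      values minus the value at the midpoint, which lies in T N and therefore costs at least d
      N.\<close>
    define G where "G k = (\<lambda>z. (u z - v (N + k) z) / 2)" for k
    have hG: "hardy_fun q (G k)" for k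
      unfolding G_def by (rule hsup_clarkson(3)[OF T(1)[OF u(1)] T(1)[OF v(1)] q])
    have Gle: "circle_mean q (G k) r \<le> 2 * \<eta>" for k
    proof -
      have vk: "v (N + k) \<in> T N" using v(1) Tmono[of N "N + k"] by auto
      have "d N \<le> hsup q (\<lambda>z. (u z + v (N + k) z) / 2)"
        by (rule dle) (use u vk in \<open>auto simp: T_def intro: midhull.mid\<close>)
      then have "hsup q (G k) \<le> (hsup q u + hsup q (v (N + k))) / 2 - d N"
        using hsup_clarkson(1)[OF T(1)[OF u(1)] T(1)[OF v(1)[of "N + k"]] q] unfolding G_def by linarith
      also have "\<dots> \<le> 2 * \<eta>" 
      proof -
        have *: "a < x + h \<Longrightarrow> b < y + h \<Longrightarrow> y < x + h \<Longrightarrow> 0 < h \<Longrightarrow> (a + b) / 2 - x \<le> 2 * h" for a b x y h :: real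
          by (simp add: field_simps)
        show ?thesis by (rule *[OF u(2) v(2)[of "N + k"] dN[of "N + k"] \<eta>])
      qed
      finally show ?thesis using circle_mean_le_hsup[OF hG r, of k] by simp
    qed
    have "C \<ge> 0" using hsup_nonneg[OF F(1)] F(2) by (meson order_trans)
    define K where "K = (1 + C) / ((1 - r) / 2)"
    have bound: "norm (f z) \<le> K" if "norm z = r" "hardy_fun q f" "hsup q f \<le> C" for f z
    proof -
      have "norm (f z) \<le> (1 + hsup q f) / ((1 - r) / 2)"
        using hardy_point_bound[OF that(2), of z 1] that(1) r q by simp
      also have "\<dots> \<le> K"
        unfolding K_def using r that by (intro divide_right_mono) auto
      finally show ?thesis .
    qed
    have "(\<lambda>k. circle_mean q (G k) r) \<longlonglongrightarrow> circle_mean q (\<lambda>z. (u z - 0) / 2) r"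
    proof (rule circle_mean_limit)
      show "continuous_on \<D> (G k)" for k by (rule hardy_fun_continuous[OF hG])
      show "norm (G k z) \<le> K" if "norm z = r" for k z
        using norm_triangle_ineq4[of "u z" "v (N + k) z"] bound[OF that T[OF u(1)]] bound[OF that T[OF v(1)[of "N + k"]]]
        by (simp add: G_def norm_divide)
      show "(\<lambda>k. G k z) \<longlonglongrightarrow> (u z - 0) / 2" if "norm z = r" for z
      proof -
        \<comment> \<open>Members of the M-th hull are repeated midpoints of functions F n with n >=
          M and inherit every bound on the values of these at z.\<close>
        have "(\<lambda>M. v M z) \<longlonglongrightarrow> 0"
        proof (rule LIMSEQ_I)
          fix e' :: real assume "e' > 0"
          then have "\<exists>M0. \<forall>M\<ge>M0. norm (F M z - 0) < e' / 2"
            using LIMSEQ_D[OF lim, of z "e'/2"] that r by auto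
          then obtain M0 where M0: "\<And>M. M \<ge> M0 \<Longrightarrow> norm (F M z) < e' / 2" by auto
          have "norm (v M z) \<le> e' / 2" if "M \<ge> M0" for M
            by (rule midhull_norm_le[of _ "F ` {M..}"]) (use v(1)[of M] M0 that in \<open>auto simp: T_def less_imp_le\<close>)
          then show "\<exists>no. \<forall>n\<ge>no. norm (v n z - 0) < e'"
            using \<open>e' > 0\<close> by (intro exI[of _ M0]) (fastforce)
        qed
        then have "(\<lambda>k. v (N + k) z) \<longlonglongrightarrow> 0"
          using LIMSEQ_ignore_initial_segment[of "\<lambda>M. v M z" 0 N] by (simp add: add.commute)
        then show ?thesis unfolding G_def by (intro tendsto_intros) auto
      qed
    qed (use r q in auto)
    then have "circle_mean q (\<lambda>z. (u z - 0) / 2) r \<le> 2 * \<eta>"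
      by (rule LIMSEQ_le_const2) (use Gle in auto)
    moreover have "circle_mean q u r = 2 powr q * circle_mean q (\<lambda>z. (u z - 0) / 2) r"
      using circle_mean_scale[of q 2 "\<lambda>z. (u z - 0) / 2" r] by simp
    ultimately show ?thesis by (simp add: mult_left_mono)
  qed
  then have "hsup q u \<le> 2 powr q * (2 * \<eta>)" by (intro hsup_le)
  also have "\<dots> < e" using e by (simp add: \<eta>_def)
  finally show thesis using that[of u] u(1) Tmono[of 0 N] by (auto simp: T_def atLeast_0)
qed

section \<open>Dilations, and density of bounded functions for exponents at least 2\<close>

lemma dilation_sequence:
  obtains \<rho> :: "nat \<Rightarrow> real" where "\<And>n. 0 < \<rho> n" "\<And>n. \<rho> n < 1" "\<rho> \<longlonglongrightarrow> 1"
    "\<And>n z. z \<in> \<D> \<Longrightarrow> of_real (\<rho> n) * z \<in> \<D>"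
proof -
  define \<rho> where "\<rho> n = 1 - 1 / real (n + 2)" for n
  have \<rho>: "0 < \<rho> n" "\<rho> n < 1" for n by (auto simp: \<rho>_def field_simps)
  have "\<rho> \<longlonglongrightarrow> 1 - 0" unfolding \<rho>_def
    by (intro tendsto_diff tendsto_const LIMSEQ_ignore_initial_segment[of "\<lambda>n. 1 / real n" 0 2] lim_1_over_n)
  then have "\<rho> \<longlonglongrightarrow> 1" by simp
  moreover have "of_real (\<rho> n) * z \<in> \<D>" if "z \<in> \<D>" for n z
    using that \<rho>[of n] mult_strict_mono'[of "\<rho> n" 1 "norm z" 1] by (auto simp: norm_mult)
  ultimately show thesis using that \<rho> by blast
qed

lemma dilation_tendsto:
  assumes f: "continuous_on \<D> f" and \<rho>: "\<rho> \<longlonglongrightarrow> 1" "\<And>n. of_real (\<rho> n) * z \<in> \<D>" and z: "z \<in> \<D>"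
  shows "(\<lambda>n. f (of_real (\<rho> n) * z)) \<longlonglongrightarrow> f z"
proof -
  have "(\<lambda>n. of_real (\<rho> n) * z) \<longlonglongrightarrow> of_real 1 * z" by (intro tendsto_intros \<rho>)
  then show ?thesis by (intro continuous_on_tendsto_compose[OF f]) (use \<rho>(2) z in auto)
qed

text \<open>The dilates of f are bounded functions with \<open>hsup\<close> at most that of f, and
  they converge to f pointwise. \<open>midhull_small\<close> upgrades this to norm convergence of
  averages, and averages of f - B n are again f minus a bounded function.\<close>

lemma bhol_dense_ge2:
  assumes q: "q \<ge> 2" and f: "hardy_fun q f" and e: "e > 0"
  obtains b where "bhol b" "hsup q (\<lambda>z. f z - b z) < e"
proof -
  obtain \<rho> :: "nat \<Rightarrow> real" where \<rho>: "\<And>n. 0 < \<rho> n" "\<And>n. \<rho> n < 1" and \<rho>1: "\<rho> \<longlonglongrightarrow> 1"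
    and in_disc: "\<And>n z. z \<in> \<D> \<Longrightarrow> of_real (\<rho> n) * z \<in> \<D>"
    using dilation_sequence by blast
  define B where "B n z = f (of_real (\<rho> n) * z)" for n z
  have holB: "B n holomorphic_on \<D>" for n
    unfolding B_def
    by (rule holomorphic_on_compose_gen[OF _ hardy_fun_holomorphic[OF f], unfolded o_def])
       (use in_disc in \<open>auto intro!: holomorphic_intros\<close>)
  have bholB: "bhol (B n)" for n
  proof -
    have "compact (cball (0::complex) (\<rho> n))" "cball 0 (\<rho> n) \<subseteq> \<D>" using \<rho>[of n] by auto
    then have "bounded (f ` cball 0 (\<rho> n))"
      using hardy_fun_continuous[OF f] compact_continuous_image compact_imp_bounded continuous_on_subset by metis
    then obtain M where M: "\<And>z. norm z \<le> \<rho> n \<Longrightarrow> norm (f z) \<le> M" by (fastforce simp: bounded_iff)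
    have "norm (B n z) \<le> M" if "z \<in> \<D>" for z
      unfolding B_def using that \<rho>[of n] by (intro M) (auto simp: norm_mult mult_left_le)
    then show ?thesis using holB unfolding bhol_def by blast
  qed
  \<comment> \<open>Dilating only shrinks the radius of the circle.\<close>
  have cmB: "circle_mean q (B n) r = circle_mean q f (\<rho> n * r)" for n r
    by (simp add: circle_mean_def B_def mult.assoc)
  have hsB: "hsup q (B n) \<le> hsup q f" for n
    using circle_mean_le_hsup[OF f] \<rho>[of n] mult_strict_mono'[of "\<rho> n" 1 _ 1]
    by (intro hsup_le) (simp add: cmB)
  define F where "F n = (\<lambda>z. f z - B n z)" for n
  have hB: "hardy_fun q (B n)" for n using bhol_hardy[OF bholB] q by auto
  have F: "hardy_fun q (F n)" "hsup q (F n) \<le> 2 powr q * (hsup q f + hsup q f)" for n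
  proof -
    show "hardy_fun q (F n)" unfolding F_def by (rule hardy_fun_diff(1)[OF f hB]) (use q in auto)
    have "hsup q (F n) \<le> 2 powr q * (hsup q f + hsup q (B n))"
      unfolding F_def by (rule hardy_fun_diff(2)[OF f hB]) (use q in auto)
    also have "\<dots> \<le> 2 powr q * (hsup q f + hsup q f)" using hsB by (intro mult_left_mono) auto
    finally show "hsup q (F n) \<le> 2 powr q * (hsup q f + hsup q f)" .
  qed
  have lim: "(\<lambda>n. F n z) \<longlonglongrightarrow> 0" if z: "z \<in> \<D>" for z
  proof -
    have "(\<lambda>n. f (of_real (\<rho> n) * z)) \<longlonglongrightarrow> f z"
      by (rule dilation_tendsto[OF hardy_fun_continuous[OF f] \<rho>1 in_disc[OF z] z])
    then have "(\<lambda>n. f z - B n z) \<longlonglongrightarrow> f z - f z" unfolding B_def by (intro tendsto_intros)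
    then show ?thesis by (simp add: F_def)
  qed
  obtain u where u: "u \<in> midhull (range F)" "hsup q u < e"
    using midhull_small[OF q F lim e] by blast
  from u(1) have "\<exists>b. bhol b \<and> u = (\<lambda>z. f z - b z)"
  proof induction
    case (base g)
    then show ?case using bholB by (auto simp: F_def)
  next
    case (mid g h)
    then obtain b c where b: "bhol b" "g = (\<lambda>z. f z - b z)" and c: "bhol c" "h = (\<lambda>z. f z - c z)" by blast
    have "bhol (\<lambda>z. (1/2) * (b z + c z))"
      by (intro bhol_mult bhol_add bhol_const b c)
    moreover have "(\<lambda>z. (g z + h z) / 2) = (\<lambda>z. f z - (1/2) * (b z + c z))"
      by (auto simp: b c field_simps)
    ultimately show ?case by blast
  qed
  then show thesis using that u(2) by auto
qed

section \<open>Continuity for bounded pointwise limits\<close>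

lemma hsup_small_power:
  assumes "0 < p" "p \<le> q" "e > 0"
  obtains e' where "e' > 0" "\<And>u. hardy_fun q u \<Longrightarrow> hsup q u < e' \<Longrightarrow> hsup p u < e"
proof -
  \<comment> \<open>Fixed first, so that the part below the threshold contributes e / 4; then e'
    leaves e / 2 for the part above it.\<close>
  define d where "d = (e / (8 * pi)) powr (1 / p)"
  have d: "d > 0" "2 * pi * d powr p = e / 4"
    using assms by (auto simp: d_def powr_powr)
  define e' where "e' = e / (2 * d powr (p - q))"
  have e': "e' > 0" "d powr (p - q) * e' = e / 2" using d assms by (auto simp: e'_def)
  show thesis
  proof (rule that[OF e'(1)])
    fix u assume u: "hardy_fun q u" "hsup q u < e'"
    have "hsup p u \<le> d powr (p - q) * hsup q u + 2 * pi * d powr p"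
      by (rule hsup_power_le(2)[OF u(1) assms(1,2) d(1)])
    also have "d powr (p - q) * hsup q u \<le> d powr (p - q) * e'" using u by (intro mult_left_mono) auto
    finally show "hsup p u < e" using e' d assms by linarith
  qed
qed

lemma midhull_bhol:
  assumes "u \<in> midhull S" "\<And>f. f \<in> S \<Longrightarrow> bhol f"
  shows "bhol u"
  using assms(1)
proof induction
  case (mid f g)
  have "bhol (\<lambda>z. (1/2) * (f z + g z))" by (intro bhol_mult bhol_add bhol_const mid)
  then show ?case by simp
qed (use assms in auto)

lemma cnj_sgn_mult: "cnj (sgn x) * x = of_real (norm x)"
proof (cases "x = 0")
  case False
  then show ?thesis using complex_norm_square[of x] by (simp add: sgn_eq field_simps power2_eq_square)
qed auto

(* A subsequence of values bounded away from 0 can be rotated to the positive real axis;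
   this survives averaging and contradicts the small elements of the hull. *)
lemma functional_bp_continuous:
  fixes l :: "(complex \<Rightarrow> complex) \<Rightarrow> complex"
  assumes p: "p > 0"
    and add: "\<And>f g. bhol f \<Longrightarrow> bhol g \<Longrightarrow> l (\<lambda>z. f z + g z) = l f + l g"
    and scale: "\<And>c f. bhol f \<Longrightarrow> l (\<lambda>z. c * f z) = c * l f"
    and cont: "\<And>F. (\<And>n. bhol (F n)) \<Longrightarrow> (\<lambda>n. hsup p (F n)) \<longlonglongrightarrow> 0 \<Longrightarrow> (\<lambda>n. l (F n)) \<longlonglongrightarrow> 0"
    and F: "\<And>n. F n holomorphic_on \<D>" "\<And>n z. z \<in> \<D> \<Longrightarrow> norm (F n z) \<le> M"
    and lim: "\<And>z. z \<in> \<D> \<Longrightarrow> (\<lambda>n. F n z) \<longlonglongrightarrow> 0"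
  shows "(\<lambda>n. l (F n)) \<longlonglongrightarrow> 0"
proof (rule ccontr)
  assume "\<not> (\<lambda>n. l (F n)) \<longlonglongrightarrow> 0"
  then obtain e where e: "e > 0" and "\<And>N. \<exists>n\<ge>N. norm (l (F n)) \<ge> e"
    by (auto simp: LIMSEQ_iff not_less)
  then obtain s where s: "\<And>N. s N \<ge> N" "\<And>N. norm (l (F (s N))) \<ge> e" by metis
  \<comment> \<open>Uniform convexity acts in H^q with q >= 2, where the bounded sequence also
    lives; smallness is then carried down to H^p.\<close>
  define q where "q = max p 2"
  have q: "q \<ge> 2" "p \<le> q" by (auto simp: q_def)
  define G where "G N = (\<lambda>z. cnj (sgn (l (F (s N)))) * F (s N) z)" for N
  have bF: "bhol (F n)" for n using F unfolding bhol_def by blast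
  have bG: "bhol (G N)" for N
    unfolding G_def by (intro bhol_mult bhol_const bF)
  have nG: "norm (G N z) \<le> M" if "z \<in> \<D>" for N z
    using F(2)[OF that, of "s N"] norm_ge_zero[of "F (s N) z"] by (auto simp: G_def norm_mult norm_sgn simp del: norm_ge_zero)
  have lG: "Re (l (G N)) \<ge> e" for N
  proof -
    have "l (G N) = of_real (norm (l (F (s N))))"
      unfolding G_def scale[OF bF] by (rule cnj_sgn_mult)
    then show ?thesis using s(2)[of N] by simp
  qed
  have limG: "(\<lambda>N. G N z) \<longlonglongrightarrow> 0" if "z \<in> \<D>" for z
  proof (rule Lim_null_comparison)
    show "\<forall>\<^sub>F N in sequentially. norm (G N z) \<le> norm (F (s N) z)"
      by (auto simp: G_def norm_mult norm_sgn)
    have "filterlim s at_top sequentially"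
      by (rule filterlim_at_top_mono[OF filterlim_ident]) (use s in auto)
    then show "(\<lambda>N. norm (F (s N) z)) \<longlonglongrightarrow> 0"
      using filterlim_compose[OF tendsto_norm_zero[OF lim[OF that]]] by blast
  qed
  have hG: "hardy_fun q (G N)" "hsup q (G N) \<le> 2 * pi * M powr q" for N
    using hardy_fun_bounded[of "G N" M q] nG bG[of N] q by (auto simp: bhol_def)
  have "\<exists>u\<in>midhull (range G). hsup p u < 1 / real (m + 1)" for m
  proof -
    obtain e' where e': "e' > 0" "\<And>u. hardy_fun q u \<Longrightarrow> hsup q u < e' \<Longrightarrow> hsup p u < 1 / real (m + 1)"
      using hsup_small_power[OF p q(2), of "1 / real (m + 1)"] by auto
    obtain u where u: "u \<in> midhull (range G)" "hsup q u < e'"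
      using midhull_small[OF q(1) hG limG e'(1)] by blast
    have "hardy_fun q u" using midhull_hardy[OF u(1), of q] hG q by auto
    then show ?thesis using e'(2) u by blast
  qed
  then obtain u where u: "\<And>m. u m \<in> midhull (range G)" "\<And>m. hsup p (u m) < 1 / real (m + 1)" by metis
  have bu: "bhol (u m)" for m by (rule midhull_bhol[OF u(1)]) (use bG in auto)
  have "(\<lambda>m. hsup p (u m)) \<longlonglongrightarrow> 0"
  proof (rule tendsto_sandwich[of "\<lambda>m. 0"])
    show "\<forall>\<^sub>F m in sequentially. 0 \<le> hsup p (u m)" using hsup_nonneg[OF bhol_hardy[OF bu p]] by simp
    show "\<forall>\<^sub>F m in sequentially. hsup p (u m) \<le> 1 / real (m + 1)" using u(2) by (simp add: less_imp_le)
    show "(\<lambda>m. 1 / real (m + 1)) \<longlonglongrightarrow> 0"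
      by (rule LIMSEQ_ignore_initial_segment[of "\<lambda>n. 1 / real n" 0 1, OF lim_1_over_n])
  qed simp
  then have "(\<lambda>m. l (u m)) \<longlonglongrightarrow> 0" by (rule cont[OF bu])
  then have "(\<lambda>m. Re (l (u m))) \<longlonglongrightarrow> 0" using tendsto_Re by fastforce
  moreover have "Re (l v) \<ge> e \<and> bhol v" if "v \<in> midhull (range G)" for v
    using that
  proof induction
    case (mid f g)
    have "l (\<lambda>z. (1/2) * (f z + g z)) = (1/2) * (l f + l g)"
      using mid by (subst scale) (auto intro: bhol_add simp: add)
    then have eq: "l (\<lambda>z. (f z + g z) / 2) = (l f + l g) / 2" by simp
    have "bhol (\<lambda>z. (1/2) * (f z + g z))" using mid by (intro bhol_mult bhol_add bhol_const) auto
    then show ?case unfolding eq using mid by simp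
  qed (use lG bG in auto)
  then have "e \<le> Re (l (u m))" for m using u(1) by blast
  ultimately have "e \<le> 0" by (intro LIMSEQ_le_const[of "\<lambda>m. Re (l (u m))" 0 e]) auto
  then show False using e by simp
qed

section \<open>Blaschke factors\<close>

lemma moebius_norm_identity:
  "(norm (1 - cnj a * z))\<^sup>2 - (norm (z - a))\<^sup>2 = (1 - (norm a)\<^sup>2) * (1 - (norm z)\<^sup>2)"
  by (simp add: cmod_power2) (simp add: power2_eq_square algebra_simps)

lemma moebius_norm_le:
  assumes "norm a < 1" "norm z \<le> 1"
  shows "norm (z - a) \<le> norm (1 - cnj a * z)" "1 - cnj a * z \<noteq> 0"
    and "norm z = 1 \<Longrightarrow> norm (1 - cnj a * z) = norm (z - a)"
proof -
  have sq: "(norm a)\<^sup>2 \<le> 1" "(norm z)\<^sup>2 \<le> 1" using assms by (auto simp: abs_square_le_1)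
  have "(norm (z - a))\<^sup>2 \<le> (norm (1 - cnj a * z))\<^sup>2"
  proof -
    have "0 \<le> (1 - (norm a)\<^sup>2) * (1 - (norm z)\<^sup>2)" using sq by (intro mult_nonneg_nonneg) auto
    then show ?thesis using moebius_norm_identity[of a z] by linarith
  qed
  then show "norm (z - a) \<le> norm (1 - cnj a * z)" by (rule power2_le_imp_le) auto
  show "norm (1 - cnj a * z) = norm (z - a)" if "norm z = 1"
    using moebius_norm_identity[of a z] that by (simp add: power2_eq_iff_nonneg)
  have "norm (cnj a * z) < 1" using assms mult_le_one[of "norm z" "norm a"]
    by (simp add: norm_mult) (metis mult.commute mult_left_le norm_ge_zero order_le_less_trans)
  then show "1 - cnj a * z \<noteq> 0" by auto
qed

text \<open>Induction on the number of zeros in the open disc: each zero is traded for a Blaschke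
  factor, whose modulus on the circle is 1. The room beyond the circle, R > 1, keeps the number of
  zeros finite and gives meaning to values on the circle.\<close>

lemma blaschke_division:
  assumes "F holomorphic_on ball 0 R" "R > 1" "\<exists>z\<in>ball 0 R. F z \<noteq> 0"
  shows "\<exists>G B. G holomorphic_on ball 0 R \<and> B holomorphic_on \<D> \<and> (\<forall>z\<in>\<D>. G z \<noteq> 0 \<and> norm (B z) \<le> 1 \<and> F z = B z * G z)
           \<and> (\<forall>z. norm z = 1 \<longrightarrow> norm (G z) = norm (F z))"
  using assms
proof (induction "card {z \<in> \<D>. F z = 0}" arbitrary: F rule: less_induct)
  case less
  \<comment> \<open>A zero together with a nonzero value excludes constancy, and a nonconstant
    function has finitely many zeros in the compact disc.\<close>
  have fin: "finite {z \<in> \<D>. F z = 0}" if "\<exists>z\<in>ball 0 R. F z \<noteq> 0" "\<exists>z\<in>ball 0 R. F z = 0"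
  proof -
    have "\<not> F constant_on ball 0 R" using that unfolding constant_on_def by metis
    then have "finite {z \<in> cball 0 1. F z = 0}"
      using holomorphic_compact_finite_zeros[OF less.prems(1), of "cball 0 1"] less.prems(2)
        by (simp add: subset_iff)
    then show ?thesis by (rule finite_subset[rotated]) auto
  qed
  show ?case
  proof (cases "\<exists>a\<in>\<D>. F a = 0")
    case False
    then show ?thesis
      by (intro exI[of _ F] exI[of _ "\<lambda>z. 1"]) (use less.prems in auto)
  next
    case True
    then obtain a where a: "norm a < 1" "F a = 0" by auto
    then have aR: "a \<in> ball 0 R" using less.prems by auto
    have nc: "\<not> F constant_on ball 0 R" using less.prems(3) aR a unfolding constant_on_def by metis
    obtain g r n where g: "0 < n" "0 < r" "ball a r \<subseteq> ball 0 R" "g holomorphic_on ball a r"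
      "\<And>w. w \<in> ball a r \<Longrightarrow> F w = (w - a) ^ n * g w" "\<And>w. w \<in> ball a r \<Longrightarrow> g w \<noteq> 0"
      by (rule holomorphic_factor_zero_nonconstant[OF less.prems(1) open_ball connected_ball aR a(2) nc]) blast
    \<comment> \<open>The quotient by (z - a)^n, with its removable singularity filled by the local
      factor.\<close>
    define g' where "g' z = (if z = a then g a else F z / (z - a) ^ n)" for z
    have "g' holomorphic_on (ball 0 R - {a}) \<union> ball a r"
    proof (rule holomorphic_on_Un)
      show "g' holomorphic_on ball 0 R - {a}"
        by (rule holomorphic_transform[of "\<lambda>z. F z / (z - a) ^ n"])
           (auto simp: g'_def intro!: holomorphic_intros holomorphic_on_subset[OF less.prems(1)])
      show "g' holomorphic_on ball a r"
        by (rule holomorphic_transform[OF g(4)]) (use g(5) in \<open>auto simp: g'_def\<close>)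
    qed auto
    then have hol: "g' holomorphic_on ball 0 R"
      by (rule holomorphic_on_subset) (use g(2) in auto)
    have Fg: "F z = (z - a) ^ n * g' z" for z
      using a(2) g(1) by (auto simp: g'_def)
    \<comment> \<open>The new factor restores the modulus on the unit circle and has no zero in the
      closed disc.\<close>
    define F1 where "F1 z = (1 - cnj a * z) ^ n * g' z" for z
    have hol1: "F1 holomorphic_on ball 0 R"
      unfolding F1_def by (intro holomorphic_intros hol)
    have zeros: "{z \<in> \<D>. F1 z = 0} \<subset> {z \<in> \<D>. F z = 0}"
    proof -
      have "F1 a \<noteq> 0" using g(6)[of a] g(2) moebius_norm_le(2)[OF a(1), of a] a by (auto simp: F1_def g'_def)
      moreover have "{z \<in> \<D>. F1 z = 0} \<subseteq> {z \<in> \<D>. F z = 0}"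
        using moebius_norm_le(2)[OF a(1)] by (auto simp: F1_def Fg)
      ultimately show ?thesis using a by auto
    qed
    have "finite {z \<in> \<D>. F z = 0}" using fin less.prems(3) aR a by blast
    then have "card {z \<in> \<D>. F1 z = 0} < card {z \<in> \<D>. F z = 0}" using zeros by (rule psubset_card_mono)
    moreover have "\<exists>z\<in>ball 0 R. F1 z \<noteq> 0"
    proof -
      have "a \<in> \<D> \<and> F1 a \<noteq> 0" using g(6)[of a] g(2) moebius_norm_le(2)[OF a(1), of a] a by (auto simp: F1_def g'_def)
      then show ?thesis using aR by blast
    qed
    ultimately obtain G B where GB: "G holomorphic_on ball 0 R" "B holomorphic_on \<D>"
      "\<And>z. z \<in> \<D> \<Longrightarrow> G z \<noteq> 0 \<and> norm (B z) \<le> 1 \<and> F1 z = B z * G z"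
      "\<And>z. norm z = 1 \<Longrightarrow> norm (G z) = norm (F1 z)"
      using less.hyps[OF _ hol1 less.prems(2)] by blast
    define b where "b z = ((z - a) / (1 - cnj a * z)) ^ n" for z
    have nz: "1 - cnj a * z \<noteq> 0" if "norm z \<le> 1" for z using moebius_norm_le(2)[OF a(1) that] .
    have "b holomorphic_on \<D>" unfolding b_def using nz by (intro holomorphic_intros) auto
    moreover have "norm (b z) \<le> 1" if "norm z \<le> 1" for z
      unfolding b_def norm_power norm_divide using moebius_norm_le(1)[OF a(1) that] nz[OF that]
      by (intro power_le_one) (auto simp: divide_le_eq)
    moreover have "F z = b z * F1 z" if "norm z \<le> 1" for z
      using nz[OF that] by (simp add: b_def F1_def Fg power_divide)
    moreover have "norm (F1 z) = norm (F z)" if "norm z = 1" for z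
      using moebius_norm_le(3)[OF a(1) _ that] that by (simp add: F1_def Fg norm_mult norm_power)
    ultimately show ?thesis
      using GB
      by (intro exI[of _ G] exI[of _ "\<lambda>z. b z * B z"])
         (auto intro!: holomorphic_intros simp: norm_mult mult_le_one)
  qed
qed

subsection \<open>Factorization and density of bounded functions\<close>

lemma holomorphic_sqrt_disc:
  assumes "G holomorphic_on \<D>" "\<And>z. z \<in> \<D> \<Longrightarrow> G z \<noteq> 0"
  obtains w where "w holomorphic_on \<D>" "\<And>z. z \<in> \<D> \<Longrightarrow> G z = (w z)\<^sup>2"
proof -
  have "simply_connected \<D>" by (simp add: convex_imp_simply_connected)
  then show thesis
    using assms that simply_connected_eq_holomorphic_sqrt[of \<D>] by auto
qed

text \<open>Montel's theorem under the growth c / (1 - |z|), the shape that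
  \<open>hardy_point_bound\<close> delivers.\<close>

lemma montel_disc:
  assumes hol: "\<And>n. F n holomorphic_on \<D>"
    and bd: "\<And>n z. z \<in> \<D> \<Longrightarrow> norm (F n z) \<le> c / (1 - norm z)"
  obtains g k where "g holomorphic_on \<D>" "strict_mono (k :: nat \<Rightarrow> nat)"
    "\<And>z. z \<in> \<D> \<Longrightarrow> (\<lambda>n. F (k n) z) \<longlonglongrightarrow> g z"
    "\<And>K. compact K \<Longrightarrow> K \<subseteq> \<D> \<Longrightarrow> uniform_limit K (F \<circ> k) g sequentially"
proof (rule Montel[of \<D> "range F" F])
  fix K assume K: "compact K" "K \<subseteq> \<D>"
  show "\<exists>B. \<forall>h\<in>range F. \<forall>z\<in>K. norm (h z) \<le> B"
  proof (cases "K = {}")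
    case False
    obtain x where x: "x \<in> K" "\<And>z. z \<in> K \<Longrightarrow> norm z \<le> norm x"
      using continuous_attains_sup[OF K(1) False continuous_on_norm_id] by auto
    have c: "c \<ge> 0" using bd[of 0 undefined] norm_ge_zero[of "F undefined 0"] by (simp del: norm_ge_zero)
    have "norm (F n z) \<le> c / (1 - norm x)" if "z \<in> K" for n z
    proof -
      have "norm (F n z) \<le> c / (1 - norm z)" using bd K that by auto
      also have "\<dots> \<le> c / (1 - norm x)" using x K c that by (intro divide_left_mono mult_pos_pos) auto
      finally show ?thesis .
    qed
    then show ?thesis by blast
  qed auto
next
  fix g r
  assume "g holomorphic_on \<D>" "strict_mono (r :: nat \<Rightarrow> nat)"
    "\<And>x. x \<in> \<D> \<Longrightarrow> (\<lambda>n. F (r n) x) \<longlonglongrightarrow> g x"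
    "\<And>K. compact K \<Longrightarrow> K \<subseteq> \<D> \<Longrightarrow> uniform_limit K (F \<circ> r) g sequentially"
  then show thesis by (rule that)
qed (use hol in auto)

text \<open>The dilate is holomorphic across the circle, so its zeros in the disc divide out as F =
  B G. With w a square root of G and v = B w, the identity |w|^(2p) = |G|^p hands the means of w
  over to those of f.\<close>

lemma hardy_factor_dilate:
  assumes f: "hardy_fun p f" and p: "1 \<le> p" and nz: "z0 \<in> \<D>" "f z0 \<noteq> 0" and \<rho>: "0 < \<rho>" "\<rho> < 1"
  obtains v w where "v holomorphic_on \<D>" "w holomorphic_on \<D>"
    "\<And>z. z \<in> \<D> \<Longrightarrow> f (of_real \<rho> * z) = v z * w z" "\<And>z. z \<in> \<D> \<Longrightarrow> norm (v z) \<le> norm (w z)"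
    "\<And>r. 0 < r \<Longrightarrow> r < 1 \<Longrightarrow> circle_mean (2 * p) w r \<le> hsup p f"
proof -
  define F where "F z = f (of_real \<rho> * z)" for z
  have inD: "of_real \<rho> * z \<in> \<D> \<longleftrightarrow> z \<in> ball 0 (1 / \<rho>)" for z
    using \<rho> by (auto simp: norm_mult field_simps)
  have holF: "F holomorphic_on ball 0 (1 / \<rho>)"
    unfolding F_def
    by (rule holomorphic_on_compose_gen[OF _ hardy_fun_holomorphic[OF f], unfolded o_def])
       (use inD in \<open>auto intro!: holomorphic_intros\<close>)
  have "F (z0 / of_real \<rho>) \<noteq> 0" using nz \<rho> by (simp add: F_def)
  moreover have "z0 / of_real \<rho> \<in> ball 0 (1 / \<rho>)" using nz \<rho> by (simp add: norm_divide divide_strict_right_mono)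
  ultimately have "\<exists>z\<in>ball 0 (1 / \<rho>). F z \<noteq> 0" by blast
  moreover have R: "1 / \<rho> > 1" using \<rho> by simp
  ultimately obtain G B where GB: "G holomorphic_on ball 0 (1 / \<rho>)" "B holomorphic_on \<D>"
      "\<And>z. z \<in> \<D> \<Longrightarrow> G z \<noteq> 0 \<and> norm (B z) \<le> 1 \<and> F z = B z * G z"
      "\<And>z. norm z = 1 \<Longrightarrow> norm (G z) = norm (F z)"
    using blaschke_division[OF holF] by blast
  have "G holomorphic_on \<D>" by (rule holomorphic_on_subset[OF GB(1)]) (use R in auto)
  then obtain w where w: "w holomorphic_on \<D>" "\<And>z. z \<in> \<D> \<Longrightarrow> G z = (w z)\<^sup>2"
    using holomorphic_sqrt_disc GB(3) by metis
  show thesis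
  proof (rule that[of "\<lambda>z. B z * w z" w])
    fix r :: real assume r: "0 < r" "r < 1"
    have "norm (w z) powr (2 * p) = norm (G z) powr p" if "z \<in> \<D>" for z
    proof (cases "w z = 0")
      case False
      have "norm (G z) = norm (w z) powr 2" using w(2)[OF that] False by (simp add: norm_power powr_numeral)
      then show ?thesis by (simp only: powr_powr)
    qed (use w that in simp)
    then have "circle_mean (2 * p) w r = circle_mean p G r"
      unfolding circle_mean_def using circle_in_disc[of r] r by simp
    \<comment> \<open>G lives on a larger disc, and on the unit circle its modulus is that of
      F.\<close>
    also have "\<dots> \<le> circle_mean p G 1"
      by (rule circle_mean_mono[OF GB(1) p]) (use r R in auto)
    also have "\<dots> = circle_mean p f \<rho>"
      unfolding circle_mean_def using GB(4) by (simp add: F_def)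
    also have "\<dots> \<le> hsup p f" by (rule circle_mean_le_hsup[OF f \<rho>])
    finally show "circle_mean (2 * p) w r \<le> hsup p f" .
  qed (use GB w in \<open>auto intro!: holomorphic_intros simp: F_def[symmetric] norm_mult mult_left_le_one_le power2_eq_square\<close>)
qed

text \<open>The Riesz factorization, as a Montel limit of factorizations of dilates. Its purpose is
  to double the exponent, since 2p >= 2 falls under uniform convexity.\<close>

lemma hardy_factor:
  assumes f: "hardy_fun p f" and p: "1 \<le> p"
  obtains v w where "hardy_fun (2 * p) v" "hardy_fun (2 * p) w" "\<And>z. z \<in> \<D> \<Longrightarrow> f z = v z * w z"
proof (cases "\<exists>z\<in>\<D>. f z \<noteq> 0")
  case False
  then show thesis using that[of "\<lambda>z. 0" "\<lambda>z. 0"] bhol_hardy[OF bhol_const[of 0], of "2 * p"] p by auto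
next
  case True
  then obtain z0 where z0: "z0 \<in> \<D>" "f z0 \<noteq> 0" by blast
  obtain \<rho> :: "nat \<Rightarrow> real" where \<rho>: "\<And>n. 0 < \<rho> n" "\<And>n. \<rho> n < 1" and \<rho>1: "\<rho> \<longlonglongrightarrow> 1"
    and in_disc: "\<And>n z. z \<in> \<D> \<Longrightarrow> of_real (\<rho> n) * z \<in> \<D>"
    using dilation_sequence by blast
  have "\<exists>v w. v holomorphic_on \<D> \<and> w holomorphic_on \<D> \<and>
    (\<forall>z\<in>\<D>. f (of_real (\<rho> n) * z) = v z * w z \<and> norm (v z) \<le> norm (w z)) \<and>
    (\<forall>r. 0 < r \<and> r < 1 \<longrightarrow> circle_mean (2 * p) w r \<le> hsup p f)" for n
    using hardy_factor_dilate[OF f p z0 \<rho>(1)[of n] \<rho>(2)[of n]] by metis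
  then obtain v w where v: "\<And>n. v n holomorphic_on \<D>" and w: "\<And>n. w n holomorphic_on \<D>"
    and fac: "\<And>n z. z \<in> \<D> \<Longrightarrow> f (of_real (\<rho> n) * z) = v n z * w n z"
    and vw: "\<And>n z. z \<in> \<D> \<Longrightarrow> norm (v n z) \<le> norm (w n z)"
    and cm: "\<And>n r. 0 < r \<Longrightarrow> r < 1 \<Longrightarrow> circle_mean (2 * p) (w n) r \<le> hsup p f"
    by metis
  have hw: "hardy_fun (2 * p) (w n)" "hsup (2 * p) (w n) \<le> hsup p f" for n
    using hardy_funI[OF w, of "2 * p" n "hsup p f"] hsup_le[of "2 * p" "w n" "hsup p f"] cm by auto
  define c where "c = (1 + hsup p f) * 2"
  have bw: "norm (w n z) \<le> c / (1 - norm z)" if "z \<in> \<D>" for n z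
  proof -
    have "norm (w n z) \<le> (1 + hsup (2 * p) (w n)) / ((1 - norm z) / 2)"
      using hardy_point_bound[OF hw(1), of z 1 n] that p by simp
    also have "\<dots> \<le> (1 + hsup p f) / ((1 - norm z) / 2)"
      using that hw(2) by (intro divide_right_mono) auto
    finally show ?thesis by (simp add: c_def)
  qed
  then have bv: "norm (v n z) \<le> c / (1 - norm z)" if "z \<in> \<D>" for n z
    using vw[OF that, of n] that by (meson order_trans)
  obtain v' k where v': "v' holomorphic_on \<D>" "strict_mono (k :: nat \<Rightarrow> nat)"
    "\<And>z. z \<in> \<D> \<Longrightarrow> (\<lambda>n. v (k n) z) \<longlonglongrightarrow> v' z"
    by (rule montel_disc[of v, OF v bv]) (assumption, rule that)
  obtain w' l where w': "w' holomorphic_on \<D>" "strict_mono (l :: nat \<Rightarrow> nat)"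
    "\<And>z. z \<in> \<D> \<Longrightarrow> (\<lambda>n. w (k (l n)) z) \<longlonglongrightarrow> w' z"
    by (rule montel_disc[of "\<lambda>n. w (k n)", OF w bw]) (assumption, rule that)
  have v'': "(\<lambda>n. v (k (l n)) z) \<longlonglongrightarrow> v' z" if "z \<in> \<D>" for z
    using LIMSEQ_subseq_LIMSEQ[OF v'(3)[OF that] w'(2)] by (simp add: o_def)
  have kl: "strict_mono (\<lambda>n. k (l n))" using strict_mono_o[OF v'(2) w'(2)] by (simp add: o_def)
  have "f z = v' z * w' z" if z: "z \<in> \<D>" for z
  proof (rule LIMSEQ_unique)
    have "(\<lambda>n. \<rho> (k (l n))) \<longlonglongrightarrow> 1"
      using LIMSEQ_subseq_LIMSEQ[OF \<rho>1 kl] by (simp add: o_def)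
    then show "(\<lambda>n. f (of_real (\<rho> (k (l n))) * z)) \<longlonglongrightarrow> f z"
      by (rule dilation_tendsto[OF hardy_fun_continuous[OF f] _ in_disc[OF z] z])
    show "(\<lambda>n. f (of_real (\<rho> (k (l n))) * z)) \<longlonglongrightarrow> v' z * w' z"
      unfolding fac[OF z] by (intro tendsto_mult v'' w' z)
  qed
  \<comment> \<open>Stated for any sequence dominated by w, since it serves both factors.\<close>
  moreover have lim: "hardy_fun (2 * p) u'"
    if u: "\<And>n. u n holomorphic_on \<D>" "\<And>n z. z \<in> \<D> \<Longrightarrow> norm (u n z) \<le> norm (w n z)"
      "u' holomorphic_on \<D>" "\<And>z. z \<in> \<D> \<Longrightarrow> (\<lambda>n. u (k (l n)) z) \<longlonglongrightarrow> u' z" for u u'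
  proof (rule hardy_funI[OF u(3)])
    fix r :: real assume r: "0 < r" "r < 1"
    have "circle_mean (2 * p) (u n) r \<le> hsup p f" for n
    proof -
      have "circle_mean (2 * p) (u n) r \<le> 1 * circle_mean (2 * p) (w n) r + 0 * circle_mean (2 * p) (w n) r + 2 * pi * 0"
        by (rule circle_mean_le)
           (use r p u(2) in \<open>auto intro!: powr_mono2 holomorphic_on_imp_continuous_on w u(1)\<close>)
      then show ?thesis using cm[OF r, of n] by simp
    qed
    moreover have "(\<lambda>n. circle_mean (2 * p) (u (k (l n))) r) \<longlonglongrightarrow> circle_mean (2 * p) u' r"
    proof (rule circle_mean_limit)
      show "norm (u (k (l n)) z) \<le> c / (1 - r)" if "norm z = r" for n z
        using order_trans[OF u(2) bw, of z "k (l n)"] that r by auto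
    qed (use r p u in \<open>auto intro: holomorphic_on_imp_continuous_on\<close>)
    ultimately show "circle_mean (2 * p) u' r \<le> hsup p f"
      by (intro LIMSEQ_le_const2) auto
  qed
  have "hardy_fun (2 * p) v'" by (rule lim[OF v vw v'(1) v''])
  moreover have "hardy_fun (2 * p) w'" by (rule lim[OF w _ w'(1) w'(3)]) auto
  ultimately show thesis using that by blast
qed

text \<open>A weighted arithmetic-geometric mean inequality replaces Cauchy-Schwarz: a small weight
  d lets one factor be merely bounded while the other is made small.\<close>

lemma hardy_fun_mult:
  assumes f: "hardy_fun (2 * p) f" and g: "hardy_fun (2 * p) g" and p: "p > 0" and d: "d > 0"
  shows "hardy_fun p (\<lambda>z. f z * g z)" "hsup p (\<lambda>z. f z * g z) \<le> d * hsup (2 * p) f + hsup (2 * p) g / d"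
proof -
  have le: "circle_mean p (\<lambda>z. f z * g z) r \<le> d * hsup (2 * p) f + hsup (2 * p) g / d" if r: "0 < r" "r < 1" for r
  proof -
    have "circle_mean p (\<lambda>z. f z * g z) r \<le> d * circle_mean (2 * p) f r + (1 / d) * circle_mean (2 * p) g r + 2 * pi * 0"
    proof (rule circle_mean_le)
      fix z
      have sq: "x powr (2 * p) = (x powr p)\<^sup>2" for x :: real
        by (simp add: power2_eq_square flip: powr_add)
      have amgm: "s * t \<le> d * s\<^sup>2 + (1 / d) * t\<^sup>2" if "s \<ge> 0" "t \<ge> 0" for s t :: real
      proof -
        have "0 \<le> (d * s - t)\<^sup>2 / d" using d by simp
        also have "\<dots> = d * s\<^sup>2 + (1 / d) * t\<^sup>2 - 2 * (s * t)"
          using d by (simp add: power2_eq_square field_simps)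
        finally show ?thesis using mult_nonneg_nonneg[OF that] by linarith
      qed
      show "norm (f z * g z) powr p \<le> d * norm (f z) powr (2 * p) + (1 / d) * norm (g z) powr (2 * p) + 0"
        using amgm[of "norm (f z) powr p" "norm (g z) powr p"] by (simp add: norm_mult powr_mult sq)
    qed (use r p f g in \<open>auto intro!: continuous_on_mult intro: hardy_fun_continuous\<close>)
    also have "\<dots> \<le> d * hsup (2 * p) f + (1 / d) * hsup (2 * p) g + 2 * pi * 0"
      using r f g d by (intro add_mono mult_left_mono circle_mean_le_hsup) auto
    finally show ?thesis by simp
  qed
  show "hardy_fun p (\<lambda>z. f z * g z)" "hsup p (\<lambda>z. f z * g z) \<le> d * hsup (2 * p) f + hsup (2 * p) g / d"
    by (rule hardy_funI[OF _ le] hsup_le[OF le]; (assumption | rule holomorphic_on_mult hardy_fun_holomorphic[OF f] hardy_fun_holomorphic[OF g])+)+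
qed

text \<open>With f = v w the approximant is b c, through f - b c = v (w - c) + (v - b) c. First c is
  chosen close to w; then b is chosen close to v, depending on the bound of c.\<close>

lemma bhol_dense:
  assumes f: "hardy_fun p f" and p: "1 \<le> p" and e: "e > 0"
  obtains b where "bhol b" "hsup p (\<lambda>z. f z - b z) < e"
proof -
  obtain v w where v: "hardy_fun (2 * p) v" and w: "hardy_fun (2 * p) w" and fac: "\<And>z. z \<in> \<D> \<Longrightarrow> f z = v z * w z"
    using hardy_factor[OF f p] by metis
  \<comment> \<open>The two parts contribute 2 e0 and e0; with the factor 2^p this gives 3 e /
    4.\<close>
  define e0 where "e0 = e / (4 * 2 powr p)"
  have e0: "e0 > 0" "2 powr p * (2 * e0 + e0) < e" using e by (auto simp: e0_def)
  \<comment> \<open>The weight is small enough for the fixed factor v; the closeness d * e0 of c to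
    w then survives the division by d.\<close>
  define d where "d = e0 / (hsup (2 * p) v + 1)"
  have "hsup (2 * p) v \<ge> 0" by (rule hsup_nonneg[OF v])
  then have d: "d > 0" "d * hsup (2 * p) v \<le> e0" using e0 by (auto simp: d_def field_simps)
  obtain c where c: "bhol c" "hsup (2 * p) (\<lambda>z. w z - c z) < d * e0"
    using bhol_dense_ge2[OF _ w, of "d * e0"] p d e0 by auto
  obtain M where M: "\<And>z. z \<in> \<D> \<Longrightarrow> norm (c z) \<le> M" using c(1) unfolding bhol_def by blast
  \<comment> \<open>Multiplication by c costs M^p; the + 1 keeps the quotient defined when M =
    0.\<close>
  obtain e' where e': "e' > 0" "\<And>u. hardy_fun (2 * p) u \<Longrightarrow> hsup (2 * p) u < e' \<Longrightarrow> hsup p u < e0 / (M powr p + 1)"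
    by (rule hsup_small_power[of p "2 * p" "e0 / (M powr p + 1)"])
       (use p e0 in \<open>auto intro!: divide_pos_pos add_nonneg_pos\<close>)
  obtain b where b: "bhol b" "hsup (2 * p) (\<lambda>z. v z - b z) < e'"
    using bhol_dense_ge2[OF _ v e'(1)] p by auto
  have hc: "hardy_fun (2 * p) (\<lambda>z. w z - c z)" and hb: "hardy_fun (2 * p) (\<lambda>z. v z - b z)"
    using hardy_fun_diff(1)[OF w bhol_hardy[OF c(1)]] hardy_fun_diff(1)[OF v bhol_hardy[OF b(1)]] p by auto
  have hbp: "hardy_fun p (\<lambda>z. v z - b z)" by (rule hsup_power_le(1)[OF hb _ _ zero_less_one]) (use p in auto)
  note m1 = hardy_fun_mult[OF v hc _ d(1)]
  have "hsup (2 * p) (\<lambda>z. w z - c z) / d \<le> e0" using c(2) d by (simp add: divide_le_eq mult.commute)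
  then have 1: "hsup p (\<lambda>z. v z * (w z - c z)) \<le> 2 * e0" using m1(2) d p by simp
  have cm2: "circle_mean p (\<lambda>z. (v z - b z) * c z) r \<le> M powr p * hsup p (\<lambda>z. v z - b z)" if r: "0 < r" "r < 1" for r
  proof -
    have cc: "continuous_on \<D> c" using c(1) by (auto simp: bhol_def holomorphic_on_imp_continuous_on)
    have "circle_mean p (\<lambda>z. (v z - b z) * c z) r \<le> M powr p * circle_mean p (\<lambda>z. v z - b z) r
        + 0 * circle_mean p (\<lambda>z. v z - b z) r + 2 * pi * 0"
    proof (rule circle_mean_le)
      fix z assume "z \<in> \<D>"
      then have "norm (c z) powr p \<le> M powr p" using M p by (intro powr_mono2) auto
      then show "norm ((v z - b z) * c z) powr p \<le> M powr p * norm (v z - b z) powr p + 0 * norm (v z - b z) powr p + 0"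
        by (simp add: norm_mult powr_mult mult.commute mult_right_mono)
    qed (use hardy_fun_continuous[OF hbp] cc r p in \<open>auto intro!: continuous_on_mult\<close>)
    also have "\<dots> \<le> M powr p * hsup p (\<lambda>z. v z - b z)"
      using circle_mean_le_hsup[OF hbp r] by (simp add: mult_left_mono)
    finally show ?thesis .
  qed
  have h2: "hardy_fun p (\<lambda>z. (v z - b z) * c z)"
  proof (rule hardy_funI[OF _ cm2])
    show "(\<lambda>z. (v z - b z) * c z) holomorphic_on \<D>"
      using c(1) by (intro holomorphic_on_mult hardy_fun_holomorphic[OF hb]) (simp add: bhol_def)
  qed
  have 2: "hsup p (\<lambda>z. (v z - b z) * c z) \<le> e0"
  proof -
    have "hsup p (\<lambda>z. (v z - b z) * c z) \<le> M powr p * hsup p (\<lambda>z. v z - b z)" by (rule hsup_le[OF cm2])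
    also have "\<dots> \<le> (M powr p + 1) * hsup p (\<lambda>z. v z - b z)"
      using hsup_nonneg[OF hbp] by (intro mult_right_mono) auto
    also have "\<dots> \<le> (M powr p + 1) * (e0 / (M powr p + 1))"
      using e'(2)[OF hb b(2)] by (intro mult_left_mono) auto
    also have "\<dots> = e0" using powr_ge_zero[of M p] by (simp add: add_nonneg_eq_0_iff)
    finally show ?thesis .
  qed
  have "hsup p (\<lambda>z. f z - b z * c z) = hsup p (\<lambda>z. v z * (w z - c z) + (v z - b z) * c z)"
    by (rule hardy_fun_cong) (simp add: fac algebra_simps)
  also have "\<dots> \<le> 2 powr p * (hsup p (\<lambda>z. v z * (w z - c z)) + hsup p (\<lambda>z. (v z - b z) * c z))"
    by (rule hardy_fun_add(2)[OF m1(1) h2]) (use p in auto)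
  also have "\<dots> \<le> 2 powr p * (2 * e0 + e0)" using 1 2 by (intro mult_left_mono) auto
  also have "\<dots> < e" by (rule e0(2))
  finally show thesis using that bhol_mult[OF b(1) c(1)] by blast
qed

subsection \<open>Algebras closed under bounded pointwise limits\<close>

lemma riemann_sum_tendsto:
  fixes H :: "real \<Rightarrow> 'a::euclidean_space"
  assumes cont: "continuous_on {a..a+L} H" and L: "L > 0"
  shows "(\<lambda>N. \<Sum>j<Suc N. (L / real (Suc N)) *\<^sub>R H (a + L * real j / real (Suc N))) \<longlonglongrightarrow> integral {a..a+L} H"
proof (rule LIMSEQ_I)
  fix e :: real assume e: "e > 0"
  have "uniformly_continuous_on {a..a+L} H"
    by (rule compact_uniformly_continuous[OF cont]) auto
  moreover have "e / (2 * L) > 0" using e L by simp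
  ultimately obtain d where d: "d > 0" "\<And>x y. x \<in> {a..a+L} \<Longrightarrow> y \<in> {a..a+L} \<Longrightarrow> dist x y < d \<Longrightarrow> dist (H x) (H y) < e / (2 * L)"
    unfolding uniformly_continuous_on_def by metis
  obtain N0 :: nat where N0: "L / d < real N0" using reals_Archimedean2 by blast
  show "\<exists>N0. \<forall>N\<ge>N0. norm ((\<Sum>j<Suc N. (L / real (Suc N)) *\<^sub>R H (a + L * real j / real (Suc N))) - integral {a..a+L} H) < e"
  proof (intro exI allI impI)
    fix N assume "N0 \<le> N"
    then have "L / d < real (Suc N)" using N0 by linarith
    then have small: "L / real (Suc N) < d" using d L by (simp add: divide_less_eq mult.commute)
    have "norm (integral {a..a+L} H - (\<Sum>j<Suc N. (L / real (Suc N)) *\<^sub>R H (a + L * real j / real (Suc N)))) \<le> L * (e / (2 * L))"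
    proof (rule riemann_sum_error[OF cont L])
      fix x y assume "x \<in> {a..a+L}" "y \<in> {a..a+L}" "\<bar>x - y\<bar> \<le> L / real (Suc N)"
      then show "norm (H x - H y) \<le> e / (2 * L)"
        using d(2)[of x y] small by (simp add: dist_norm less_imp_le)
    qed simp
    also have "\<dots> < e" using L e by simp
    finally show "norm ((\<Sum>j<Suc N. (L / real (Suc N)) *\<^sub>R H (a + L * real j / real (Suc N))) - integral {a..a+L} H) < e"
      by (simp add: norm_minus_commute)
  qed
qed

text \<open>Only values on the disc are controlled: boundedness and convergence are asked there and
  nowhere else. The instance used later is the span of the exponentials.\<close>

locale bp_algebra =
  fixes Y :: "(complex \<Rightarrow> complex) set"
  assumes bounded: "f \<in> Y \<Longrightarrow> \<exists>M. \<forall>z\<in>\<D>. norm (f z) \<le> M"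
    and const: "(\<lambda>z. c) \<in> Y"
    and add: "f \<in> Y \<Longrightarrow> g \<in> Y \<Longrightarrow> (\<lambda>z. f z + g z) \<in> Y"
    and mult: "f \<in> Y \<Longrightarrow> g \<in> Y \<Longrightarrow> (\<lambda>z. f z * g z) \<in> Y"
    and lim: "(\<And>n. F n \<in> Y) \<Longrightarrow> (\<And>n z. z \<in> \<D> \<Longrightarrow> norm (F n z) \<le> M) \<Longrightarrow>
      (\<And>z. z \<in> \<D> \<Longrightarrow> (\<lambda>n. F n z) \<longlonglongrightarrow> f z) \<Longrightarrow> f \<in> Y"
begin

text \<open>A constant sequence converges boundedly to anything that agrees with it on the
  disc.\<close>

lemma cong:
  assumes "f \<in> Y" "\<And>z. z \<in> \<D> \<Longrightarrow> f z = g z"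
  shows "g \<in> Y"
proof -
  obtain M where "\<forall>z\<in>\<D>. norm (f z) \<le> M" using bounded[OF assms(1)] by blast
  with assms show ?thesis by - (rule lim[of "\<lambda>n. f" M], auto)
qed

lemma scale: "f \<in> Y \<Longrightarrow> (\<lambda>z. c * f z) \<in> Y"
  using mult[OF const] .

lemma sum: "(\<And>j. j \<in> A \<Longrightarrow> f j \<in> Y) \<Longrightarrow> (\<lambda>z. \<Sum>j\<in>A. f j z) \<in> Y"
proof (induction A rule: infinite_finite_induct)
  case (insert x A)
  then show ?case using add[of "f x" "\<lambda>z. \<Sum>j\<in>A. f j z"] by simp
qed (use const[of 0] in simp_all)

lemma power: "f \<in> Y \<Longrightarrow> (\<lambda>z. f z ^ n) \<in> Y"
proof (induction n)
  case (Suc n)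
  then show ?case using mult[OF Suc.prems Suc.IH[OF Suc.prems]] by simp
qed (use const[of 1] in simp)

lemma power_series:
  assumes f: "f \<in> Y" "\<And>z. z \<in> \<D> \<Longrightarrow> norm (f z) \<le> M" and sm: "summable (\<lambda>n. norm (c n) * M ^ n)"
  shows "(\<lambda>z. \<Sum>n. c n * f z ^ n) \<in> Y"
proof (rule lim)
  have M: "M \<ge> 0" using f(2)[of 0] norm_ge_zero[of "f 0"] by (simp del: norm_ge_zero)
  have tb: "norm (c n * f z ^ n) \<le> norm (c n) * M ^ n" if "z \<in> \<D>" for n z
    using f(2)[OF that] by (simp add: norm_mult norm_power mult_left_mono power_mono)
  show "(\<lambda>z. \<Sum>n<N. c n * f z ^ n) \<in> Y" for N
    by (rule sum, rule scale, rule power, rule f(1))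
  show "norm (\<Sum>n<N. c n * f z ^ n) \<le> (\<Sum>n. norm (c n) * M ^ n)" if "z \<in> \<D>" for N z
  proof -
    have "norm (\<Sum>n<N. c n * f z ^ n) \<le> (\<Sum>n<N. norm (c n) * M ^ n)"
      by (rule sum_norm_le) (use tb that in auto)
    also have "\<dots> \<le> (\<Sum>n. norm (c n) * M ^ n)"
      by (rule sum_le_suminf[OF sm]) (use M in auto)
    finally show ?thesis .
  qed
  show "(\<lambda>N. \<Sum>n<N. c n * f z ^ n) \<longlonglongrightarrow> (\<Sum>n. c n * f z ^ n)" if "z \<in> \<D>" for z
    by (rule summable_LIMSEQ, rule summable_comparison_test'[OF sm]) (use tb that in auto)
qed

lemma neumann:
  assumes f: "f \<in> Y" "\<And>z. z \<in> \<D> \<Longrightarrow> norm (f z) \<le> M" and c: "norm c * M < 1"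
  shows "(\<lambda>z. 1 / (1 - c * f z)) \<in> Y"
proof (rule cong)
  have M: "M \<ge> 0" using f(2)[of 0] norm_ge_zero[of "f 0"] by (simp del: norm_ge_zero)
  have "summable (\<lambda>n. (norm c * M) ^ n)" using c M by (intro summable_geometric) simp
  then show "(\<lambda>z. \<Sum>n. c ^ n * f z ^ n) \<in> Y"
    by (intro power_series[OF f]) (simp_all add: norm_power power_mult_distrib)
  show "(\<Sum>n. c ^ n * f z ^ n) = 1 / (1 - c * f z)" if "z \<in> \<D>" for z
  proof -
    have "norm (c * f z) \<le> norm c * M" using f(2)[OF that] by (simp add: norm_mult mult_left_mono)
    then show ?thesis using suminf_geometric[of "c * f z"] c by (simp add: power_mult_distrib)
  qed
qed

text \<open>Runge's pole pushing. Far from K the resolvent is a Neumann series; a pole can be moved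
  a little at a time by another one; connectedness of the complement of K brings it to every a
  outside K.\<close>

lemma resolvent:
  assumes F: "F \<in> Y" "F ` \<D> \<subseteq> K" and K: "closed K" "bounded K" "connected (- K)" and a: "a \<notin> K"
  shows "(\<lambda>z. 1 / (F z - a)) \<in> Y"
proof -
  obtain B where B: "B > 0" "\<And>w. w \<in> K \<Longrightarrow> norm w \<le> B" using bounded_pos[THEN iffD1, OF K(2)] by auto
  have "norm (of_real (B + 1) :: complex) = B + 1" using B(1) unfolding norm_of_real by simp
  then have far: "of_real (B + 1) \<in> - K" using B(2)[of "of_real (B + 1)"] by (metis ComplI add_le_same_cancel1 not_one_le_zero)
  have nz: "F z - a \<noteq> 0" if "a \<notin> K" "z \<in> \<D>" for a z
  proof -
    have "F z \<in> K" using F(2) that(2) by blast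
    then show ?thesis using that(1) by (metis eq_iff_diff_eq_0)
  qed
  have "(\<lambda>z. 1 / (F z - of_real (B + 1))) \<in> Y"
  proof (rule cong)
    have "(\<lambda>z. 1 / (1 - (1 / of_real (B + 1)) * F z)) \<in> Y"
    proof (rule neumann[OF F(1), of B])
      show "norm (F z) \<le> B" if "z \<in> \<D>" for z using F(2) B(2) that by blast
      have "norm (1 / of_real (B + 1) :: complex) = 1 / (B + 1)"
        using B(1) unfolding norm_divide norm_of_real by simp
      then show "norm (1 / of_real (B + 1) :: complex) * B < 1" using B(1) by (simp only:) (simp add: field_simps)
    qed
    then show "(\<lambda>z. (- 1 / of_real (B + 1)) * (1 / (1 - (1 / of_real (B + 1)) * F z))) \<in> Y" by (rule scale)
    show "(- 1 / of_real (B + 1)) * (1 / (1 - (1 / of_real (B + 1)) * F z)) = 1 / (F z - of_real (B + 1))" if "z \<in> \<D>" for z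
    proof -
      have *: "(-1 / b) * (1 / (1 - (1 / b) * w)) = 1 / (w - b)" if "b \<noteq> 0" "w - b \<noteq> 0" for b w :: complex
      proof -
        have "(-b) * (1 - (1 / b) * w) = w - b" using that by (simp add: field_simps)
        then have "1 / (w - b) = 1 / ((-b) * (1 - (1 / b) * w))" by (simp only:)
        also have "\<dots> = (-1 / b) * (1 / (1 - (1 / b) * w))" by simp
        finally show ?thesis by (rule sym)
      qed
      have "of_real (B + 1) \<noteq> (0::complex)" using B(1) by (metis add_pos_pos less_irrefl of_real_eq_0_iff zero_less_one)
      then show ?thesis using *[OF _ nz[of "of_real (B + 1)", OF _ that]] far by blast
    qed
  qed
  note base = this
  have step: "\<exists>T. openin (top_of_set (- K)) T \<and> a \<in> T \<and>
      (\<forall>x\<in>T. \<forall>y\<in>T. (\<lambda>z. 1 / (F z - x)) \<in> Y \<longrightarrow> (\<lambda>z. 1 / (F z - y)) \<in> Y)" if "a \<in> - K" for a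
  proof -
    note aK = that
    obtain e where e: "e > 0" "ball a e \<subseteq> - K"
      using openE[OF open_Compl[OF K(1)] aK] by metis
    \<comment> \<open>With radius e / 4 the poles x and y differ by less than e / 2, while F z keeps
      distance 3 e / 4 from x; the ratio of the Neumann series is thus below 2/3.\<close>
    have local: "(\<lambda>z. 1 / (F z - y)) \<in> Y" if xy: "x \<in> ball a (e/4)" "y \<in> ball a (e/4)" "(\<lambda>z. 1 / (F z - x)) \<in> Y" for x y
    proof (rule cong)
      have xK: "x \<notin> K" "y \<notin> K" using xy e by (auto simp: subset_iff)
      have ge: "3 / 4 * e \<le> norm (F z - x)" if "z \<in> \<D>" for z
      proof -
        have "F z \<notin> ball a e" using F(2) e(2) that by blast
        then have "e \<le> dist a (F z)" by simp
        also have "\<dots> \<le> dist a x + dist x (F z)" by (rule dist_triangle)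
        finally show ?thesis using xy(1) by (simp add: dist_norm norm_minus_commute)
      qed
      have bd: "norm (1 / (F z - x)) \<le> 1 / (3 / 4 * e)" if "z \<in> \<D>" for z
        using ge[OF that] e(1) by (simp add: norm_divide frac_le del: times_divide_eq_left)
      have "dist x y < e / 2" using xy dist_triangle[of x y a] by (simp add: dist_commute)
      then have "norm (y - x) * (1 / (3 / 4 * e)) < 1"
        using e(1) by (simp add: dist_norm norm_minus_commute field_simps)
      from neumann[OF xy(3) bd this]
      have "(\<lambda>z. 1 / (1 - (y - x) * (1 / (F z - x)))) \<in> Y" .
      then show "(\<lambda>z. (1 / (F z - x)) * (1 / (1 - (y - x) * (1 / (F z - x))))) \<in> Y" by (rule mult[OF xy(3)])
      show "(1 / (F z - x)) * (1 / (1 - (y - x) * (1 / (F z - x)))) = 1 / (F z - y)" if "z \<in> \<D>" for z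
      proof -
        have "(F z - x) * (1 - (y - x) * (1 / (F z - x))) = F z - y"
        proof -
          have *: "d * (1 - c * (1 / d)) = d - c" if "d \<noteq> 0" for c d :: complex
            using that by (simp add: field_simps)
          show ?thesis using *[OF nz[OF xK(1) that], of "y - x"] by simp
        qed
        then show ?thesis unfolding times_divide_times_eq mult_1_left by (rule arg_cong)
      qed
    qed
    have "ball a (e/4) \<subseteq> ball a e" by (rule subset_ball) (use e(1) in simp)
    then have "ball a (e/4) \<subseteq> - K" using e(2) by (rule order_trans)
    then have "openin (top_of_set (- K)) (ball a (e/4))" by (simp add: open_subset)
    moreover have "a \<in> ball a (e/4)" using e(1) by simp
    ultimately show ?thesis using local by blast
  qed
  show ?thesis
    by (rule connected_induction_simple[OF K(3) far _ base step]) (use a in simp)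
qed

(* The Cauchy integral of the identity over a circle, transported by the conformal map g,
   represents f on K by resolvents with poles outside K. *)
lemma conformal_map_comp:
  assumes F: "F \<in> Y" "F ` \<D> \<subseteq> K" and K: "compact K" "connected (- K)" and U: "open U" "K \<subseteq> U"
    and f: "f holomorphic_on U" "\<And>w. w \<in> U \<Longrightarrow> f w \<in> \<D> \<and> g (f w) = w"
    and g: "g holomorphic_on \<D>" "\<And>z. z \<in> \<D> \<Longrightarrow> g z \<in> U \<and> f (g z) = z"
  shows "(\<lambda>z. f (F z)) \<in> Y"
proof -
  have Kne: "K \<noteq> {}" using F(2) by (metis all_not_in_conv image_subset_iff centre_in_ball zero_less_one)
  have "continuous_on K f" using f(1) U(2) holomorphic_on_imp_continuous_on continuous_on_subset by blast
  then obtain k where k: "k \<in> K" "\<And>w. w \<in> K \<Longrightarrow> norm (f w) \<le> norm (f k)"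
    using continuous_attains_sup[OF K(1) Kne, of "\<lambda>w. norm (f w)"] continuous_on_norm by blast
  \<comment> \<open>Between the largest modulus of f on K and 1, so that g maps the circle of radius
    r off K.\<close>
  define r where "r = (norm (f k) + 1) / 2"
  have fk: "norm (f k) < 1" using f(2) k(1) U(2) by auto
  have r: "0 < r" "r < 1" "\<And>w. w \<in> K \<Longrightarrow> norm (f w) < r"
    using k(2) fk norm_ge_zero[of "f k"] unfolding r_def by (force simp del: norm_ge_zero)+
  have inj: "inj_on g \<D>" using g(2) by (metis inj_onI)
  have gU: "g z \<notin> K" if "norm z = r" for z
    using r(3)[of "g z"] g(2)[of z] that r(2) by auto
  define \<xi> where "\<xi> t = of_real r * cis t" for t
  have \<xi>: "norm (\<xi> t) = r" "\<xi> t \<in> \<D>" for t using r by (auto simp: \<xi>_def norm_mult)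
  \<comment> \<open>f w is the integral of zeta g'(zeta) / (g(zeta) - w) d zeta over the circle,
    divided by 2 pi i; with d zeta = i zeta dt the numerator becomes zeta^2 g'(zeta).\<close>
  define N where "N t = (\<xi> t)\<^sup>2 * deriv g (\<xi> t)" for t
  have contg: "continuous_on \<D> g" "continuous_on \<D> (deriv g)"
    using g(1) by (auto intro!: holomorphic_on_imp_continuous_on holomorphic_deriv)
  have cont\<xi>: "continuous_on A \<xi>" for A unfolding \<xi>_def by (intro continuous_intros)
  have contN: "continuous_on A N" "continuous_on A (\<lambda>t. g (\<xi> t))" for A
    unfolding N_def using \<xi>(2)
    by (auto intro!: continuous_intros cont\<xi> continuous_on_compose2[OF contg(1) cont\<xi>] continuous_on_compose2[OF contg(2) cont\<xi>])
  have int: "integral {0..2*pi} (\<lambda>t. N t / (g (\<xi> t) - w)) = 2 * pi * f w" if w: "w \<in> K" for w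
  proof -
    define z0 where "z0 = f w"
    have z0: "z0 \<in> \<D>" "g z0 = w" "norm z0 < r" using f(2) w U(2) r(3) by (auto simp: z0_def)
    \<comment> \<open>The difference quotient of g at z0, free of zeros by univalence. It turns the
      kernel 1 / (g - w) into the Cauchy kernel 1 / (zeta - z0), and zeta g'(zeta) / P(zeta) has the
      value z0 at z0.\<close>
    define P where "P \<xi> = (if \<xi> = z0 then deriv g z0 else (g \<xi> - w) / (\<xi> - z0))" for \<xi>
    have holP: "P holomorphic_on \<D>"
    proof (rule pole_theorem_open_0[of "\<lambda>\<xi>. g \<xi> - w" \<D> z0])
      show "(\<lambda>\<xi>. g \<xi> - w) holomorphic_on \<D>" by (intro holomorphic_intros g)
      have "deriv (\<lambda>\<xi>. g \<xi> - w) z0 = deriv g z0"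
        using g(1) z0(1) by (subst deriv_diff) (auto intro: holomorphic_on_imp_differentiable_at)
      then show "P z0 = deriv (\<lambda>\<xi>. g \<xi> - w) z0" by (simp add: P_def)
    qed (auto simp: P_def z0)
    have Pnz: "P \<zeta> \<noteq> 0" if "\<zeta> \<in> \<D>" for \<zeta>
    proof (cases "\<zeta> = z0")
      case True
      then show ?thesis
        using holomorphic_injective_imp_regular[OF g(1) open_ball inj z0(1)] by (simp add: P_def)
    next
      case False
      then have "g \<zeta> \<noteq> w" using inj_onD[OF inj _ that z0(1)] z0(2) by metis
      then show ?thesis using False by (simp add: P_def)
    qed
    have hol: "(\<lambda>\<zeta>. \<zeta> * deriv g \<zeta> / P \<zeta>) holomorphic_on \<D>"
      using Pnz by (intro holomorphic_intros holP holomorphic_deriv g) auto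
    have eq: "(\<lambda>\<theta>. (\<xi> \<theta> * deriv g (\<xi> \<theta>) / P (\<xi> \<theta>)) * \<xi> \<theta> / (\<xi> \<theta> - z0)) = (\<lambda>t. N t / (g (\<xi> t) - w))"
    proof
      fix t
      have ne: "\<xi> t \<noteq> z0" using \<xi>(1)[of t] z0(3) by auto
      have "P (\<xi> t) * (\<xi> t - z0) = g (\<xi> t) - w" using ne by (simp add: P_def)
      then show "(\<xi> t * deriv g (\<xi> t) / P (\<xi> t)) * \<xi> t / (\<xi> t - z0) = N t / (g (\<xi> t) - w)"
        unfolding N_def by (simp add: power2_eq_square ac_simps flip: \<open>P (\<xi> t) * (\<xi> t - z0) = g (\<xi> t) - w\<close>)
    qed
    have "((\<lambda>\<theta>. (\<xi> \<theta> * deriv g (\<xi> \<theta>) / P (\<xi> \<theta>)) * \<xi> \<theta> / (\<xi> \<theta> - z0)) has_integral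
        (2 * pi * (z0 * deriv g z0 / P z0))) {0..2*pi}"
      unfolding \<xi>_def by (rule cauchy_circle[OF hol z0(3) r(2)])
    then show ?thesis using Pnz[OF z0(1)] unfolding eq by (simp add: integral_unique P_def z0_def)
  qed
  define S where "S n z = (\<Sum>j<Suc n. (2*pi / real (Suc n)) *\<^sub>R (N (0 + 2*pi * real j / real (Suc n)) / (g (\<xi> (0 + 2*pi * real j / real (Suc n))) - F z)))" for n z
  have lim': "(\<lambda>n. S n z) \<longlonglongrightarrow> 2 * pi * f (F z)" if "z \<in> \<D>" for z
  proof -
    have FK: "F z \<in> K" using F(2) that by auto
    have "g (\<xi> t) - F z \<noteq> 0" for t using gU[OF \<xi>(1)] FK by (metis eq_iff_diff_eq_0)
    then have "continuous_on {0..0+2*pi} (\<lambda>t. N t / (g (\<xi> t) - F z))"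
      by (intro continuous_intros contN) auto
    then have "(\<lambda>n. S n z) \<longlonglongrightarrow> integral {0..0+2*pi} (\<lambda>t. N t / (g (\<xi> t) - F z))"
      unfolding S_def by (rule riemann_sum_tendsto) auto
    then show ?thesis using int[OF FK] by simp
  qed
  have SY: "S n \<in> Y" for n
  proof -
    have "(\<lambda>z. (- (2*pi / real (Suc n)) * N t) * (1 / (F z - g (\<xi> t)))) \<in> Y" for t
      by (intro scale resolvent[OF F] compact_imp_closed compact_imp_bounded K gU \<xi>)
    moreover have "(- (2*pi / real (Suc n)) * N t) * (1 / (F z - g (\<xi> t))) = (2*pi / real (Suc n)) *\<^sub>R (N t / (g (\<xi> t) - F z))" for t z
    proof -
      have "N t / (g (\<xi> t) - F z) = - (N t / (F z - g (\<xi> t)))"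
        using minus_divide_right[of "N t" "F z - g (\<xi> t)"] by simp
      then show ?thesis by (simp add: scaleR_conv_of_real)
    qed
    ultimately have "(\<lambda>z. (2*pi / real (Suc n)) *\<^sub>R (N t / (g (\<xi> t) - F z))) \<in> Y" for t by simp
    then show ?thesis unfolding S_def by (intro sum)
  qed
  \<comment> \<open>One bound for all Riemann sums: the curve keeps a distance d from K, and N is
    bounded by C.\<close>
  have "compact ((\<lambda>t. g (\<xi> t)) ` {0..2*pi})" "compact (N ` {0..2*pi})"
    by (intro compact_continuous_image contN compact_Icc)+
  moreover have "(\<lambda>t. g (\<xi> t)) ` {0..2*pi} \<inter> K = {}" using gU \<xi> by auto
  ultimately obtain d C where d: "d > 0" "\<And>t w. t \<in> {0..2*pi} \<Longrightarrow> w \<in> K \<Longrightarrow> d \<le> dist (g (\<xi> t)) w"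
    and C: "C > 0" "\<And>t. t \<in> {0..2*pi} \<Longrightarrow> norm (N t) \<le> C"
    using separate_compact_closed[of "(\<lambda>t. g (\<xi> t)) ` {0..2*pi}" K] compact_imp_closed[OF K(1)]
      compact_imp_bounded[of "N ` {0..2*pi}"] bounded_pos[of "N ` {0..2*pi}"] by (metis image_eqI)
  have bound: "norm (S n z) \<le> 2 * pi * (C / d)" if z: "z \<in> \<D>" for n z
  proof -
    have "norm (S n z) \<le> (\<Sum>j<Suc n. (2*pi / real (Suc n)) * (C / d))"
      unfolding S_def
    proof (rule sum_norm_le)
      fix j assume "j \<in> {..<Suc n}"
      then have t: "0 + 2*pi * real j / real (Suc n) \<in> {0..2*pi}" (is "?t \<in> _")
        by (auto simp: divide_le_eq)
      have "norm (N ?t / (g (\<xi> ?t) - F z)) \<le> C / d"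
      proof -
        have "F z \<in> K" using F(2) z by blast
        from d(2)[OF t this] show ?thesis
          unfolding norm_divide using C(2)[OF t] d(1) C(1) by (intro frac_le) (auto simp: dist_norm)
      qed
      then show "norm ((2*pi / real (Suc n)) *\<^sub>R (N ?t / (g (\<xi> ?t) - F z))) \<le> (2*pi / real (Suc n)) * (C / d)"
        unfolding norm_scaleR by (intro mult_mono) auto
    qed
    also have "\<dots> = 2 * pi * (C / d)" by simp
    finally show ?thesis .
  qed
  have "(\<lambda>z. 2 * pi * f (F z)) \<in> Y"
    by (rule lim[of S, OF SY bound lim']) auto
  from scale[OF this, of "1 / of_real (2 * pi)"] show ?thesis by simp
qed

text \<open>The power series of a dilate converges absolutely on the closed disc, so the dilate is
  in Y; the dilates converge boundedly to f.\<close>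

lemma bhol_mem:
  assumes id: "(\<lambda>z. z) \<in> Y" and f: "bhol f"
  shows "f \<in> Y"
proof -
  obtain M where M: "\<And>z. z \<in> \<D> \<Longrightarrow> norm (f z) \<le> M" using f unfolding bhol_def by blast
  have hol: "f holomorphic_on \<D>" using f by (simp add: bhol_def)
  obtain \<rho> :: "nat \<Rightarrow> real" where \<rho>: "\<And>n. 0 < \<rho> n" "\<And>n. \<rho> n < 1" and \<rho>1: "\<rho> \<longlonglongrightarrow> 1"
    and in_disc: "\<And>n z. z \<in> \<D> \<Longrightarrow> of_real (\<rho> n) * z \<in> \<D>"
    using dilation_sequence by blast
  define a where "a n = (deriv ^^ n) f 0 / fact n" for n
  have a: "(\<lambda>n. a n * w ^ n) sums f w" if "w \<in> \<D>" for w
    using holomorphic_power_series[OF hol that] by (simp add: a_def)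
  show ?thesis
  proof (rule lim[of "\<lambda>n z. f (of_real (\<rho> n) * z)" M])
    fix n
    \<comment> \<open>A point strictly between rho and 1: convergence there gives absolute
      convergence at rho.\<close>
    have "norm (of_real ((1 + \<rho> n) / 2) :: complex) = (1 + \<rho> n) / 2" using \<rho>[of n] unfolding norm_of_real by simp
    then have "summable (\<lambda>k. a k * (of_real ((1 + \<rho> n) / 2)) ^ k)"
      using \<rho>[of n] by (intro sums_summable[OF a]) simp
    then have "summable (\<lambda>k. norm (a k * (of_real (\<rho> n)) ^ k))"
      by (rule powser_insidea) (use \<rho>[of n] in \<open>simp_all only: norm_of_real, auto\<close>)
    then have "(\<lambda>z. \<Sum>k. (a k * of_real (\<rho> n) ^ k) * z ^ k) \<in> Y"
      by (intro power_series[OF id, of 1]) auto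
    then show "(\<lambda>z. f (of_real (\<rho> n) * z)) \<in> Y"
    proof (rule cong)
      fix z :: complex assume "z \<in> \<D>"
      then show "(\<Sum>k. (a k * of_real (\<rho> n) ^ k) * z ^ k) = f (of_real (\<rho> n) * z)"
        using sums_unique[OF a[OF in_disc[of z n]]] by (simp add: power_mult_distrib mult.assoc)
    qed
  next
    fix n z assume "z \<in> \<D>"
    then show "norm (f (of_real (\<rho> n) * z)) \<le> M" using M in_disc by blast
  next
    fix z :: complex assume z: "z \<in> \<D>"
    show "(\<lambda>n. f (of_real (\<rho> n) * z)) \<longlonglongrightarrow> f z"
      by (rule dilation_tendsto[OF holomorphic_on_imp_continuous_on[OF hol] \<rho>1 in_disc[OF z] z])
  qed
qed

end

subsection \<open>Convergence of Riemann maps\<close>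

text \<open>Metric neighbourhoods of K may have holes, so the holes are filled: the unbounded part S
  n of the complement is kept, and U n is the component of the rest that contains K. A point off K
  is separated from late U n because a path off K joins it to a far point.\<close>

lemma simply_connected_neighbourhoods:
  fixes K :: "complex set"
  assumes K: "compact K" "connected K" "K \<noteq> {}" "connected (- K)"
  obtains U B where "\<And>n::nat. open (U n)" "\<And>n. simply_connected (U n)" "\<And>n. K \<subseteq> U n" "\<And>n. U n \<subseteq> ball 0 B"
    "\<And>a. a \<notin> K \<Longrightarrow> \<exists>e>0. \<exists>N. \<forall>n\<ge>N. ball a e \<inter> U n = {}"
proof -
  obtain B where B: "B > 0" "\<And>w. w \<in> K \<Longrightarrow> norm w \<le> B"
    using bounded_pos[THEN iffD1, OF compact_imp_bounded[OF K(1)]] by auto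
  \<comment> \<open>The margin 1 is the largest of the radii 1 / (n + 1), so the exterior E misses
    every N n.\<close>
  define B1 where "B1 = B + 1"
  define b0 :: complex where "b0 = of_real B1"
  have nb0: "norm b0 = B1" using B(1) unfolding b0_def norm_of_real B1_def by simp
  define N where "N n = {w. infdist w K < 1 / real (Suc n)}" for n
  define E where "E = - ball (0::complex) B1"
  have E: "connected E" "b0 \<in> E" unfolding E_def
    using nb0 by (auto intro!: connected_complement_bounded_convex)
  have EN: "E \<subseteq> - N n" for n
  proof
    fix w assume w: "w \<in> E"
    obtain k where k: "k \<in> K" "infdist w K = dist w k"
      using infdist_attains_inf[OF compact_imp_closed[OF K(1)] K(3)] by blast
    have "norm w \<le> dist w k + norm k" by (metis dist_norm norm_triangle_sub add.commute)
    then have "1 \<le> infdist w K" using w B(2)[OF k(1)] k(2) by (simp add: E_def B1_def)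
    moreover have "1 / real (Suc n) \<le> 1" by simp
    ultimately have "\<not> infdist w K < 1 / real (Suc n)" by linarith
    then show "w \<in> - N n" by (simp only: N_def mem_Collect_eq Compl_iff not_False_eq_True)
  qed
  have KN: "K \<subseteq> N n" for n by (auto simp: N_def)
  have "open (N n)" for n unfolding N_def by (intro open_Collect_less continuous_intros)
  then have clN: "closed (- N n)" for n by (simp add: closed_Compl)
  define S where "S n = connected_component_set (- N n) b0" for n
  have S: "closed (S n)" "connected (S n)" "S n \<subseteq> - N n" "E \<subseteq> S n" for n
    unfolding S_def
    by (rule closed_connected_component[OF clN] connected_connected_component connected_component_subset
        connected_component_maximal[OF E(2,1) EN])+
  obtain w0 where w0: "w0 \<in> K" using K(3) by auto
  define U where "U n = connected_component_set (- S n) w0" for n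
  have KS: "K \<subseteq> - S n" for n using KN S(3) by blast
  have U: "open (U n)" "K \<subseteq> U n" "U n \<subseteq> - S n" "connected (U n)" for n
    unfolding U_def
    by (rule open_connected_component[OF open_Compl[OF S(1)]] connected_component_maximal[OF w0 K(2) KS]
        connected_component_subset connected_connected_component)+
  have UB: "U n \<subseteq> ball 0 B1" for n using U(3)[of n] S(4)[of n] by (auto simp: E_def)
  have sc: "simply_connected (U n)" for n
  proof -
    have "w0 \<in> - S n" using KS w0 by auto
    then have "U n \<in> components (- S n)" unfolding U_def by (rule componentsI)
    \<comment> \<open>A component of the complement of a connected set has connected complement.
      This complement is unbounded too, so U n meets the criterion for simple connectivity.\<close>
    then have conn: "connected (- U n)" using component_complement_connected[OF S(2)] by blast
    have unb: "\<not> bounded (- U n)"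
    proof
      assume "bounded (- U n)"
      moreover have "bounded (U n)" using UB bounded_subset[OF bounded_ball] by blast
      ultimately have "bounded (- U n \<union> U n)" by (simp only: bounded_Un)
      moreover have "- U n \<union> U n = UNIV" by auto
      ultimately show False by (metis not_bounded_UNIV)
    qed
    have "C = - U n" if "C \<in> components (- U n)" for C
      using that conn by (metis components_empty components_eq_sing_iff empty_iff singletonD)
    then show ?thesis
      using simply_connected_eq_unbounded_complement_components[OF U(1)] U(4) unb by blast
  qed
  have sep: "\<exists>e>0. \<exists>N. \<forall>n\<ge>N. ball a e \<inter> U n = {}" if a: "a \<notin> K" for a
  proof -
    have opK: "open (- K)" using compact_imp_closed[OF K(1)] by (simp add: open_Compl)
    obtain e where e: "e > 0" "cball a e \<subseteq> - K" using open_contains_cball[of "- K"] opK a by blast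
    have "b0 \<notin> K" using B(2)[of b0] nb0 by (auto simp: B1_def)
    then obtain \<gamma> where \<gamma>: "path \<gamma>" "path_image \<gamma> \<subseteq> - K" "pathstart \<gamma> = a" "pathfinish \<gamma> = b0"
      using connected_open_path_connected[OF opK K(4)] a unfolding path_connected_def by blast
    \<comment> \<open>A compact connected set off K that ties the disc around a to b0; once 1 / (n +
      1) is below its distance from K, it is swallowed by S n.\<close>
    define C where "C = path_image \<gamma> \<union> cball a e"
    have a': "a \<in> path_image \<gamma>" "b0 \<in> path_image \<gamma>"
      using pathstart_in_path_image[of \<gamma>] pathfinish_in_path_image[of \<gamma>] \<gamma> by auto
    have C: "compact C" "connected C" "C \<inter> K = {}" "b0 \<in> C"
    proof -
      have "path_image \<gamma> \<inter> cball a e \<noteq> {}" using a'(1) e(1) by (metis IntI centre_in_cball empty_iff less_imp_le)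
      then show "connected C" unfolding C_def
        using connected_path_image[OF \<gamma>(1)] connected_cball by (rule connected_Un[rotated 2])
      show "compact C" unfolding C_def using compact_path_image[OF \<gamma>(1)] compact_cball by (rule compact_Un)
      show "C \<inter> K = {}" "b0 \<in> C" unfolding C_def using a'(2) e(2) \<gamma>(2) by blast+
    qed
    obtain d where d: "d > 0" "\<And>x y. x \<in> C \<Longrightarrow> y \<in> K \<Longrightarrow> d \<le> dist x y"
      using separate_compact_closed[OF C(1) compact_imp_closed[OF K(1)] C(3)] by blast
    obtain M :: nat where M: "1 / d < real M" using reals_Archimedean2 by blast
    have "ball a e \<inter> U n = {}" if "n \<ge> M" for n
    proof -
      have "1 / d < real (Suc n)" using M that by linarith
      then have small: "1 / real (Suc n) < d" using d(1) by (simp add: field_simps)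
      have "C \<subseteq> - N n"
      proof
        fix x assume x: "x \<in> C"
        obtain k where k: "k \<in> K" "infdist x K = dist x k"
          using infdist_attains_inf[OF compact_imp_closed[OF K(1)] K(3)] by blast
        show "x \<in> - N n" using d(2)[OF x k(1)] k(2) small by (simp add: N_def)
      qed
      then have "C \<subseteq> S n" unfolding S_def by (intro connected_component_maximal C)
      then show ?thesis using U(3)[of n] ball_subset_cball[of a e] unfolding C_def by blast
    qed
    then show ?thesis using e(1) by blast
  qed
  show thesis by (rule that[OF U(1) sc U(2) UB sep])
qed

lemma normalized_riemann_map:
  assumes U: "open U" "simply_connected U" "w0 \<in> U" "U \<noteq> UNIV"
  obtains f g where "f holomorphic_on U" "\<And>w. w \<in> U \<Longrightarrow> f w \<in> \<D> \<and> g (f w) = w"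
    "g holomorphic_on \<D>" "\<And>z. z \<in> \<D> \<Longrightarrow> g z \<in> U \<and> f (g z) = z" "f w0 = 0"
proof -
  obtain f g where f: "f holomorphic_on U" "\<And>w. w \<in> U \<Longrightarrow> f w \<in> \<D> \<and> g (f w) = w"
    and g: "g holomorphic_on \<D>" "\<And>z. z \<in> \<D> \<Longrightarrow> g z \<in> U \<and> f (g z) = z"
    using iffD1[OF Riemann_mapping_theorem, OF conjI[OF U(1,2)]] U(3,4) by blast
  obtain m k where m: "m (f w0) = 0" "m holomorphic_on \<D>" "m ` \<D> \<subseteq> \<D>" "k holomorphic_on \<D>" "k ` \<D> \<subseteq> \<D>"
      "\<And>z. z \<in> \<D> \<Longrightarrow> m (k z) = z" "\<And>z. z \<in> \<D> \<Longrightarrow> k (m z) = z"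
    using ball_biholomorphism_exists[of "f w0"] f(2)[OF U(3)] by metis
  have mD: "m z \<in> \<D>" "k z \<in> \<D>" if "z \<in> \<D>" for z using m(3,5) that by blast+
  show thesis
  proof (rule that[of "\<lambda>w. m (f w)" "\<lambda>z. g (k z)"])
    show "(\<lambda>w. m (f w)) holomorphic_on U"
      by (rule holomorphic_on_compose_gen[OF f(1) m(2), unfolded o_def]) (use f(2) in blast)
    show "(\<lambda>z. g (k z)) holomorphic_on \<D>"
      by (rule holomorphic_on_compose_gen[OF m(4) g(1), unfolded o_def]) (use m(5) in blast)
    show "m (f w) \<in> \<D> \<and> g (k (m (f w))) = w" if "w \<in> U" for w
      using f(2)[OF that] mD(1)[of "f w"] m(7)[of "f w"] by simp
    show "g (k z) \<in> U \<and> m (f (g (k z))) = z" if "z \<in> \<D>" for z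
      using g(2)[OF mD(2)[OF that]] m(6)[OF that] by simp
    show "m (f w0) = 0" by (rule m(1))
  qed
qed

lemma uniform_limit_tendsto_compose:
  fixes f :: "nat \<Rightarrow> 'a::metric_space \<Rightarrow> 'b::metric_space"
  assumes u: "uniform_limit K f g sequentially" and g: "continuous_on K g" and y: "y \<in> K"
    and x: "\<forall>\<^sub>F n in sequentially. x n \<in> K" "x \<longlonglongrightarrow> y"
  shows "(\<lambda>n. f n (x n)) \<longlonglongrightarrow> g y"
proof (rule tendstoI)
  fix e :: real assume e: "e > 0"
  have "(\<lambda>n. g (x n)) \<longlonglongrightarrow> g y"
    by (rule continuous_on_tendsto_compose[OF g x(2) y x(1)])
  then have "\<forall>\<^sub>F n in sequentially. dist (g (x n)) (g y) < e / 2" using e by (intro tendstoD) auto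
  moreover have "\<forall>\<^sub>F n in sequentially. \<forall>z\<in>K. dist (f n z) (g z) < e / 2"
    using uniform_limitD[OF u, of "e / 2"] e by simp
  ultimately show "\<forall>\<^sub>F n in sequentially. dist (f n (x n)) (g y) < e"
    using x(1)
  proof eventually_elim
    case (elim n)
    have "dist (f n (x n)) (g y) \<le> dist (f n (x n)) (g (x n)) + dist (g (x n)) (g y)" by (rule dist_triangle)
    also have "\<dots> < e" using elim by fastforce
    finally show ?case .
  qed
qed

(* Caratheodory kernel convergence: the Riemann maps of simply connected neighbourhoods shrinking
   to K converge, after composition with F, to a rotation. *)
lemma (in bp_algebra) farrell:
  assumes FY: "F \<in> Y" and F: "F holomorphic_on \<D>" "inj_on F \<D>"
    and K: "K = closure (F ` \<D>)" "connected (- K)" "interior K = F ` \<D>"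
  shows "(\<lambda>z. z) \<in> Y"
proof -
  obtain M where M: "\<And>z. z \<in> \<D> \<Longrightarrow> norm (F z) \<le> M" using bounded[OF FY] by blast
  then have "bounded (F ` \<D>)" by (auto simp: bounded_iff intro!: exI[of _ M])
  then have cK: "compact K" by (simp add: K(1) compact_closure)
  have FK: "F z \<in> K" if "z \<in> \<D>" for z unfolding K(1) using closure_subset[of "F ` \<D>"] imageI[OF that, of F] by blast
  have "connected (F ` \<D>)"
    by (intro connected_continuous_image holomorphic_on_imp_continuous_on F) auto
  then have connK: "connected K" by (simp add: K(1) connected_imp_connected_closure)
  define w0 where "w0 = F 0"
  have w0: "w0 \<in> K" using FK by (simp add: w0_def)
  then have Kne: "K \<noteq> {}" by auto
  have openF: "open (F ` \<D>)" by (rule open_mapping_thm3[OF F(1) open_ball F(2)])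
  obtain G where G: "G holomorphic_on F ` \<D>" "\<And>z. z \<in> \<D> \<Longrightarrow> G (F z) = z"
    using holomorphic_has_inverse[OF F(1) open_ball F(2)] by metis
  obtain U B where U: "\<And>n::nat. open (U n)" "\<And>n. simply_connected (U n)" "\<And>n. K \<subseteq> U n" "\<And>n. U n \<subseteq> ball 0 B"
    "\<And>a. a \<notin> K \<Longrightarrow> \<exists>e>0. \<exists>N. \<forall>n\<ge>N. ball a e \<inter> U n = {}"
    using simply_connected_neighbourhoods[OF cK connK Kne K(2)] by metis
  have "w0 \<in> ball 0 B" using U(3)[of 0] U(4)[of 0] w0 by blast
  then have B: "B > 0" using norm_ge_zero[of w0] unfolding mem_ball_0 by linarith
  have UU: "U n \<noteq> UNIV" for n
  proof
    assume "U n = UNIV"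
    then have "bounded (UNIV :: complex set)" using bounded_subset[OF bounded_ball U(4)[of n]] by simp
    then show False using not_bounded_UNIV by blast
  qed
  define P where "P n f g \<longleftrightarrow> f holomorphic_on U n \<and> (\<forall>w\<in>U n. f w \<in> \<D> \<and> g (f w) = w) \<and>
    g holomorphic_on \<D> \<and> (\<forall>z\<in>\<D>. g z \<in> U n \<and> f (g z) = z) \<and> f w0 = 0" for n f g
  have "\<exists>f g. P n f g" for n
  proof -
    have "w0 \<in> U n" using w0 U(3) by blast
    from normalized_riemann_map[OF U(1,2) this UU] show ?thesis unfolding P_def by metis
  qed
  then obtain f g where "\<And>n. P n (f n) (g n)" by metis
  then have f: "\<And>n. f n holomorphic_on U n" "\<And>n w. w \<in> U n \<Longrightarrow> f n w \<in> \<D> \<and> g n (f n w) = w"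
    and g: "\<And>n. g n holomorphic_on \<D>" "\<And>n z. z \<in> \<D> \<Longrightarrow> g n z \<in> U n \<and> f n (g n z) = z" and f0: "\<And>n. f n w0 = 0"
    unfolding P_def by blast+
  define u where "u n z = f n (F z)" for n z
  have FU: "F z \<in> U n" if "z \<in> \<D>" for z n using FK[OF that] U(3) by blast
  have uY: "u n \<in> Y" for n
  proof -
    have "F ` \<D> \<subseteq> K" using FK by blast
    then show ?thesis unfolding u_def by (rule conformal_map_comp[OF FY _ cK K(2) U(1,3) f g])
  qed
  have holu: "u n holomorphic_on \<D>" for n
    unfolding u_def by (rule holomorphic_on_compose_gen[OF F(1) f(1), unfolded o_def]) (use FU in blast)
  have uD: "norm (u n z) < 1" if "z \<in> \<D>" for n z using f(2)[OF FU[OF that], of n] by (simp add: u_def)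
  have bd: "norm x \<le> c / (1 - norm z)" if "z \<in> \<D>" "norm x \<le> c" "c \<ge> 0" for x z :: complex and c
  proof -
    have "c * (1 - norm z) \<le> c * 1" using that by (intro mult_left_mono) auto
    then have "c \<le> c / (1 - norm z)" using that(1) by (simp add: pos_le_divide_eq)
    then show ?thesis using that(2) by linarith
  qed
  have gB: "norm (g n z) \<le> B" if "z \<in> \<D>" for n z using g(2)[OF that, of n] U(4)[of n] by fastforce
  have bdu: "norm (u n z) \<le> 1 / (1 - norm z)" if "z \<in> \<D>" for n z
    by (rule bd[OF that less_imp_le[OF uD[OF that]]]) simp
  have bdg: "norm (g n z) \<le> B / (1 - norm z)" if "z \<in> \<D>" for n z
    by (rule bd[OF that gB[OF that]]) (use B in simp)
  obtain v k where v: "v holomorphic_on \<D>" "strict_mono (k :: nat \<Rightarrow> nat)"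
    "\<And>z. z \<in> \<D> \<Longrightarrow> (\<lambda>n. u (k n) z) \<longlonglongrightarrow> v z"
    "\<And>K. compact K \<Longrightarrow> K \<subseteq> \<D> \<Longrightarrow> uniform_limit K (u \<circ> k) v sequentially"
    by (rule montel_disc[of u, OF holu bdu]) (assumption, rule that)
  obtain \<omega> l where \<omega>: "\<omega> holomorphic_on \<D>" "strict_mono (l :: nat \<Rightarrow> nat)"
    "\<And>z. z \<in> \<D> \<Longrightarrow> (\<lambda>n. g (k (l n)) z) \<longlonglongrightarrow> \<omega> z"
    by (rule montel_disc[of "\<lambda>n. g (k n)", OF g(1) bdg]) (assumption, rule that)
  have kl: "strict_mono (\<lambda>n. k (l n))" using strict_mono_o[OF v(2) \<omega>(2)] by (simp add: o_def)
  have unif: "uniform_limit C (\<lambda>n. u (k (l n))) v sequentially" if "compact C" "C \<subseteq> \<D>" for C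
    using filterlim_compose[OF v(4)[OF that] filterlim_subseq[OF \<omega>(2)]] by (simp add: o_def)
  \<comment> \<open>Once g_n z lies in the range of F, the relation f_n (g_n z) = z reads u_n (G
    (g_n z)) = z, and locally uniform convergence passes to the limit.\<close>
  have key: "v (G (\<omega> z)) = z" if z: "z \<in> \<D>" "\<omega> z \<in> F ` \<D>" for z
  proof -
    have ev: "\<forall>\<^sub>F n in sequentially. g (k (l n)) z \<in> F ` \<D>"
      using topological_tendstoD[OF \<omega>(3)[OF z(1)] openF z(2)] .
    have contG: "continuous_on (F ` \<D>) G" by (rule holomorphic_on_imp_continuous_on[OF G(1)])
    have y: "(\<lambda>n. G (g (k (l n)) z)) \<longlonglongrightarrow> G (\<omega> z)"
      by (rule continuous_on_tendsto_compose[OF contG \<omega>(3)[OF z(1)] z(2) ev])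
    have GD: "G (\<omega> z) \<in> \<D>" using z(2) G(2) by auto
    obtain e where e: "e > 0" "cball (G (\<omega> z)) e \<subseteq> \<D>" using open_contains_cball[of \<D>] GD by blast
    have "(\<lambda>n. u (k (l n)) (G (g (k (l n)) z))) \<longlonglongrightarrow> v (G (\<omega> z))"
    proof (rule uniform_limit_tendsto_compose[OF unif[OF compact_cball e(2)] _ _ _ y])
      show "continuous_on (cball (G (\<omega> z)) e) v"
        using holomorphic_on_imp_continuous_on[OF v(1)] e(2) continuous_on_subset by blast
      have "\<forall>\<^sub>F n in sequentially. dist (G (g (k (l n)) z)) (G (\<omega> z)) < e" using y e(1) by (rule tendstoD)
      then show "\<forall>\<^sub>F n in sequentially. G (g (k (l n)) z) \<in> cball (G (\<omega> z)) e"
        by eventually_elim (simp add: dist_commute)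
    qed (use e in auto)
    moreover have "\<forall>\<^sub>F n in sequentially. u (k (l n)) (G (g (k (l n)) z)) = z"
      using ev
    proof eventually_elim
      case (elim n)
      then obtain x where x: "x \<in> \<D>" "g (k (l n)) z = F x" by auto
      have "f (k (l n)) (g (k (l n)) z) = z" using g(2)[OF z(1)] by blast
      then show ?case using x G(2)[OF x(1)] by (simp add: u_def)
    qed
    then have "(\<lambda>n. u (k (l n)) (G (g (k (l n)) z))) \<longlonglongrightarrow> z" by (rule tendsto_eventually)
    ultimately show ?thesis by (rule LIMSEQ_unique)
  qed
  have v0: "v 0 = 0"
  proof -
    have "u n 0 = 0" for n by (simp add: u_def f0 flip: w0_def)
    moreover have "(\<lambda>n. u (k n) 0) \<longlonglongrightarrow> v 0" by (rule v(3)) simp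
    ultimately show ?thesis by (simp add: LIMSEQ_const_iff)
  qed
  have \<omega>0: "\<omega> 0 = w0"
  proof -
    have "g n 0 = w0" for n using f(2)[of w0 n] f0[of n] U(3)[of n] w0 by (metis subsetD)
    moreover have "(\<lambda>n. g (k (l n)) 0) \<longlonglongrightarrow> \<omega> 0" by (rule \<omega>(3)) simp
    ultimately show ?thesis by (simp add: LIMSEQ_const_iff)
  qed
  have GF0: "G w0 = 0" using G(2)[of 0] by (simp add: w0_def)
  \<comment> \<open>A constant limit would be w0, which lies in the range of F, and
    \<open>key\<close> would then give v 0 = 1/2.\<close>
  have nconst: "\<not> \<omega> constant_on \<D>"
  proof
    assume "\<omega> constant_on \<D>"
    then obtain y where y: "\<And>z. z \<in> \<D> \<Longrightarrow> \<omega> z = y" unfolding constant_on_def by blast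
    have "\<omega> (1/2) = w0" using y[of "1/2"] y[of 0] \<omega>0 by simp
    then have "v (G w0) = 1/2" using key[of "1/2"] by (simp add: w0_def)
    then show False using v0 GF0 by simp
  qed
  have \<omega>K: "\<omega> z \<in> K" if z: "z \<in> \<D>" for z
  proof (rule ccontr)
    assume "\<omega> z \<notin> K"
    then obtain e N where e: "e > 0" "\<And>n. n \<ge> N \<Longrightarrow> ball (\<omega> z) e \<inter> U n = {}" using U(5) by blast
    have "\<forall>\<^sub>F n in sequentially. dist (g (k (l n)) z) (\<omega> z) < e" using \<omega>(3)[OF z] e(1) by (rule tendstoD)
    moreover have "\<forall>\<^sub>F n in sequentially. n \<ge> N" by (rule eventually_ge_at_top)
    ultimately have "\<forall>\<^sub>F n in sequentially. False"
    proof eventually_elim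
      case (elim n)
      have "k (l n) \<ge> N" using seq_suble[OF kl, of n] elim(2) by simp
      then have "ball (\<omega> z) e \<inter> U (k (l n)) = {}" by (rule e(2))
      moreover have "g (k (l n)) z \<in> U (k (l n))" using g(2)[OF z] by blast
      moreover have "g (k (l n)) z \<in> ball (\<omega> z) e" using elim(1) by (simp add: dist_commute)
      ultimately show ?case by blast
    qed
    then show False by simp
  qed
  \<comment> \<open>Here the regularity of K enters: an open subset of K lies in its interior, which
    is the range of F.\<close>
  have "open (\<omega> ` \<D>)" by (rule open_mapping_thm[OF \<omega>(1) open_ball connected_ball open_ball order_refl nconst])
  moreover have "\<omega> ` \<D> \<subseteq> K" using \<omega>K by blast
  ultimately have "\<omega> ` \<D> \<subseteq> F ` \<D>" using interior_maximal K(3) by metis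
  then have \<omega>F: "\<omega> z \<in> F ` \<D>" if "z \<in> \<D>" for z using that by blast
  define \<kappa> where "\<kappa> z = G (\<omega> z)" for z
  have \<kappa>D: "\<kappa> z \<in> \<D>" if "z \<in> \<D>" for z using \<omega>F[OF that] G(2) by (auto simp: \<kappa>_def)
  have hol\<kappa>: "\<kappa> holomorphic_on \<D>"
    unfolding \<kappa>_def by (rule holomorphic_on_compose_gen[OF \<omega>(1) G(1), unfolded o_def]) (use \<omega>F in blast)
  have v\<kappa>: "v (\<kappa> z) = z" if "z \<in> \<D>" for z using key[OF that \<omega>F[OF that]] by (simp add: \<kappa>_def)
  have \<kappa>0: "\<kappa> 0 = 0" by (simp add: \<kappa>_def \<omega>0 GF0)
  have half: "(1/2 :: complex) \<in> \<D>" by simp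
  have nconstv: "\<not> v constant_on \<D>"
  proof
    assume "v constant_on \<D>"
    then obtain y where y: "\<And>z. z \<in> \<D> \<Longrightarrow> v z = y" unfolding constant_on_def by blast
    have "v (\<kappa> (1/2)) = v 0" using y[OF \<kappa>D[OF half]] y[of 0] by simp
    then show False using v\<kappa>[OF half] v0 by simp
  qed
  \<comment> \<open>As a limit v has modulus at most 1; openness of its range excludes the value
    1.\<close>
  have vD: "norm (v z) < 1" if "norm z < 1" for z
  proof -
    have "open (v ` \<D>)" by (rule open_mapping_thm[OF v(1) open_ball connected_ball open_ball order_refl nconstv])
    moreover have "v ` \<D> \<subseteq> cball 0 1"
    proof clarsimp
      fix z :: complex assume z: "norm z < 1"
      show "norm (v z) \<le> 1"
        by (rule LIMSEQ_le_const2[OF tendsto_norm[OF v(3)]]) (use z uD in \<open>auto intro: less_imp_le\<close>)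
    qed
    ultimately have "v ` \<D> \<subseteq> interior (cball 0 1)" by (rule interior_maximal[rotated])
    moreover have "z \<in> \<D>" using that by simp
    ultimately have "v z \<in> interior (cball 0 1)" by blast
    then show ?thesis by simp
  qed
  \<comment> \<open>Both v and \<kappa> map the disc into itself and fix 0, and v undoes \<kappa>.
    Schwarz's lemma for each gives the two inequalities, and equality makes v a rotation.\<close>
  have "norm (\<kappa> (1/2)) \<le> norm (v (\<kappa> (1/2)))"
    unfolding v\<kappa>[OF half] by (rule Schwarz_Lemma(1)[OF hol\<kappa> \<kappa>0]) (use \<kappa>D half in auto)
  moreover have "norm (v (\<kappa> (1/2))) \<le> norm (\<kappa> (1/2))"
    by (rule Schwarz_Lemma(1)[OF v(1) v0 vD]) (use \<kappa>D[OF half] in auto)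
  ultimately have eq: "norm (v (\<kappa> (1/2))) = norm (\<kappa> (1/2))" by (rule order_antisym[rotated])
  have "\<kappa> (1/2) \<noteq> 0" using v\<kappa>[OF half] v0 by auto
  then have "\<exists>z. norm z < 1 \<and> z \<noteq> 0 \<and> norm (v z) = norm z" using eq \<kappa>D[OF half] by auto
  then obtain \<alpha> where \<alpha>: "\<And>z. norm z < 1 \<Longrightarrow> v z = \<alpha> * z" "norm \<alpha> = 1"
    using Schwarz_Lemma(3)[OF v(1) v0 vD, of 0] by auto
  have "v \<in> Y" by (rule lim[of "\<lambda>n. u (k n)" 1, OF uY _ v(3)]) (use uD in \<open>auto intro: less_imp_le\<close>)
  then have "(\<lambda>z. (1 / \<alpha>) * v z) \<in> Y" by (rule scale)
  then show ?thesis
  proof (rule cong)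
    show "(1 / \<alpha>) * v z = z" if "z \<in> \<D>" for z
      using \<alpha>(1)[of z] \<alpha>(2) that by auto
  qed
qed

subsection \<open>The algebra generated by exponentials\<close>

text \<open>Montel provides a subsequence with a holomorphic limit, which can only be f.\<close>

lemma bhol_limit:
  assumes F: "\<And>n. F n holomorphic_on \<D>" "\<And>n z. z \<in> \<D> \<Longrightarrow> norm (F n z) \<le> M"
    and lim: "\<And>z. z \<in> \<D> \<Longrightarrow> (\<lambda>n. F n z) \<longlonglongrightarrow> f z"
  shows "bhol f"
proof -
  have M: "M \<ge> 0" using F(2)[of 0 undefined] norm_ge_zero[of "F undefined 0"] by (simp del: norm_ge_zero)
  have bd: "norm (F n z) \<le> M / (1 - norm z)" if "z \<in> \<D>" for n z
  proof -
    have "M * (1 - norm z) \<le> M * 1" using that M by (intro mult_left_mono) auto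
    then have "M \<le> M / (1 - norm z)" using that by (simp add: pos_le_divide_eq)
    then show ?thesis using F(2)[OF that, of n] by linarith
  qed
  obtain g k where g: "g holomorphic_on \<D>" "strict_mono (k :: nat \<Rightarrow> nat)"
    "\<And>z. z \<in> \<D> \<Longrightarrow> (\<lambda>n. F (k n) z) \<longlonglongrightarrow> g z"
    by (rule montel_disc[of F, OF F(1) bd]) (assumption, rule that)
  have "g z = f z" if "z \<in> \<D>" for z
    using LIMSEQ_unique[OF g(3)[OF that]] LIMSEQ_subseq_LIMSEQ[OF lim[OF that] g(2)] by (simp add: o_def)
  then have "f holomorphic_on \<D>" using g(1) holomorphic_transform by blast
  moreover have "norm (f z) \<le> M" if "z \<in> \<D>" for z
    by (rule LIMSEQ_le_const2[OF tendsto_norm[OF lim[OF that]]]) (use F(2)[OF that] in auto)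
  ultimately show ?thesis unfolding bhol_def by blast
qed

text \<open>Limits are iterated freely, because a single passage to limits need not produce a closed
  set. Only linear operations are built in, so that identities between linear operators can be
  proved by induction; products follow separately.\<close>

inductive_set bp_span :: "(complex \<Rightarrow> complex) set \<Rightarrow> (complex \<Rightarrow> complex) set" for S where
  base: "f \<in> S \<Longrightarrow> f \<in> bp_span S"
| add: "f \<in> bp_span S \<Longrightarrow> g \<in> bp_span S \<Longrightarrow> (\<lambda>z. f z + g z) \<in> bp_span S"
| scale: "f \<in> bp_span S \<Longrightarrow> (\<lambda>z. c * f z) \<in> bp_span S"
| lim: "(\<And>n. F n \<in> bp_span S) \<Longrightarrow> (\<And>n z. z \<in> \<D> \<Longrightarrow> norm (F n z) \<le> M) \<Longrightarrow>
    (\<And>z. z \<in> \<D> \<Longrightarrow> (\<lambda>n. F n z) \<longlonglongrightarrow> f z) \<Longrightarrow> f \<in> bp_span S"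

lemma bp_span_bhol:
  assumes "f \<in> bp_span S" and S: "\<And>f. f \<in> S \<Longrightarrow> bhol f"
  shows "bhol f"
  using assms(1)
proof induction
  case (lim F M f)
  show ?case
    by (rule bhol_limit[of F M]) (use lim in \<open>auto simp: bhol_def\<close>)
qed (use S in \<open>auto intro: bhol_add bhol_mult[OF bhol_const]\<close>)

lemma bp_span_mult_aux:
  assumes "f \<in> bp_span S" "\<And>z. z \<in> \<D> \<Longrightarrow> norm (s z) \<le> C"
    and S: "\<And>f. f \<in> S \<Longrightarrow> (\<lambda>z. f z * s z) \<in> bp_span S"
  shows "(\<lambda>z. f z * s z) \<in> bp_span S"
  using assms(1)
proof induction
  case (base f)
  then show ?case by (rule S)
next
  case (add f g)
  then show ?case using bp_span.add[OF add.IH] by (simp add: distrib_right)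
next
  case (scale f c)
  then show ?case using bp_span.scale[OF scale.IH, of c] by (simp add: mult.assoc)
next
  case (lim F M f)
  show ?case
  proof (rule bp_span.lim[OF lim.IH])
    fix n and z :: complex assume z: "z \<in> \<D>"
    show "norm (F n z * s z) \<le> M * C"
      unfolding norm_mult by (intro mult_mono' lim.hyps(2) assms(2) z norm_ge_zero)
  next
    fix z :: complex assume z: "z \<in> \<D>"
    show "(\<lambda>n. F n z * s z) \<longlonglongrightarrow> f z * s z" by (intro tendsto_intros lim.hyps(3) z)
  qed
qed

text \<open>Two inductions: first against a fixed factor from S, then, by means of that, against an
  arbitrary fixed factor.\<close>

lemma bp_span_mult:
  assumes S: "\<And>f. f \<in> S \<Longrightarrow> bhol f" "\<And>f g. f \<in> S \<Longrightarrow> g \<in> S \<Longrightarrow> (\<lambda>z. f z * g z) \<in> S"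
    and f: "f \<in> bp_span S" and g: "g \<in> bp_span S"
  shows "(\<lambda>z. f z * g z) \<in> bp_span S"
proof -
  have bd: "\<exists>C. \<forall>z\<in>\<D>. norm (k z) \<le> C" if "k \<in> bp_span S" for k
    using bp_span_bhol[OF that S(1)] by (auto simp: bhol_def)
  have 1: "(\<lambda>z. k z * s z) \<in> bp_span S" if k: "k \<in> bp_span S" and s: "s \<in> S" for k s
  proof -
    obtain C where "\<And>z. z \<in> \<D> \<Longrightarrow> norm (s z) \<le> C" using bd[OF bp_span.base[OF s]] by blast
    then show ?thesis using bp_span_mult_aux[OF k] bp_span.base[OF S(2)[OF _ s]] by blast
  qed
  obtain C where C: "\<And>z. z \<in> \<D> \<Longrightarrow> norm (g z) \<le> C" using bd[OF g] by blast
  have 2: "(\<lambda>z. k z * g z) \<in> bp_span S" if "k \<in> S" for k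
    using 1[OF g that] by (simp add: mult.commute)
  show ?thesis by (rule bp_span_mult_aux[OF f C 2])
qed

lemma bp_algebra_span:
  assumes S: "\<And>f. f \<in> S \<Longrightarrow> bhol f" "\<And>f g. f \<in> S \<Longrightarrow> g \<in> S \<Longrightarrow> (\<lambda>z. f z * g z) \<in> S"
    and one: "(\<lambda>z. 1) \<in> bp_span S"
  shows "bp_algebra (bp_span S)"
proof
  fix f assume "f \<in> bp_span S"
  from bp_span_bhol[OF this S(1)] show "\<exists>M. \<forall>z\<in>\<D>. norm (f z) \<le> M" by (auto simp: bhol_def)
next
  fix c show "(\<lambda>z. c) \<in> bp_span S" using bp_span.scale[OF one, of c] by simp
next
  fix F M f
  assume "\<And>n. F n \<in> bp_span S" "\<And>n z. z \<in> \<D> \<Longrightarrow> norm (F n z) \<le> M"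
    "\<And>z. z \<in> \<D> \<Longrightarrow> (\<lambda>n. F n z) \<longlonglongrightarrow> f z"
  then show "f \<in> bp_span S" by (rule bp_span.lim)
qed (auto intro: bp_span.add bp_span_mult[OF S])

definition exp_family :: "(complex \<Rightarrow> complex) \<Rightarrow> (complex \<Rightarrow> complex) set" where
  "exp_family g = {\<lambda>z. exp (- (of_real x * g z)) | x. x > 0}"

lemma norm_exp_family:
  assumes "Re w > 0" "x > 0"
  shows "norm (exp (- (of_real x * w))) \<le> 1"
  using assms by simp

lemma exp_family_bhol:
  assumes g: "g holomorphic_on \<D>" "\<And>z. z \<in> \<D> \<Longrightarrow> Re (g z) > 0" and f: "f \<in> exp_family g"
  shows "bhol f"
proof -
  obtain x where x: "x > 0" "f = (\<lambda>z. exp (- (of_real x * g z)))" using f by (auto simp: exp_family_def)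
  have "f holomorphic_on \<D>" unfolding x(2) by (intro holomorphic_intros g)
  moreover have "\<forall>z\<in>\<D>. norm (f z) \<le> 1" unfolding x(2) using norm_exp_family g(2) x(1) by blast
  ultimately show ?thesis unfolding bhol_def by blast
qed

text \<open>The derivative of exp (- x w) at x = 0, by which g is recovered from its
  exponentials.\<close>

lemma exp_difference_quotient_limit:
  "(\<lambda>n. of_nat (Suc n) * (1 - exp (- (of_real (1 / real (Suc n)) * w)))) \<longlonglongrightarrow> (w :: complex)"
proof -
  have "((\<lambda>x. exp (- (x * w))) has_field_derivative - w) (at 0)"
    by (auto intro!: derivative_eq_intros)
  then have "(\<lambda>h. (exp (- (h * w)) - 1) / h) \<midarrow>0\<rightarrow> - w"
    by (simp add: DERIV_def)
  moreover have "filterlim (\<lambda>n. of_real (1 / real (Suc n)) :: complex) (at 0) sequentially"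
  proof (rule filterlim_atI)
    have "(\<lambda>n. 1 / real (Suc n)) \<longlonglongrightarrow> 0" by (rule LIMSEQ_Suc[OF lim_1_over_n])
    then have "(\<lambda>n. of_real (1 / real (Suc n)) :: complex) \<longlonglongrightarrow> of_real 0" by (rule tendsto_of_real)
    then show "(\<lambda>n. of_real (1 / real (Suc n)) :: complex) \<longlonglongrightarrow> 0" by (simp only: of_real_0)
  qed (auto intro!: always_eventually simp del: of_nat_Suc)
  ultimately have "(\<lambda>n. (exp (- (of_real (1 / real (Suc n)) * w)) - 1) / of_real (1 / real (Suc n))) \<longlonglongrightarrow> - w"
    by (rule filterlim_compose)
  from tendsto_minus[OF this] show ?thesis
    by (simp add: field_simps del: of_nat_Suc)
qed

text \<open>1 / (1 + g) would be a Laplace transform of the exponentials. It is reached as the limit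
  of R n instead, where g is replaced by its difference quotient; each R n is a Neumann series in
  the single exponential E n.\<close>

lemma exp_family_algebra:
  assumes g: "g holomorphic_on \<D>" "\<And>z. z \<in> \<D> \<Longrightarrow> Re (g z) > 0"
  shows "bp_algebra (bp_span (exp_family g))" "(\<lambda>z. 1 / (1 + g z)) \<in> bp_span (exp_family g)"
proof -
  let ?Y = "bp_span (exp_family g)"
  have inY: "(\<lambda>z. exp (- (of_real x * g z))) \<in> ?Y" if "x > 0" for x
    by (rule bp_span.base) (use that in \<open>auto simp: exp_family_def\<close>)
  show alg: "bp_algebra ?Y"
  proof (rule bp_algebra_span[OF exp_family_bhol[OF g]])
    fix e f assume "e \<in> exp_family g" "f \<in> exp_family g"
    then obtain x y where "x > 0" "y > 0" "e = (\<lambda>z. exp (- (of_real x * g z)))" "f = (\<lambda>z. exp (- (of_real y * g z)))"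
      by (auto simp: exp_family_def)
    then show "(\<lambda>z. e z * f z) \<in> exp_family g"
      unfolding exp_family_def by (intro CollectI exI[of _ "x + y"]) (auto simp: exp_add[symmetric] algebra_simps)
  next
    show "(\<lambda>z. 1) \<in> ?Y"
    proof (rule bp_span.lim[of "\<lambda>n z. exp (- (of_real (1 / real (Suc n)) * g z))" _ 1])
      show "(\<lambda>z. exp (- (of_real (1 / real (Suc n)) * g z))) \<in> ?Y" for n by (rule inY) simp
      show "norm (exp (- (of_real (1 / real (Suc n)) * g z))) \<le> 1" if "z \<in> \<D>" for n z
        by (rule norm_exp_family[OF g(2)[OF that]]) simp
      show "(\<lambda>n. exp (- (of_real (1 / real (Suc n)) * g z))) \<longlonglongrightarrow> 1" for z
      proof -
        have "(\<lambda>n. 1 / real (Suc n)) \<longlonglongrightarrow> 0" by (rule LIMSEQ_Suc[OF lim_1_over_n])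
        then have "(\<lambda>n. of_real (1 / real (Suc n)) :: complex) \<longlonglongrightarrow> of_real 0" by (rule tendsto_of_real)
        then have "(\<lambda>n. exp (- (of_real (1 / real (Suc n)) * g z))) \<longlonglongrightarrow> exp (- (of_real 0 * g z))"
          by (rule tendsto_exp[OF tendsto_minus[OF tendsto_mult[OF _ tendsto_const]]])
        then show ?thesis by simp
      qed
    qed
  qed
  interpret bp_algebra ?Y by (rule alg)
  define E where "E n z = exp (- (of_real (1 / real (Suc n)) * g z))" for n z
  have EY: "E n \<in> ?Y" for n unfolding E_def by (rule inY) simp
  have E1: "norm (E n z) \<le> 1" if "z \<in> \<D>" for n z
    unfolding E_def by (rule norm_exp_family[OF g(2)[OF that]]) simp
  define R where "R n z = 1 / (1 + of_nat (Suc n) * (1 - E n z))" for n z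
  have RY: "R n \<in> ?Y" for n
  proof -
    define N :: complex where "N = of_nat (Suc n)"
    have N: "norm N = real (Suc n)" "norm (1 + N) = 1 + real (Suc n)" "1 + N \<noteq> 0"
    proof -
      show "norm N = real (Suc n)" unfolding N_def by (rule norm_of_nat)
      have "1 + N = of_nat (Suc (Suc n))" by (simp add: N_def)
      then show "norm (1 + N) = 1 + real (Suc n)" "1 + N \<noteq> 0" by (simp_all only: norm_of_nat of_nat_eq_0_iff)
    qed
    \<comment> \<open>Factoring 1 + N out of the denominator of R n leaves a geometric series of
      ratio below 1.\<close>
    have "norm (N / (1 + N)) * 1 < 1" unfolding norm_divide N by simp
    from neumann[OF EY[of n] E1 this]
    have "(\<lambda>z. (1 / (1 + N)) * (1 / (1 - N / (1 + N) * E n z))) \<in> ?Y" by (rule scale)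
    moreover have "(1 / (1 + N)) * (1 / (1 - N / (1 + N) * E n z)) = R n z" for z
    proof -
      have "(1 + N) * (1 - N / (1 + N) * E n z) = 1 + N * (1 - E n z)" using N(3) by (simp add: field_simps)
      then show ?thesis unfolding R_def N_def[symmetric] times_divide_times_eq by simp
    qed
    ultimately show ?thesis by simp
  qed
  show "(\<lambda>z. 1 / (1 + g z)) \<in> ?Y"
  proof (rule bp_span.lim[of R _ 1, OF RY])
    fix n and z :: complex assume z: "z \<in> \<D>"
    \<comment> \<open>As |E n z| <= 1, the denominator of R n has real part at least 1, whence one
      bound for all n.\<close>
    have "Re (E n z) \<le> 1" using E1[OF z, of n] complex_Re_le_cmod[of "E n z"] by linarith
    then have "0 \<le> real (Suc n) * (1 - Re (E n z))" by (intro mult_nonneg_nonneg) auto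
    then have "1 \<le> Re (1 + of_nat (Suc n) * (1 - E n z))" by simp
    also have "\<dots> \<le> norm (1 + of_nat (Suc n) * (1 - E n z))" by (rule complex_Re_le_cmod)
    finally show "norm (R n z) \<le> 1" unfolding R_def norm_divide by (simp add: divide_le_eq)
  next
    fix z :: complex assume z: "z \<in> \<D>"
    have "1 + g z \<noteq> 0" using g(2)[OF z] by (metis add_pos_pos less_irrefl one_complex.simps(1) plus_complex.simps(1) zero_complex.simps(1) zero_less_one)
    then show "(\<lambda>n. R n z) \<longlonglongrightarrow> 1 / (1 + g z)"
      unfolding R_def E_def by (intro tendsto_intros exp_difference_quotient_limit)
  qed
qed

lemma bhol_in_exp_span:
  assumes g: "g holomorphic_on \<D>" "\<And>z. z \<in> \<D> \<Longrightarrow> Re (g z) > 0" "inj_on g \<D>"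
    and F: "F = (\<lambda>z. 1 / (1 + g z))"
    and K: "connected (- closure (F ` \<D>))" "interior (closure (F ` \<D>)) = F ` \<D>"
    and f: "bhol f"
  shows "f \<in> bp_span (exp_family g)"
proof -
  interpret bp_algebra "bp_span (exp_family g)" by (rule exp_family_algebra(1)[OF g(1,2)])
  have nz: "1 + g z \<noteq> 0" if "z \<in> \<D>" for z
    using g(2)[OF that] by (metis add_pos_pos less_irrefl one_complex.simps(1) plus_complex.simps(1) zero_complex.simps(1) zero_less_one)
  have FY: "F \<in> bp_span (exp_family g)" unfolding F by (rule exp_family_algebra(2)[OF g(1,2)])
  have holF: "F holomorphic_on \<D>" unfolding F using nz by (intro holomorphic_intros g) auto
  have injF: "inj_on F \<D>"
  proof (rule inj_onI)
    fix x y assume xy: "x \<in> \<D>" "y \<in> \<D>" "F x = F y"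
    then have "g x = g y" using nz[of x] nz[of y] by (simp add: F divide_eq_eq)
    then show "x = y" using inj_onD[OF g(3)] xy by blast
  qed
  show ?thesis by (rule bhol_mem[OF farrell[OF FY holF injF refl K] f])
qed

subsection \<open>Geometry of the Koenigs domain\<close>

text \<open>Moebius maps on both sides move y and u y to 0, where Schwarz's lemma applies.\<close>

lemma schwarz_pick:
  assumes u: "u holomorphic_on \<D>" "\<And>z. z \<in> \<D> \<Longrightarrow> u z \<in> \<D>" and x: "x \<in> \<D>" and y: "y \<in> \<D>"
  shows "norm ((u x - u y) / (1 - cnj (u y) * u x)) \<le> norm ((x - y) / (1 - cnj y * x))"
proof -
  let ?M = "Moebius_function 0"
  have D: "?M w z \<in> \<D>" if "w \<in> \<D>" "z \<in> \<D>" for w z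
    using Moebius_function_norm_lt_1[of w z 0] that by simp
  have hol: "?M w holomorphic_on \<D>" if "w \<in> \<D>" for w
    by (rule Moebius_function_holomorphic) (use that in simp)
  have my: "- y \<in> \<D>" using y by simp
  define f where "f z = ?M (u y) (u (?M (- y) z))" for z
  have "(\<lambda>z. u (?M (- y) z)) holomorphic_on \<D>"
    by (rule holomorphic_on_compose_gen[OF hol[OF my] u(1), unfolded o_def]) (use D[OF my] in blast)
  then have holf: "f holomorphic_on \<D>" unfolding f_def
    by (rule holomorphic_on_compose_gen[OF _ hol[OF u(2)[OF y]], unfolded o_def]) (use u(2) D[OF my] in blast)
  have f0: "f 0 = 0" by (simp add: f_def Moebius_function_of_zero Moebius_function_eq_zero)
  have fD: "norm (f z) < 1" if "norm z < 1" for z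
    using D[OF u(2)[OF y] u(2)[OF D[OF my, of z]]] that by (simp add: f_def)
  have "?M (- y) (?M y x) = x" by (rule Moebius_function_compose) (use x y in auto)
  then have "f (?M y x) = ?M (u y) (u x)" by (simp add: f_def)
  moreover have "norm (f (?M y x)) \<le> norm (?M y x)"
    by (rule Schwarz_Lemma(1)[OF holf f0 fD]) (use D[OF y x] in auto)
  ultimately show ?thesis by (simp add: Moebius_function_simple)
qed

lemma artanh_mono:
  fixes x y :: real
  assumes "0 \<le> x" "x \<le> y" "y < 1"
  shows "artanh x \<le> artanh y"
proof -
  have "(1 + x) / (1 - x) \<le> (1 + y) / (1 - y)" using assms by (intro frac_le) auto
  then have "ln ((1 + x) / (1 - x)) \<le> ln ((1 + y) / (1 - y))" using assms by (intro ln_mono) auto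
  then show ?thesis by (simp add: artanh_def)
qed

lemma artanh_pos:
  fixes x :: real
  assumes "0 < x" "x < 1"
  shows "0 < artanh x"
proof -
  have "1 < (1 + x) / (1 - x)" using assms by simp
  then have "0 < ln ((1 + x) / (1 - x))" by (rule ln_gt_zero)
  then show ?thesis by (simp add: artanh_def)
qed

lemma pseudo_hyperbolic_lt_1:
  assumes "z \<in> \<D>" "w \<in> \<D>"
  shows "norm ((z - w) / (1 - cnj w * z)) < 1"
  using Moebius_function_norm_lt_1[of w z 0] assms by (simp add: Moebius_function_simple)

lemma decreasing_bounded_tendsto:
  fixes k :: "real \<Rightarrow> real"
  assumes mono: "\<And>t s. 0 \<le> t \<Longrightarrow> t \<le> s \<Longrightarrow> k s \<le> k t" and lb: "\<And>t. 0 \<le> t \<Longrightarrow> c \<le> k t"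
  obtains L where "c \<le> L" "(k \<longlongrightarrow> L) at_top"
proof -
  define L where "L = (INF t\<in>{0..}. k t)"
  have bdd: "bdd_below (k ` {0..})" using lb by (auto intro!: bdd_belowI[of _ c])
  have cL: "c \<le> L" unfolding L_def by (rule cINF_greatest) (use lb in auto)
  have Lk: "L \<le> k t" if "0 \<le> t" for t unfolding L_def by (rule cINF_lower[OF bdd]) (use that in simp)
  have "(k \<longlongrightarrow> L) at_top"
  proof (rule order_tendstoI)
    fix a assume "a < L"
    then show "\<forall>\<^sub>F t in at_top. a < k t"
      using Lk by (intro eventually_at_top_linorderI[of 0]) (auto intro: less_le_trans)
  next
    fix a assume "L < a"
    then obtain t0 where t0: "t0 \<ge> 0" "k t0 < a"
      using cINF_less_iff[OF _ bdd, of a] by (auto simp: L_def)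
    then show "\<forall>\<^sub>F t in at_top. k t < a"
      using mono[of t0] by (intro eventually_at_top_linorderI[of t0]) (meson le_less_trans)
  qed
  then show thesis using that cL by blast
qed

section \<open>Half-planes and translation-stable Koenigs domains\<close>

context
  fixes \<phi> :: "real \<Rightarrow> complex \<Rightarrow> complex" and h :: "complex \<Rightarrow> complex"
  assumes sf: "holomorphic_semiflow \<phi>" and koe: "koenigs_function \<phi> h"
begin

lemma semiflow_D: "0 \<le> t \<Longrightarrow> z \<in> \<D> \<Longrightarrow> \<phi> t z \<in> \<D>"
  using sf unfolding holomorphic_semiflow_def by blast

lemma semiflow_hol: "0 \<le> t \<Longrightarrow> \<phi> t holomorphic_on \<D>"
  using sf unfolding holomorphic_semiflow_def by blast

lemma semiflow_add: "0 \<le> t \<Longrightarrow> 0 \<le> s \<Longrightarrow> z \<in> \<D> \<Longrightarrow> \<phi> (t + s) z = \<phi> t (\<phi> s z)"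
  using sf unfolding holomorphic_semiflow_def by blast

lemma koenigs_hol: "h holomorphic_on \<D>" and koenigs_inj: "inj_on h \<D>"
  and koenigs_translate: "0 \<le> t \<Longrightarrow> z \<in> \<D> \<Longrightarrow> h z + of_real t \<in> h ` \<D>"
  using koe unfolding koenigs_function_def by blast+

lemma koenigs_flow:
  assumes "0 \<le> t" "z \<in> \<D>"
  shows "h (\<phi> t z) = h z + of_real t"
proof -
  have "\<phi> t z = inv_into \<D> h (h z + of_real t)" using koe assms unfolding koenigs_function_def by blast
  then show ?thesis using f_inv_into_f[OF koenigs_translate[OF assms]] by simp
qed

(* If the horizontal lines through the Koenigs domain fill the plane, then the domain contains
   arbitrarily large discs around h z + t as t grows. *)
lemma positive_step_Im:
  assumes "positive_hyperbolic_step \<phi>"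
  shows "\<exists>y. \<forall>z\<in>\<D>. Im (h z) \<noteq> y"
proof (rule ccontr)
  assume "\<not> ?thesis"
  then have onto: "\<exists>z\<in>\<D>. Im (h z) = y" for y by blast
  obtain z L where z: "z \<in> \<D>" and L: "L > 0" "((\<lambda>t. hyperbolic_dist (\<phi> t z) (\<phi> (t + 1) z)) \<longlongrightarrow> L) at_top"
    using assms unfolding positive_hyperbolic_step_def by blast
  define \<Omega> where "\<Omega> = h ` \<D>"
  have open\<Omega>: "open \<Omega>" unfolding \<Omega>_def by (rule open_mapping_thm3[OF koenigs_hol open_ball koenigs_inj])
  obtain k where k: "k holomorphic_on \<Omega>" "\<And>z. z \<in> \<D> \<Longrightarrow> k (h z) = z"
    unfolding \<Omega>_def using holomorphic_has_inverse[OF koenigs_hol open_ball koenigs_inj] by metis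
  have transl: "w + of_real t \<in> \<Omega>" if "w \<in> \<Omega>" "0 \<le> t" for w t
    using that koenigs_translate unfolding \<Omega>_def by blast
  define pd where "pd t = norm ((\<phi> t z - \<phi> (t + 1) z) / (1 - cnj (\<phi> (t + 1) z) * \<phi> t z))" for t
  have small: "\<exists>T\<ge>0. \<forall>t\<ge>T. pd t \<le> 1 / R" if R: "R > 1" for R
  proof -
    \<comment> \<open>Every horizontal line meets Omega, and Omega is stable under translation to
      the right, so each point of the disc enters Omega after a large integer translation;
      compactness leaves finitely many of these.\<close>
    have cover: "cball (h z) R \<subseteq> (\<Union>n::nat. (\<lambda>v. v + of_nat n) -` \<Omega>)"
    proof
      fix v assume "v \<in> cball (h z) R"
      obtain z' where z': "z' \<in> \<D>" "Im (h z') = Im v" using onto by blast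
      obtain n :: nat where n: "Re (h z') - Re v \<le> real n" using real_arch_simple by blast
      have "h z' + of_real (real n + Re v - Re (h z')) \<in> \<Omega>"
        by (rule transl) (use z' n in \<open>auto simp: \<Omega>_def\<close>)
      moreover have "h z' + of_real (real n + Re v - Re (h z')) = v + of_nat n"
        by (rule complex_eqI) (use z' in auto)
      ultimately have "v + of_nat n \<in> \<Omega>" by (simp only:)
      then show "v \<in> (\<Union>n::nat. (\<lambda>v. v + of_nat n) -` \<Omega>)" by blast
    qed
    have "open ((\<lambda>v. v + of_nat n) -` \<Omega>)" for n
      by (intro open_vimage open\<Omega> continuous_intros)
    then obtain N where N: "finite N" "cball (h z) R \<subseteq> (\<Union>n\<in>N. (\<lambda>v. v + of_nat n) -` \<Omega>)"
      using compactE_image[OF compact_cball, of UNIV "\<lambda>n. (\<lambda>v. v + of_nat n) -` \<Omega>" "h z" R] cover by metis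
    \<comment> \<open>The sum is a convenient upper bound of the finite set N.\<close>
    define T where "T = (\<Sum>n\<in>N. real n)"
    have T0: "T \<ge> 0" unfolding T_def by (rule sum_nonneg) simp
    have inO: "v + of_real t \<in> \<Omega>" if v: "v \<in> cball (h z) R" and t: "t \<ge> T" for v t
    proof -
      obtain n where n: "n \<in> N" "v + of_nat n \<in> \<Omega>" using N(2) v by blast
      have "real n \<le> T" unfolding T_def by (rule member_le_sum[OF n(1)]) (use N in auto)
      then have "(v + of_nat n) + of_real (t - real n) \<in> \<Omega>" using t by (intro transl n) auto
      then show ?thesis by simp
    qed
    have "pd t \<le> 1 / R" if t: "t \<ge> T" for t
    proof -
      have t0: "t \<ge> 0" using T0 t by simp
      \<comment> \<open>A self-map of the disc with u 0 = phi_t z and u (1/R) = phi_(t+1) z, so that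
        Schwarz-Pick bounds the step by 1/R.\<close>
      define u where "u \<zeta> = k (h z + of_real R * \<zeta> + of_real t)" for \<zeta>
      have inb: "h z + of_real R * \<zeta> \<in> cball (h z) R" if "\<zeta> \<in> \<D>" for \<zeta>
        using that R mult_left_mono[of "norm \<zeta>" 1 R] by (simp add: dist_norm norm_mult)
      have inO': "h z + of_real R * \<zeta> + of_real t \<in> \<Omega>" if "\<zeta> \<in> \<D>" for \<zeta>
        by (rule inO[OF inb[OF that] t])
      have holu: "u holomorphic_on \<D>"
        unfolding u_def
        by (rule holomorphic_on_compose_gen[OF _ k(1), unfolded o_def]) (use inO' in \<open>auto intro!: holomorphic_intros\<close>)
      have uD: "u \<zeta> \<in> \<D>" if zD: "\<zeta> \<in> \<D>" for \<zeta>
      proof -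
        obtain x where "x \<in> \<D>" "h z + of_real R * \<zeta> + of_real t = h x" using inO'[OF zD] unfolding \<Omega>_def by blast
        then show ?thesis using k(2) by (simp add: u_def)
      qed
      have u0: "u 0 = \<phi> t z"
        using k(2)[OF semiflow_D[OF t0 z]] by (simp add: u_def koenigs_flow[OF t0 z])
      have u1: "u (of_real (1 / R)) = \<phi> (t + 1) z"
        using k(2)[OF semiflow_D[of "t + 1" z]] t0 z koenigs_flow[of "t + 1" z] R
        by (simp add: u_def add.commute add.left_commute)
      have Rd: "(of_real (1 / R) :: complex) \<in> \<D>" using R unfolding mem_ball_0 norm_of_real by simp
      have "pd t = norm ((u 0 - u (of_real (1 / R))) / (1 - cnj (u (of_real (1 / R))) * u 0))"
        by (simp only: pd_def u0 u1)
      also have "\<dots> \<le> norm ((0 - of_real (1 / R)) / (1 - cnj (of_real (1 / R)) * 0) :: complex)"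
        by (rule schwarz_pick[OF holu uD _ Rd]) auto
      also have "\<dots> = 1 / R" using R by (simp add: norm_divide)
      finally show ?thesis .
    qed
    then show ?thesis using T0 by blast
  qed
  have "(pd \<longlongrightarrow> 0) at_top"
  proof (rule tendstoI)
    fix e :: real assume e: "e > 0"
    define R where "R = max 2 (2 / e)"
    have R: "R > 1" by (simp add: R_def)
    have "2 / e \<le> R" by (simp add: R_def)
    then have "1 / R \<le> 1 / (2 / e)" using e by (intro divide_left_mono) (auto simp: R_def)
    then have Re: "1 / R < e" using e by simp
    obtain T where "\<forall>t\<ge>T. pd t \<le> 1 / R" using small[OF R] by blast
    then show "\<forall>\<^sub>F t in at_top. dist (pd t) 0 < e"
      using Re by (intro eventually_at_top_linorderI[of T]) (auto simp: pd_def)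
  qed
  then have "((\<lambda>t. artanh (pd t)) \<longlongrightarrow> artanh 0) at_top" by (rule tendsto_artanh) auto
  then have "L = artanh 0"
    using tendsto_unique[OF _ L(2)] by (simp add: hyperbolic_dist_def pd_def)
  then show False using L(1) by simp
qed

(* Along trajectories exp (i s h) has constant modulus, which bounds the step from below. *)
lemma horizontal_half_plane_positive_step:
  assumes s: "s = 1 \<or> s = - 1" and half: "\<And>z. z \<in> \<D> \<Longrightarrow> s * Im (h z) > b"
  shows "positive_hyperbolic_step \<phi>"
proof -
  \<comment> \<open>The sign s and the shift b carry the half-plane into the unit disc.\<close>
  define E where "E z = exp (of_real s * \<i> * h z + of_real b)" for z
  have normE: "norm (E z) = exp (b - s * Im (h z))" for z
    by (simp add: E_def)
  have ED: "E z \<in> \<D>" if "z \<in> \<D>" for z using half[OF that] unfolding mem_ball_0 normE by simp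
  have holE: "E holomorphic_on \<D>" unfolding E_def by (intro holomorphic_intros koenigs_hol)
  have z0: "(0::complex) \<in> \<D>" by simp
  define pd where "pd t = norm ((\<phi> t 0 - \<phi> (t + 1) 0) / (1 - cnj (\<phi> (t + 1) 0) * \<phi> t 0))" for t
  \<comment> \<open>From one unit of time to the next E is multiplied by exp (s i), at constant
    modulus; the 2 bounds the denominator in Schwarz-Pick.\<close>
  define c where "c = norm (E 0) * norm (1 - exp (of_real s * \<i>)) / 2"
  have "exp (of_real s * \<i>) \<noteq> (1 :: complex)"
  proof
    assume "exp (of_real s * \<i>) = (1 :: complex)"
    then have "Im (exp (of_real s * \<i>)) = 0" by simp
    then have "sin s = 0" by (simp add: Im_exp)
    then have "sin (1::real) = 0" using s by auto
    then show False using sin_gt_zero[of 1] pi_gt3 by simp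
  qed
  then have c: "c > 0" by (simp add: c_def normE)
  have lb: "c \<le> pd t" if t: "0 \<le> t" for t
  proof -
    let ?x = "\<phi> t 0" and ?y = "\<phi> (t + 1) 0"
    have xy: "?x \<in> \<D>" "?y \<in> \<D>" using semiflow_D z0 t by auto
    have hx: "h ?x = h 0 + of_real t" "h ?y = h 0 + of_real t + 1"
      using koenigs_flow[of t 0] koenigs_flow[of "t + 1" 0] t by (auto simp: add.assoc)
    have "norm (E ?x) = norm (E 0)" by (simp add: normE hx)
    moreover have "E ?x - E ?y = E ?x * (1 - exp (of_real s * \<i>))"
      by (simp add: E_def hx exp_add[symmetric] right_diff_distrib) (simp add: algebra_simps exp_add)
    ultimately have diff: "norm (E ?x - E ?y) = 2 * c" by (simp add: c_def norm_mult)
    have "norm (1 - cnj (E ?y) * E ?x) \<le> norm (1::complex) + norm (cnj (E ?y) * E ?x)" by (rule norm_triangle_ineq4)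
    also have "norm (cnj (E ?y) * E ?x) \<le> 1"
      using ED[OF xy(1)] ED[OF xy(2)] by (simp add: norm_mult mult_le_one less_imp_le)
    finally have den: "norm (1 - cnj (E ?y) * E ?x) \<le> 2" by simp
    have nz: "1 - cnj (E ?y) * E ?x \<noteq> 0"
      by (rule moebius_norm_le(2)) (use ED[OF xy(1)] ED[OF xy(2)] in auto)
    have "c = norm (E ?x - E ?y) / 2" by (simp add: diff)
    also have "\<dots> \<le> norm (E ?x - E ?y) / norm (1 - cnj (E ?y) * E ?x)"
      using den nz by (intro divide_left_mono) auto
    also have "\<dots> \<le> pd t"
      unfolding pd_def norm_divide[symmetric] by (rule schwarz_pick[OF holE ED xy])
    finally show ?thesis .
  qed
  have pd1: "pd t < 1" if "0 \<le> t" for t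
    unfolding pd_def by (rule pseudo_hyperbolic_lt_1) (use semiflow_D z0 that in auto)
  \<comment> \<open>Positive step asks that the limit exist: Schwarz-Pick for phi_(r - t) makes the
    steps decrease.\<close>
  have mono: "pd r \<le> pd t" if "0 \<le> t" "t \<le> r" for t r
  proof -
    have "\<phi> r 0 = \<phi> (r - t) (\<phi> t 0)" "\<phi> (r + 1) 0 = \<phi> (r - t) (\<phi> (t + 1) 0)"
      using semiflow_add[of "r - t" t 0] semiflow_add[of "r - t" "t + 1" 0] that by (auto simp: algebra_simps)
    then show ?thesis unfolding pd_def
      using schwarz_pick[OF semiflow_hol[of "r - t"] semiflow_D, of "\<phi> t 0" "\<phi> (t + 1) 0"] semiflow_D z0 that
      by (simp only:)
  qed
  have hd: "hyperbolic_dist (\<phi> t 0) (\<phi> (t + 1) 0) = artanh (pd t)" for t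
    by (simp add: hyperbolic_dist_def pd_def)
  obtain L where L: "artanh c \<le> L" "((\<lambda>t. artanh (pd t)) \<longlongrightarrow> L) at_top"
  proof (rule decreasing_bounded_tendsto[of "\<lambda>t. artanh (pd t)" "artanh c"])
    show "artanh (pd r) \<le> artanh (pd t)" if "0 \<le> t" "t \<le> r" for t r
      by (rule artanh_mono) (use mono pd1 that in \<open>auto simp: pd_def\<close>)
    show "artanh c \<le> artanh (pd t)" if "0 \<le> t" for t
      by (rule artanh_mono) (use lb pd1 c that in auto)
  qed
  have "c < 1" using lb[of 0] pd1[of 0] by simp
  then have L0: "L > 0" using artanh_pos[of c] c L(1) by simp
  have "((\<lambda>t. hyperbolic_dist (\<phi> t 0) (\<phi> (t + 1) 0)) \<longlongrightarrow> L) at_top"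
    unfolding hd by (rule L(2))
  then show ?thesis unfolding positive_hyperbolic_step_def using L0 by (intro bexI[OF _ z0] exI[of _ L] conjI)
qed

text \<open>Omega contains h 0 + t for all t >= 0, and this ray would leave a half-plane with Re a <
  0.\<close>

lemma half_plane_Re_nonneg:
  assumes "h ` \<D> \<subseteq> {w. a \<bullet> w > b}"
  shows "Re a \<ge> 0"
proof (rule ccontr)
  assume "\<not> Re a \<ge> 0"
  then have a: "Re a < 0" by simp
  define t where "t = max 0 ((a \<bullet> h 0 - b) / (- Re a))"
  have t: "t \<ge> 0" "(a \<bullet> h 0 - b) / (- Re a) \<le> t" by (auto simp: t_def)
  then have "a \<bullet> h 0 - b \<le> t * (- Re a)" using a by (subst (asm) pos_divide_le_eq) auto
  moreover have "a \<bullet> (h 0 + of_real t) > b" using koenigs_translate[OF t(1), of 0] assms by auto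
  moreover have "a \<bullet> (h 0 + of_real t) = a \<bullet> h 0 + t * Re a"
    by (simp add: inner_add_right) (simp add: inner_complex_def)
  ultimately show False by simp
qed

text \<open>The closure is stable under translation to the right, its complement under translation
  to the left. As Re a > 0, a segment to the left takes each point of the complement into the
  opposite half-plane, which is convex.\<close>

lemma connected_Compl_closure:
  assumes half: "h ` \<D> \<subseteq> {w. a \<bullet> w > b}" and a: "Re a > 0"
  shows "connected (- closure (h ` \<D>))"
proof -
  let ?V = "- closure (h ` \<D>)"
  define H where "H = {w. a \<bullet> w < b}"
  have "closure (h ` \<D>) \<subseteq> {w. a \<bullet> w \<ge> b}"
    by (rule closure_minimal) (use half closed_halfspace_ge[of b a] in \<open>auto simp: less_imp_le\<close>)
  then have HV: "H \<subseteq> ?V" by (auto simp: H_def)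
  have left: "x - of_real t \<in> ?V" if x: "x \<in> ?V" and t: "0 \<le> t" for x t
  proof
    assume "x - of_real t \<in> closure (h ` \<D>)"
    then have "of_real t + (x - of_real t) \<in> (\<lambda>w. of_real t + w) ` closure (h ` \<D>)" by (rule imageI)
    also have "\<dots> = closure ((\<lambda>w. of_real t + w) ` (h ` \<D>))" by (rule closure_translation[symmetric])
    also have "\<dots> \<subseteq> closure (h ` \<D>)"
      using koenigs_translate[OF t] by (intro closure_mono) (auto simp: add.commute)
    finally show False using x by simp
  qed
  \<comment> \<open>The + 1 carries the point strictly across the line at b; the maximum keeps the
    move leftward.\<close>
  define r where "r x = max 0 ((a \<bullet> x - b) / Re a + 1)" for x
  have r0: "r x \<ge> 0" for x by (simp add: r_def)
  have rH: "x - of_real (r x) \<in> H" for x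
  proof -
    have "(a \<bullet> x - b) / Re a < r x" by (simp add: r_def)
    then have "a \<bullet> x - b < r x * Re a" using a by (simp add: pos_divide_less_eq)
    moreover have "a \<bullet> (x - of_real (r x)) = a \<bullet> x - r x * Re a"
      by (simp add: inner_diff_right) (simp add: inner_complex_def)
    ultimately show ?thesis by (simp add: H_def)
  qed
  define T where "T x = closed_segment x (x - of_real (r x)) \<union> H" for x
  have segV: "closed_segment x (x - of_real (r x)) \<subseteq> ?V" if x: "x \<in> ?V" for x
  proof
    fix y assume "y \<in> closed_segment x (x - of_real (r x))"
    then obtain q where q: "0 \<le> q" "y = (1 - q) *\<^sub>R x + q *\<^sub>R (x - of_real (r x))" by (auto simp: in_segment)
    have "y = x - of_real (q * r x)" unfolding q(2) by (simp add: scaleR_conv_of_real algebra_simps)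
    then show "y \<in> ?V" using left[OF x, of "q * r x"] q(1) r0 by simp
  qed
  have "connected (T x)" for x
    unfolding T_def
    by (rule connected_Un) (use rH[of x] in \<open>auto simp: H_def intro!: convex_connected convex_halfspace_lt\<close>)
  moreover have "\<Inter>(T ` ?V) \<noteq> {}"
  proof -
    have "0 - of_real (r 0) \<in> T x" for x using rH[of 0] by (simp add: T_def)
    then show ?thesis by blast
  qed
  ultimately have "connected (\<Union>(T ` ?V))" by (intro connected_Union) auto
  moreover have "\<Union>(T ` ?V) = ?V"
  proof
    show "\<Union>(T ` ?V) \<subseteq> ?V" unfolding T_def using segV HV by blast
    show "?V \<subseteq> \<Union>(T ` ?V)" unfolding T_def by auto
  qed
  ultimately show ?thesis by simp
qed

text \<open>F is h followed by the Moebius map T = 1 / P, which takes the closure of Omega onto K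
  without 0 and infinity to 0. The topology carries over except at 0 and at the pole of T, which are
  treated by hand.\<close>

lemma closure_transfer:
  assumes half: "h ` \<D> \<subseteq> {w. a \<bullet> w > b}" and a: "a \<noteq> 0"
    and int: "interior (closure (h ` \<D>)) = h ` \<D>" and conn: "connected (- closure (h ` \<D>))"
    and F: "F = (\<lambda>z. 1 / (1 + (cnj a * h z - of_real b)))"
  shows "connected (- closure (F ` \<D>))" "interior (closure (F ` \<D>)) = F ` \<D>"
proof -
  let ?\<Omega> = "h ` \<D>"
  have open\<Omega>: "open ?\<Omega>" by (rule open_mapping_thm3[OF koenigs_hol open_ball koenigs_inj])
  define P where "P w = 1 + (cnj a * w - of_real b)" for w
  define T where "T w = 1 / P w" for w
  define S where "S \<zeta> = (1 / \<zeta> - 1 + of_real b) / cnj a" for \<zeta>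
  have ca: "cnj a \<noteq> 0" using a by simp
  have ReP: "Re (P w) = 1 + (a \<bullet> w - b)" for w by (simp add: P_def inner_complex_def)
  have "closure ?\<Omega> \<subseteq> {w. a \<bullet> w \<ge> b}"
    by (rule closure_minimal) (use half closed_halfspace_ge[of b a] in \<open>auto simp: less_imp_le\<close>)
  then have P1: "Re (P w) \<ge> 1" if "w \<in> closure ?\<Omega>" for w using that by (auto simp: ReP)
  then have Pnz: "P w \<noteq> 0" if "w \<in> closure ?\<Omega>" for w using that by force
  have PS: "P (S \<zeta>) = 1 / \<zeta>" for \<zeta> using ca by (simp add: P_def S_def)
  have ST: "S (T w) = w" if "P w \<noteq> 0" for w using ca that by (simp add: S_def T_def P_def field_simps)
  have TS: "T (S \<zeta>) = \<zeta>" if "\<zeta> \<noteq> 0" for \<zeta> using that by (simp add: T_def PS)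
  have contT: "continuous_on (closure ?\<Omega>) T"
    unfolding T_def using Pnz by (intro continuous_intros) (auto simp: P_def intro!: continuous_intros)
  have holS: "S holomorphic_on - {0}" unfolding S_def using ca by (intro holomorphic_intros) auto
  define K where "K = closure (F ` \<D>)"
  have FT: "F ` \<D> = T ` ?\<Omega>" by (auto simp: F T_def P_def image_image)
  have KT: "T w \<in> K" if "w \<in> closure ?\<Omega>" for w
    unfolding K_def FT using image_closure_subset[OF contT closed_closure closure_subset] imageI[OF that, of T] by (rule subsetD)
  have ReK: "Re \<zeta> \<ge> 0" if "\<zeta> \<in> K" for \<zeta>
  proof -
    have "K \<subseteq> {\<zeta>. Re \<zeta> \<ge> 0}" unfolding K_def FT
    proof (rule closure_minimal)
      show "T ` ?\<Omega> \<subseteq> {\<zeta>. Re \<zeta> \<ge> 0}"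
      proof clarify
        fix z assume "z \<in> \<D>"
        then have "Re (P (h z)) \<ge> 1" by (intro P1 subsetD[OF closure_subset] imageI)
        then show "Re (T (h z)) \<ge> 0" by (simp add: T_def Re_divide)
      qed
      show "closed {\<zeta>. Re \<zeta> \<ge> 0}" by (rule closed_halfspace_Re_ge)
    qed
    then show ?thesis using that by blast
  qed
  have KS: "S \<zeta> \<in> closure ?\<Omega>" if zK: "\<zeta> \<in> K" "\<zeta> \<noteq> 0" for \<zeta>
  proof -
    obtain x where x: "\<And>n. x n \<in> T ` ?\<Omega>" "x \<longlonglongrightarrow> \<zeta>"
      using zK(1) unfolding K_def FT closure_sequential by blast
    have Sx: "S (x n) \<in> ?\<Omega>" for n
    proof -
      obtain w where w: "w \<in> ?\<Omega>" "x n = T w" using x(1)[of n] by blast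
      have "w \<in> closure ?\<Omega>" by (rule subsetD[OF closure_subset w(1)])
      then show ?thesis using ST[OF Pnz] w by simp
    qed
    have "(\<lambda>n. S (x n)) \<longlonglongrightarrow> S \<zeta>" unfolding S_def using zK(2) ca by (intro tendsto_intros x) auto
    then show ?thesis unfolding closure_sequential using Sx by (intro exI[of _ "\<lambda>n. S (x n)"]) simp
  qed
  have injS: "inj_on S (- {0})" using TS by (metis ComplD inj_onI singletonI)
  show "interior (closure (F ` \<D>)) = F ` \<D>"
  proof
    have "open (S -` ?\<Omega> \<inter> - {0})"
      using continuous_open_preimage[OF holomorphic_on_imp_continuous_on[OF holS] _ open\<Omega>] by (simp add: open_Compl Int_commute)
    moreover have "S -` ?\<Omega> \<inter> - {0} = F ` \<D>"
    proof
      show "S -` ?\<Omega> \<inter> - {0} \<subseteq> F ` \<D>" unfolding FT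
      proof
        fix \<zeta> assume "\<zeta> \<in> S -` ?\<Omega> \<inter> - {0}"
        then have "S \<zeta> \<in> ?\<Omega>" "\<zeta> = T (S \<zeta>)" using TS by auto
        then show "\<zeta> \<in> T ` ?\<Omega>" by blast
      qed
      show "F ` \<D> \<subseteq> S -` ?\<Omega> \<inter> - {0}" unfolding FT
      proof
        fix \<zeta> assume "\<zeta> \<in> T ` ?\<Omega>"
        then obtain w where w: "w \<in> ?\<Omega>" "\<zeta> = T w" by blast
        have "P w \<noteq> 0" by (rule Pnz[OF subsetD[OF closure_subset w(1)]])
        then show "\<zeta> \<in> S -` ?\<Omega> \<inter> - {0}" using ST w by (simp add: T_def)
      qed
    qed
    ultimately show "F ` \<D> \<subseteq> interior (closure (F ` \<D>))"
      using interior_maximal[OF closure_subset] by metis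
    show "interior (closure (F ` \<D>)) \<subseteq> F ` \<D>"
    proof
      fix \<zeta> assume \<zeta>: "\<zeta> \<in> interior (closure (F ` \<D>))"
      then obtain e where e: "e > 0" "ball \<zeta> e \<subseteq> K" unfolding mem_interior K_def by blast
      \<comment> \<open>K lies in the closed right half-plane, so 0 is not interior to it.\<close>
      have "\<zeta> \<noteq> 0"
      proof
        assume "\<zeta> = 0"
        then have "of_real (- e / 2) \<in> K" using e by (auto simp: subset_iff dist_norm)
        then show False using ReK[of "of_real (- e / 2)"] e(1) by simp
      qed
      define B where "B = ball \<zeta> e \<inter> - {0}"
      have "open (S ` B)"
        by (rule open_mapping_thm3) (auto simp: B_def intro: holomorphic_on_subset[OF holS] inj_on_subset[OF injS])
      moreover have "S ` B \<subseteq> closure ?\<Omega>" using KS e(2) by (auto simp: B_def)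
      ultimately have "S ` B \<subseteq> ?\<Omega>" using interior_maximal int by metis
      moreover have "\<zeta> \<in> B" using e(1) \<open>\<zeta> \<noteq> 0\<close> by (simp add: B_def)
      ultimately have "S \<zeta> \<in> ?\<Omega>" by blast
      moreover have "T (S \<zeta>) = \<zeta>" using TS \<open>\<zeta> \<noteq> 0\<close> by blast
      ultimately show "\<zeta> \<in> F ` \<D>" unfolding FT by (metis imageI)
    qed
  qed
  \<comment> \<open>The image of infinity, approached along h 0 + n.\<close>
  have K0: "0 \<in> K"
  proof -
    define x where "x n = T (h 0 + of_nat n)" for n :: nat
    have "h 0 + of_nat n \<in> closure ?\<Omega>" for n
      using koenigs_translate[of "real n" 0] closure_subset by fastforce
    then have "x n \<in> K" for n using KT by (simp add: x_def)
    moreover have "x \<longlonglongrightarrow> 0"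
    proof -
      have "filterlim (\<lambda>n. cnj a * of_nat n) at_infinity sequentially"
        by (rule tendsto_mult_filterlim_at_infinity[OF tendsto_const ca]) (rule tendsto_of_nat)
      then have "filterlim (\<lambda>n. (1 + cnj a * h 0 - of_real b) + cnj a * of_nat n) at_infinity sequentially"
        by (rule tendsto_add_filterlim_at_infinity[OF tendsto_const])
      then have "(\<lambda>n. inverse ((1 + cnj a * h 0 - of_real b) + cnj a * of_nat n)) \<longlonglongrightarrow> 0"
        by (rule filterlim_compose[OF tendsto_inverse_0])
      then show ?thesis unfolding x_def T_def P_def by (simp add: field_simps)
    qed
    ultimately show ?thesis using closed_sequentially[of K x] by (simp add: K_def)
  qed
  \<comment> \<open>The pole of T. It lies off the closure of Omega, and an open connected set of
    the plane stays connected when one point is deleted.\<close>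
  define w0 where "w0 = (of_real b - 1) / cnj a"
  have w0: "P w = 0 \<longleftrightarrow> w = w0" for w using ca by (auto simp: P_def w0_def field_simps)
  have "- K = T ` (- closure ?\<Omega> - {w0})"
  proof
    show "- K \<subseteq> T ` (- closure ?\<Omega> - {w0})"
    proof
      fix y assume y: "y \<in> - K"
      then have "y \<noteq> 0" using K0 by auto
      then have "T (S y) = y" "P (S y) \<noteq> 0" using TS PS by auto
      moreover have "S y \<notin> closure ?\<Omega>" using KT y \<open>T (S y) = y\<close> by force
      ultimately show "y \<in> T ` (- closure ?\<Omega> - {w0})" using w0 by (metis ComplI DiffI imageI singletonD)
    qed
    show "T ` (- closure ?\<Omega> - {w0}) \<subseteq> - K"
    proof clarify
      fix v assume v: "v \<notin> closure ?\<Omega>" "v \<noteq> w0" "T v \<in> K"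
      have "P v \<noteq> 0" using w0 v by blast
      then have "T v \<noteq> 0" "S (T v) = v" using ST by (auto simp: T_def)
      then show False using KS[OF v(3)] v(1) by simp
    qed
  qed
  moreover have "connected (T ` (- closure ?\<Omega> - {w0}))"
  proof (rule connected_continuous_image)
    show "connected (- closure ?\<Omega> - {w0})"
      by (rule connected_open_delete) (use conn in auto)
    show "continuous_on (- closure ?\<Omega> - {w0}) T"
      unfolding T_def using w0 by (intro continuous_intros) (auto simp: P_def intro!: continuous_intros)
  qed
  ultimately show "connected (- closure (F ` \<D>))" by (simp add: K_def)
qed

end

subsection \<open>Operators on the Hardy space\<close>

lemma Hardy_iff: "f \<in> Hardy p \<longleftrightarrow> hardy_fun p f \<and> (\<forall>z. z \<notin> \<D> \<longrightarrow> f z = 0)"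
  unfolding Hardy_def hardy_fun_def by auto

lemma Hardy_norm_eq: "Hardy_norm p f = hsup p f powr (1 / p)"
  unfolding Hardy_norm_def hsup_def ..

text \<open>Elements of \<open>Hardy p\<close> vanish off the disc, whereas exponentials and limits
  are formed without that condition; this passes from one to the other.\<close>

definition disc_ext :: "(complex \<Rightarrow> complex) \<Rightarrow> complex \<Rightarrow> complex" where
  "disc_ext f = (\<lambda>z. if z \<in> \<D> then f z else 0)"

lemma disc_ext_add: "disc_ext (\<lambda>z. f z + g z) = (\<lambda>z. disc_ext f z + disc_ext g z)"
  and disc_ext_scale: "disc_ext (\<lambda>z. c * f z) = (\<lambda>z. c * disc_ext f z)"
  by (auto simp: disc_ext_def)

lemma disc_ext_Hardy: "hardy_fun p f \<Longrightarrow> disc_ext f \<in> Hardy p"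
  unfolding Hardy_iff using hardy_fun_cong(1)[of f "disc_ext f" p] by (simp add: disc_ext_def)

lemma hsup_disc_ext: "hsup p (disc_ext f) = hsup p f"
  by (rule hardy_fun_cong(2)) (simp add: disc_ext_def)

lemma bhol_ext_Hardy: "bhol f \<Longrightarrow> 1 \<le> p \<Longrightarrow> disc_ext f \<in> Hardy p"
  by (rule disc_ext_Hardy, rule bhol_hardy) auto

lemma zero_Hardy: "1 \<le> p \<Longrightarrow> (\<lambda>z. 0) \<in> Hardy p"
  using bhol_ext_Hardy[OF bhol_const[of 0]] by (simp add: disc_ext_def)

lemma Hardy_add: "f \<in> Hardy p \<Longrightarrow> g \<in> Hardy p \<Longrightarrow> 1 \<le> p \<Longrightarrow> (\<lambda>z. f z + g z) \<in> Hardy p"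
  unfolding Hardy_iff using hardy_fun_add(1)[of p f g] by simp

lemma Hardy_scale: "f \<in> Hardy p \<Longrightarrow> (\<lambda>z. c * f z) \<in> Hardy p"
  unfolding Hardy_iff using hardy_fun_scale(1)[of p f c] by simp

section \<open>Bounded operators and their continuity\<close>

context
  fixes p :: real and A :: fun_op
  assumes p: "1 \<le> p" and A: "A \<in> bounded_operators p"
begin

lemma op_Hardy: "f \<in> Hardy p \<Longrightarrow> A f \<in> Hardy p"
  and op_add: "f \<in> Hardy p \<Longrightarrow> g \<in> Hardy p \<Longrightarrow> A (\<lambda>z. f z + g z) = (\<lambda>z. A f z + A g z)"
  and op_scale: "f \<in> Hardy p \<Longrightarrow> A (\<lambda>z. c * f z) = (\<lambda>z. c * A f z)"
  and op_outside: "f \<notin> Hardy p \<Longrightarrow> A f = (\<lambda>z. 0)"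
  using A unfolding bounded_operators_def by blast+

lemma op_zero: "A (\<lambda>z. 0) = (\<lambda>z. 0)"
  using op_scale[OF zero_Hardy[OF p], of 0] by simp

lemma op_diff:
  assumes "f \<in> Hardy p" "g \<in> Hardy p"
  shows "A (\<lambda>z. f z - g z) = (\<lambda>z. A f z - A g z)"
  using op_add[OF assms(1) Hardy_scale[OF assms(2), of "- 1"]] op_scale[OF assms(2), of "- 1"] by simp

lemma op_norm_bound:
  obtains C where "C \<ge> 0" "\<And>f. f \<in> Hardy p \<Longrightarrow> Hardy_norm p (A f) \<le> C * Hardy_norm p f"
proof -
  obtain C where C: "\<And>f. f \<in> Hardy p \<Longrightarrow> Hardy_norm p (A f) \<le> C * Hardy_norm p f"
    using A unfolding bounded_operators_def by blast
  have "Hardy_norm p (A f) \<le> max C 0 * Hardy_norm p f" if "f \<in> Hardy p" for f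
    by (rule order_trans[OF C[OF that]]) (auto simp: Hardy_norm_eq intro: mult_right_mono)
  then show thesis using that[of "max C 0"] by simp
qed

lemma op_hsup_bound:
  obtains C where "C \<ge> 0" "\<And>f. f \<in> Hardy p \<Longrightarrow> hsup p (A f) \<le> C * hsup p f"
proof -
  obtain C where C: "C \<ge> 0" "\<And>f. f \<in> Hardy p \<Longrightarrow> Hardy_norm p (A f) \<le> C * Hardy_norm p f"
    by (rule op_norm_bound) blast
  have "hsup p (A f) \<le> C powr p * hsup p f" if f: "f \<in> Hardy p" for f
  proof -
    have nn: "hsup p (A f) \<ge> 0" "hsup p f \<ge> 0"
      using hsup_nonneg op_Hardy[OF f] f unfolding Hardy_iff by auto
    have "(hsup p (A f) powr (1 / p)) powr p \<le> (C * hsup p f powr (1 / p)) powr p"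
      using C(2)[OF f] p unfolding Hardy_norm_eq by (intro powr_mono2) auto
    then show ?thesis using nn p C(1) by (simp add: powr_powr powr_mult)
  qed
  then show thesis using that[of "C powr p"] by simp
qed

lemma op_tendsto_0:
  assumes F: "\<And>n. F n \<in> Hardy p" and lim: "(\<lambda>n. hsup p (F n)) \<longlonglongrightarrow> 0" and z: "z \<in> \<D>"
  shows "(\<lambda>n. A (F n) z) \<longlonglongrightarrow> 0"
proof -
  obtain C where C: "C \<ge> 0" "\<And>f. f \<in> Hardy p \<Longrightarrow> hsup p (A f) \<le> C * hsup p f"
    by (rule op_hsup_bound) blast
  have h: "hardy_fun p (A (F n))" for n using op_Hardy[OF F, of n] by (simp add: Hardy_iff)
  show ?thesis
  proof (rule hsup_tendsto_0_imp_pointwise[OF h _ _ p])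
    show "(\<lambda>n. hsup p (A (F n))) \<longlonglongrightarrow> 0"
    proof (rule tendsto_sandwich[of "\<lambda>n. 0"])
      show "\<forall>\<^sub>F n in sequentially. 0 \<le> hsup p (A (F n))" using hsup_nonneg[OF h] by simp
      show "\<forall>\<^sub>F n in sequentially. hsup p (A (F n)) \<le> C * hsup p (F n)" using C(2)[OF F] by simp
      show "(\<lambda>n. C * hsup p (F n)) \<longlonglongrightarrow> 0" by (rule tendsto_mult_right_zero[OF lim])
    qed simp
  qed (use z in simp)
qed

text \<open>The value of A f at a point is a norm-continuous functional of f, so
  \<open>functional_bp_continuous\<close> applies to F n - f.\<close>

lemma op_bp_continuous:
  assumes F: "\<And>n. F n holomorphic_on \<D>" "\<And>n z. z \<in> \<D> \<Longrightarrow> norm (F n z) \<le> M"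
    and lim: "\<And>z. z \<in> \<D> \<Longrightarrow> (\<lambda>n. F n z) \<longlonglongrightarrow> f z" and z: "z \<in> \<D>"
  shows "(\<lambda>n. A (disc_ext (F n)) z) \<longlonglongrightarrow> A (disc_ext f) z"
proof -
  have f: "bhol f" by (rule bhol_limit[OF F lim])
  have bF: "bhol (F n)" for n using F unfolding bhol_def by blast
  have fM: "norm (f z) \<le> M" if "z \<in> \<D>" for z
    by (rule LIMSEQ_le_const2[OF tendsto_norm[OF lim[OF that]]]) (use F(2)[OF that] in auto)
  have "(\<lambda>n. A (disc_ext (\<lambda>z. F n z - f z)) z) \<longlonglongrightarrow> 0"
  proof (rule functional_bp_continuous[of p "\<lambda>f. A (disc_ext f) z" "\<lambda>n z. F n z - f z" "M + M"])
    show "p > 0" using p by simp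
    show "A (disc_ext (\<lambda>z. f z + g z)) z = A (disc_ext f) z + A (disc_ext g) z" if "bhol f" "bhol g" for f g
      unfolding disc_ext_add using op_add[OF bhol_ext_Hardy[OF that(1) p] bhol_ext_Hardy[OF that(2) p]] by simp
    show "A (disc_ext (\<lambda>z. c * f z)) z = c * A (disc_ext f) z" if "bhol f" for c f
      unfolding disc_ext_scale using op_scale[OF bhol_ext_Hardy[OF that p]] by simp
    show "(\<lambda>n. A (disc_ext (G n)) z) \<longlonglongrightarrow> 0" if "\<And>n. bhol (G n)" "(\<lambda>n. hsup p (G n)) \<longlonglongrightarrow> 0" for G
      by (rule op_tendsto_0[OF bhol_ext_Hardy[OF that(1) p] _ z]) (use that(2) in \<open>simp add: hsup_disc_ext\<close>)
    show "(\<lambda>z. F n z - f z) holomorphic_on \<D>" for n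
      using f F(1) unfolding bhol_def by (auto intro: holomorphic_on_diff)
    show "norm (F n x - f x) \<le> M + M" if "x \<in> \<D>" for n x
      using norm_triangle_ineq4[of "F n x" "f x"] F(2)[OF that, of n] fM[OF that] by linarith
    show "(\<lambda>n. F n x - f x) \<longlonglongrightarrow> 0" if "x \<in> \<D>" for x
      using tendsto_diff[OF lim[OF that] tendsto_const[of "f x"]] by simp
  qed
  moreover have "A (disc_ext (\<lambda>z. F n z - f z)) z = A (disc_ext (F n)) z - A (disc_ext f) z" for n
  proof -
    have "disc_ext (\<lambda>z. F n z - f z) = (\<lambda>z. disc_ext (F n) z - disc_ext f z)" by (auto simp: disc_ext_def)
    then show ?thesis using op_diff[OF bhol_ext_Hardy[OF bF p] bhol_ext_Hardy[OF f p], of n] by simp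
  qed
  ultimately have "(\<lambda>n. A (disc_ext (F n)) z - A (disc_ext f) z) \<longlonglongrightarrow> 0" by simp
  then show ?thesis by (rule LIM_zero_cancel)
qed

end

text \<open>Bounded functions b n approximate f in norm, and both A (f - b n) and B (f - b n) tend
  to 0 pointwise; their difference does not depend on n.\<close>

lemma op_eqI:
  assumes p: "1 \<le> p" and A: "A \<in> bounded_operators p" and B: "B \<in> bounded_operators p"
    and eq: "\<And>f. bhol f \<Longrightarrow> A (disc_ext f) = B (disc_ext f)"
  shows "A = B"
proof
  fix f
  show "A f = B f"
  proof (cases "f \<in> Hardy p")
    case False
    then show ?thesis using op_outside[OF p A] op_outside[OF p B] by simp
  next
    case True
    have hf: "hardy_fun p f" using True by (simp add: Hardy_iff)
    have "\<exists>b. bhol b \<and> hsup p (\<lambda>z. f z - b z) < 1 / real (Suc n)" for n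
      by (rule bhol_dense[OF hf p, of "1 / real (Suc n)"]) auto
    then obtain b where b: "\<And>n. bhol (b n)" "\<And>n. hsup p (\<lambda>z. f z - b n z) < 1 / real (Suc n)" by metis
    have bH: "disc_ext (b n) \<in> Hardy p" for n by (rule bhol_ext_Hardy[OF b(1) p])
    define F where "F n = (\<lambda>z. f z - disc_ext (b n) z)" for n
    have FH: "F n \<in> Hardy p" for n
      using Hardy_add[OF True Hardy_scale[OF bH, of "- 1"] p, of n] by (simp add: F_def)
    have "hsup p (F n) = hsup p (\<lambda>z. f z - b n z)" for n
      by (rule hardy_fun_cong(2)) (simp add: F_def disc_ext_def)
    then have small: "hsup p (F n) \<le> 1 / real (Suc n)" for n using b(2)[of n] by simp
    have lim: "(\<lambda>n. hsup p (F n)) \<longlonglongrightarrow> 0"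
    proof (rule tendsto_sandwich[of "\<lambda>n. 0"])
      have "hardy_fun p (F n)" for n using FH by (simp add: Hardy_iff)
      then show "\<forall>\<^sub>F n in sequentially. 0 \<le> hsup p (F n)" using hsup_nonneg by simp
      show "\<forall>\<^sub>F n in sequentially. hsup p (F n) \<le> 1 / real (Suc n)" using small by simp
      show "(\<lambda>n. 1 / real (Suc n)) \<longlonglongrightarrow> 0" by (rule LIMSEQ_Suc[OF lim_1_over_n])
    qed simp
    show ?thesis
    proof
      fix z
      show "A f z = B f z"
      proof (cases "z \<in> \<D>")
        case False
        then show ?thesis
          using op_Hardy[OF p A True] op_Hardy[OF p B True] by (simp add: Hardy_iff)
      next
        case z: True
        have "(\<lambda>n. A (F n) z - B (F n) z) \<longlonglongrightarrow> 0 - 0"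
          by (intro tendsto_diff op_tendsto_0[OF p A FH lim z] op_tendsto_0[OF p B FH lim z])
        moreover have "A (F n) z - B (F n) z = A f z - B f z" for n
          unfolding F_def op_diff[OF p A True bH] op_diff[OF p B True bH] using eq[OF b(1), of n] by simp
        ultimately show ?thesis by (simp add: LIMSEQ_const_iff)
      qed
    qed
  qed
qed

lemma bounded_operators_comp:
  assumes p: "1 \<le> p" and A: "A \<in> bounded_operators p" and B: "B \<in> bounded_operators p"
  shows "A \<circ> B \<in> bounded_operators p"
proof -
  obtain C where C: "C \<ge> 0" "\<And>f. f \<in> Hardy p \<Longrightarrow> Hardy_norm p (A f) \<le> C * Hardy_norm p f"
    by (rule op_norm_bound[OF p A]) blast
  obtain D where D: "D \<ge> 0" "\<And>f. f \<in> Hardy p \<Longrightarrow> Hardy_norm p (B f) \<le> D * Hardy_norm p f"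
    by (rule op_norm_bound[OF p B]) blast
  have "Hardy_norm p ((A \<circ> B) f) \<le> (C * D) * Hardy_norm p f" if "f \<in> Hardy p" for f
  proof -
    have "Hardy_norm p (A (B f)) \<le> C * Hardy_norm p (B f)" by (rule C(2)[OF op_Hardy[OF p B that]])
    also have "\<dots> \<le> C * (D * Hardy_norm p f)" by (rule mult_left_mono[OF D(2)[OF that] C(1)])
    finally show ?thesis by (simp add: mult.assoc)
  qed
  then have "\<exists>C. \<forall>f\<in>Hardy p. Hardy_norm p ((A \<circ> B) f) \<le> C * Hardy_norm p f" by blast
  moreover have "\<forall>f\<in>Hardy p. (A \<circ> B) f \<in> Hardy p"
    using op_Hardy[OF p A] op_Hardy[OF p B] by simp
  moreover have "\<forall>f\<in>Hardy p. \<forall>g\<in>Hardy p. (A \<circ> B) (\<lambda>z. f z + g z) = (\<lambda>z. (A \<circ> B) f z + (A \<circ> B) g z)"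
    using op_add[OF p B] op_add[OF p A op_Hardy[OF p B] op_Hardy[OF p B]] by simp
  moreover have "\<forall>c. \<forall>f\<in>Hardy p. (A \<circ> B) (\<lambda>z. c * f z) = (\<lambda>z. c * (A \<circ> B) f z)"
    using op_scale[OF p B] op_scale[OF p A op_Hardy[OF p B]] by simp
  moreover have "\<forall>f. f \<notin> Hardy p \<longrightarrow> (A \<circ> B) f = (\<lambda>z. 0)"
    using op_outside[OF p B] op_zero[OF p A] by simp
  ultimately show ?thesis unfolding bounded_operators_def by blast
qed

lemma zero_operator_bounded:
  assumes p: "1 \<le> p"
  shows "zero_operator \<in> bounded_operators p"
proof -
  have "hsup p (\<lambda>z. 0) = 0"
    using hardy_fun_scale(2)[OF bhol_hardy[OF bhol_const[of 0]], of p 0] p by simp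
  then have "Hardy_norm p (\<lambda>z. 0) = 0" by (simp add: Hardy_norm_eq)
  then show ?thesis unfolding bounded_operators_def zero_operator_def
    using zero_Hardy[OF p] by (auto intro!: exI[of _ 0])
qed

lemma id_operator_bounded:
  assumes p: "1 \<le> p"
  shows "id_operator p \<in> bounded_operators p"
  unfolding bounded_operators_def id_operator_def Hardy_ext_def
  using Hardy_add[OF _ _ p] Hardy_scale by (auto intro!: exI[of _ 1])

text \<open>Agreement of A and B survives sums, multiples and bounded pointwise limits, hence
  spreads from S to all bounded functions and by density to H^p.\<close>

lemma op_eq_exp_span:
  assumes p: "1 \<le> p" and A: "A \<in> bounded_operators p" and B: "B \<in> bounded_operators p"
    and S: "\<And>f. f \<in> S \<Longrightarrow> bhol f" and eq: "\<And>f. f \<in> S \<Longrightarrow> A (disc_ext f) = B (disc_ext f)"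
    and span: "\<And>f. bhol f \<Longrightarrow> f \<in> bp_span S"
  shows "A = B"
proof (rule op_eqI[OF p A B])
  fix f assume "bhol f"
  then have "f \<in> bp_span S" by (rule span)
  then show "A (disc_ext f) = B (disc_ext f)"
  proof induction
    case (base f)
    then show ?case by (rule eq)
  next
    case (add f g)
    have "disc_ext f \<in> Hardy p" "disc_ext g \<in> Hardy p"
      using bhol_ext_Hardy[OF bp_span_bhol[OF _ S] p] add.hyps by blast+
    then show ?case unfolding disc_ext_add using op_add[OF p A] op_add[OF p B] add.IH by simp
  next
    case (scale f c)
    have "disc_ext f \<in> Hardy p" using bhol_ext_Hardy[OF bp_span_bhol[OF _ S] p] scale.hyps by blast
    then show ?case unfolding disc_ext_scale using op_scale[OF p A] op_scale[OF p B] scale.IH by simp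
  next
    case (lim F M f)
    have bF: "bhol (F n)" for n by (rule bp_span_bhol[OF lim.hyps(1) S])
    have hol: "F n holomorphic_on \<D>" for n using bF by (simp add: bhol_def)
    have "bhol f" by (rule bhol_limit[OF hol lim.hyps(2,3)])
    then have fH: "disc_ext f \<in> Hardy p" using p by (rule bhol_ext_Hardy)
    show ?case
    proof
      fix z
      show "A (disc_ext f) z = B (disc_ext f) z"
      proof (cases "z \<in> \<D>")
        case False
        then show ?thesis using op_Hardy[OF p A fH] op_Hardy[OF p B fH] by (simp add: Hardy_iff)
      next
        case True
        have "(\<lambda>n. A (disc_ext (F n)) z) \<longlonglongrightarrow> A (disc_ext f) z"
          by (rule op_bp_continuous[OF p A hol lim.hyps(2,3) True])
        moreover have "(\<lambda>n. A (disc_ext (F n)) z) \<longlonglongrightarrow> B (disc_ext f) z"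
          unfolding lim.IH by (rule op_bp_continuous[OF p B hol lim.hyps(2,3) True])
        ultimately show ?thesis by (rule LIMSEQ_unique)
      qed
    qed
  qed
qed

(* The quotient of an eigenfunction of all C_{phi_t} by exp (- x g) is constant along trajectories. *)
lemma commutant_eigenvector:
  assumes sf: "holomorphic_semiflow \<phi>" and koe: "koenigs_function \<phi> h" and p: "1 \<le> p"
    and A: "A \<in> semigroup_commutant p \<phi>" and g: "g = (\<lambda>z. cnj a * h z - of_real b)" "\<And>z. z \<in> \<D> \<Longrightarrow> Re (g z) > 0"
    and x: "x > 0"
  shows "\<exists>m. A (disc_ext (\<lambda>z. exp (- (of_real x * g z)))) = (\<lambda>z. m * disc_ext (\<lambda>z. exp (- (of_real x * g z))) z)"
proof -
  let ?e = "\<lambda>z. exp (- (of_real x * g z))"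
  note flow = koenigs_flow[OF sf koe] and flowD = semiflow_D[OF sf koe]
  have holg: "g holomorphic_on \<D>" unfolding g(1) by (intro holomorphic_intros koenigs_hol[OF sf koe])
  have "?e \<in> exp_family g" using x by (auto simp: exp_family_def)
  from exp_family_bhol[OF holg g(2) this] have be: "bhol ?e" by simp
  have eH: "disc_ext ?e \<in> Hardy p" by (rule bhol_ext_Hardy[OF be p])
  have AC: "A \<in> bounded_operators p" "A \<circ> composition_operator p (\<phi> t) = composition_operator p (\<phi> t) \<circ> A" if "t > 0" for t
    using A that unfolding semigroup_commutant_def commutant_def by auto
  have Ab: "A \<in> bounded_operators p" by (rule AC(1)[of 1]) simp
  define f where "f = A (disc_ext ?e)"
  have fH: "f \<in> Hardy p" unfolding f_def by (rule op_Hardy[OF p Ab eH])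
  have holf: "f holomorphic_on \<D>" using fH by (simp add: Hardy_def)
  \<comment> \<open>Commutation passes the eigenvalue exp (- x cnj a t) of the exponential on to its
    image under A.\<close>
  have inv: "f (\<phi> t z) = exp (- (of_real x * cnj a * of_real t)) * f z" if t: "t > 0" and z: "z \<in> \<D>" for t z
  proof -
    have ext: "composition_operator p (\<phi> t) (disc_ext ?e) = (\<lambda>z. exp (- (of_real x * cnj a * of_real t)) * disc_ext ?e z)"
    proof
      fix w
      show "composition_operator p (\<phi> t) (disc_ext ?e) w = exp (- (of_real x * cnj a * of_real t)) * disc_ext ?e w"
      proof (cases "w \<in> \<D>")
        case True
        have "g (\<phi> t w) = g w + cnj a * of_real t"
          using flow[of t w] t True by (simp add: g(1) algebra_simps)
        then have "?e (\<phi> t w) = exp (- (of_real x * cnj a * of_real t)) * ?e w"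
          by (simp add: exp_add[symmetric] algebra_simps)
        then show ?thesis
          using True eH flowD[of t w] t by (simp add: composition_operator_def Hardy_ext_def disc_ext_def)
      qed (use eH in \<open>simp add: composition_operator_def Hardy_ext_def disc_ext_def\<close>)
    qed
    have "A (composition_operator p (\<phi> t) (disc_ext ?e)) = composition_operator p (\<phi> t) (A (disc_ext ?e))"
      using AC(2)[OF t] by (metis comp_apply)
    then have "(\<lambda>z. exp (- (of_real x * cnj a * of_real t)) * f z) = composition_operator p (\<phi> t) f"
      unfolding ext op_scale[OF p Ab eH] f_def .
    from fun_cong[OF this, of z] show ?thesis
      using z fH by (simp add: composition_operator_def Hardy_ext_def)
  qed
  define q where "q z = f z / ?e z" for z
  have holq: "q holomorphic_on \<D>" unfolding q_def by (intro holomorphic_intros holf holg) auto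
  have z0: "(0::complex) \<in> \<D>" by simp
  have qinv: "q (\<phi> t 0) = q 0" if t: "t > 0" for t
  proof -
    have "g (\<phi> t 0) = g 0 + cnj a * of_real t"
      using flow[of t 0] t by (simp add: g(1) algebra_simps)
    then have "?e (\<phi> t 0) = exp (- (of_real x * cnj a * of_real t)) * ?e 0"
      by (simp add: exp_add[symmetric] algebra_simps)
    then show ?thesis unfolding q_def inv[OF t z0] by simp
  qed
  have "\<forall>s\<ge>0. \<forall>K. compact K \<and> K \<subseteq> \<D> \<longrightarrow> uniform_limit K \<phi> (\<phi> s) (at s within {0..})"
    and "\<forall>z\<in>\<D>. \<phi> 0 z = z"
    using sf unfolding holomorphic_semiflow_def by blast+
  moreover have "compact {0::complex} \<and> {0::complex} \<subseteq> \<D>" by simp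
  ultimately have "uniform_limit {0} \<phi> (\<phi> 0) (at 0 within {0..})" and \<phi>0: "\<phi> 0 0 = 0"
    by blast+
  from tendsto_uniform_limitI[OF this(1), of 0] have lim0: "((\<lambda>t. \<phi> t 0) \<longlongrightarrow> 0) (at 0 within {0..})"
    by (simp add: \<phi>0)
  \<comment> \<open>The trajectory of 0 returns to 0 as t tends to 0, but h (phi_t 0) = h 0 + t
    keeps it off 0 for t > 0; so the identity theorem applies.\<close>
  have islim: "0 islimpt ((\<lambda>t. \<phi> t 0) ` {0<..})"
  proof (rule islimptI)
    fix T :: "complex set" assume T: "0 \<in> T" "open T"
    have "\<forall>\<^sub>F t in at 0 within {0..}. \<phi> t 0 \<in> T" by (rule topological_tendstoD[OF lim0 T(2,1)])
    then obtain d where d: "d > 0" "\<And>t. 0 < t \<Longrightarrow> t < d \<Longrightarrow> \<phi> t 0 \<in> T"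
      unfolding eventually_at dist_real_def by auto
    have "h (\<phi> (d/2) 0) \<noteq> h 0" using flow[of "d/2" 0] d(1) by simp
    then have "\<phi> (d/2) 0 \<noteq> 0" by auto
    moreover have "\<phi> (d/2) 0 \<in> T" using d by simp
    ultimately show "\<exists>y\<in>(\<lambda>t. \<phi> t 0) ` {0<..}. y \<in> T \<and> y \<noteq> 0" using d(1) by (intro bexI[of _ "\<phi> (d/2) 0"]) auto
  qed
  have "q z = q 0" if z: "z \<in> \<D>" for z
  proof -
    have "q z - q 0 = 0"
    proof (rule analytic_continuation[of "\<lambda>z. q z - q 0" \<D> "(\<lambda>t. \<phi> t 0) ` {0<..}" 0])
      show "(\<lambda>z. q z - q 0) holomorphic_on \<D>" by (intro holomorphic_intros holq)
      show "(\<lambda>t. \<phi> t 0) ` {0<..} \<subseteq> \<D>" using flowD z0 by (auto simp del: mem_ball_0)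
      show "q w - q 0 = 0" if "w \<in> (\<lambda>t. \<phi> t 0) ` {0<..}" for w using that qinv by auto
    qed (use islim z in auto)
    then show ?thesis by simp
  qed
  then have "f z = q 0 * ?e z" if "z \<in> \<D>" for z using that by (metis q_def exp_not_eq_zero nonzero_divide_eq_eq)
  moreover have "f z = 0" if "z \<notin> \<D>" for z using fH that by (simp add: Hardy_def)
  ultimately have "f = (\<lambda>z. q 0 * disc_ext ?e z)" by (auto simp: disc_ext_def simp del: mem_ball_0)
  then show ?thesis unfolding f_def by blast
qed

section \<open>The commutant acts by scalars on the exponentials\<close>

lemma exp_family_converges:
  assumes g: "\<And>z. z \<in> \<D> \<Longrightarrow> Re (g z) > 0" and x: "x \<longlonglongrightarrow> y"
  shows "(\<lambda>n. exp (- (of_real (x n) * g z))) \<longlonglongrightarrow> exp (- (of_real y * g z))"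
  by (intro tendsto_exp tendsto_minus tendsto_mult tendsto_of_real x tendsto_const)

text \<open>What both cases share: a half-plane around Omega and the two topological conditions.
  Operators of the commutant are diagonal on the exponentials and are determined by their
  scalars.\<close>

lemma commutant_structure:
  assumes sf: "holomorphic_semiflow \<phi>" and koe: "koenigs_function \<phi> h" and p: "1 \<le> p"
    and half: "h ` \<D> \<subseteq> {w. a \<bullet> w > b}" and a: "a \<noteq> 0"
    and int: "interior (closure (h ` \<D>)) = h ` \<D>" and conn: "connected (- closure (h ` \<D>))"
  shows "(\<forall>A\<in>semigroup_commutant p \<phi>. \<forall>B\<in>semigroup_commutant p \<phi>. A \<circ> B = B \<circ> A) \<and>
         \<not> (\<exists>J\<in>semigroup_commutant p \<phi>. nontrivial_idempotent p J)"
proof -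
  \<comment> \<open>The inner product with a is the real part of multiplication by cnj a, so g takes
    values in the right half-plane.\<close>
  define g where "g = (\<lambda>z. cnj a * h z - of_real b)"
  have Reg: "Re (g z) > 0" if "z \<in> \<D>" for z
  proof -
    have "a \<bullet> h z > b" using half that by blast
    then show ?thesis by (simp add: g_def inner_complex_def)
  qed
  have holg: "g holomorphic_on \<D>" unfolding g_def by (intro holomorphic_intros koenigs_hol[OF sf koe])
  have injg: "inj_on g \<D>" using koenigs_inj[OF sf koe] a by (auto simp: g_def inj_on_def)
  define F where "F = (\<lambda>z. 1 / (1 + (cnj a * h z - of_real b)))"
  have Fg: "F = (\<lambda>z. 1 / (1 + g z))" by (simp add: F_def g_def)
  note K = closure_transfer[OF sf koe half a int conn F_def]
  have span: "f \<in> bp_span (exp_family g)" if "bhol f" for f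
    by (rule bhol_in_exp_span[OF holg Reg injg Fg K that])
  note fam = exp_family_bhol[OF holg Reg]
  define e where "e x = disc_ext (\<lambda>z. exp (- (of_real x * g z)))" for x :: real
  have eH: "e x \<in> Hardy p" if "x > 0" for x
    unfolding e_def by (rule bhol_ext_Hardy[OF fam p]) (use that in \<open>auto simp: exp_family_def\<close>)
  \<comment> \<open>Scalars are read off at the point 0, where no exponential vanishes.\<close>
  have e0: "e x 0 \<noteq> 0" for x by (simp add: e_def disc_ext_def)
  have bdd: "A \<in> bounded_operators p" if "A \<in> semigroup_commutant p \<phi>" for A
    using that unfolding semigroup_commutant_def commutant_def by (auto intro: exI[of _ "1::real"] dest!: bspec[of _ _ "1::real"])
  have eig: "\<exists>m. A (e x) = (\<lambda>z. m * e x z)" if "A \<in> semigroup_commutant p \<phi>" "x > 0" for A x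
    unfolding e_def by (rule commutant_eigenvector[OF sf koe p that(1) g_def Reg that(2)])
  have eqI: "A = B" if AB: "A \<in> bounded_operators p" "B \<in> bounded_operators p" "\<And>x. x > 0 \<Longrightarrow> A (e x) = B (e x)" for A B
  proof (rule op_eq_exp_span[OF p AB(1,2) fam _ span])
    show "A (disc_ext f) = B (disc_ext f)" if "f \<in> exp_family g" for f
      using that AB(3) by (auto simp: exp_family_def e_def)
  qed
  have "A \<circ> B = B \<circ> A" if A: "A \<in> semigroup_commutant p \<phi>" and B: "B \<in> semigroup_commutant p \<phi>" for A B
  proof (rule eqI)
    note Ab = bdd[OF A] and Bb = bdd[OF B]
    show "A \<circ> B \<in> bounded_operators p" "B \<circ> A \<in> bounded_operators p"
      by (rule bounded_operators_comp[OF p Ab Bb] bounded_operators_comp[OF p Bb Ab])+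
    fix x :: real assume x: "x > 0"
    obtain m k where m: "A (e x) = (\<lambda>z. m * e x z)" and k: "B (e x) = (\<lambda>z. k * e x z)"
      using eig[OF A x] eig[OF B x] by blast
    show "(A \<circ> B) (e x) = (B \<circ> A) (e x)"
      unfolding comp_apply m k op_scale[OF p Ab eH[OF x]] op_scale[OF p Bb eH[OF x]] by (simp add: mult.left_commute)
  qed
  moreover have "\<not> nontrivial_idempotent p J" if J: "J \<in> semigroup_commutant p \<phi>" for J
  proof
    assume "nontrivial_idempotent p J"
    then have idem: "J \<circ> J = J" and ne: "J \<noteq> zero_operator" "J \<noteq> id_operator p"
      by (auto simp: nontrivial_idempotent_def)
    note Jb = bdd[OF J]
    have "\<exists>m. \<forall>x>0. J (e x) = (\<lambda>z. m x * e x z)" using eig[OF J] by metis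
    then obtain m where m: "\<And>x. x > 0 \<Longrightarrow> J (e x) = (\<lambda>z. m x * e x z)" by blast
    have m01: "m x \<in> {0, 1}" if x: "x > 0" for x
    proof -
      have "J (J (e x)) = J (e x)" using idem by (metis comp_apply)
      then have "(\<lambda>z. m x * (m x * e x z)) = (\<lambda>z. m x * e x z)"
        unfolding m[OF x] op_scale[OF p Jb eH[OF x]] .
      from fun_cong[OF this, of 0] have "m x * m x = m x" using e0 by simp
      then show ?thesis by auto
    qed
    have "continuous_on {0<..} m"
      unfolding continuous_on_sequentially
    proof (intro allI ballI impI, elim conjE)
      fix s and y :: real assume y: "y \<in> {0<..}" and s: "\<forall>n. s n \<in> {0<..}" "s \<longlonglongrightarrow> y"
      have 1: "(\<lambda>n. J (e (s n)) 0) \<longlonglongrightarrow> J (e y) 0"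
        unfolding e_def
      proof (rule op_bp_continuous[OF p Jb, of _ 1])
        show "(\<lambda>z. exp (- (of_real (s n) * g z))) holomorphic_on \<D>" for n by (intro holomorphic_intros holg)
        show "norm (exp (- (of_real (s n) * g z))) \<le> 1" if "z \<in> \<D>" for n z
          by (rule norm_exp_family[OF Reg[OF that]]) (use s(1) in simp)
        show "(\<lambda>n. exp (- (of_real (s n) * g z))) \<longlonglongrightarrow> exp (- (of_real y * g z))" for z
          by (rule exp_family_converges[OF Reg s(2)])
      qed simp
      have 2: "(\<lambda>n. e (s n) 0) \<longlonglongrightarrow> e y 0"
        unfolding e_def disc_ext_def using exp_family_converges[OF Reg s(2), where z = 0] by simp
      have "(\<lambda>n. J (e (s n)) 0 / e (s n) 0) \<longlonglongrightarrow> J (e y) 0 / e y 0"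
        by (rule tendsto_divide[OF 1 2 e0])
      moreover have "J (e x) 0 / e x 0 = m x" if "x > 0" for x using m[OF that] e0 by simp
      ultimately show "(m \<circ> s) \<longlonglongrightarrow> m y" using s(1) y by (simp add: o_def)
    qed
    \<comment> \<open>A nonempty connected subset of {0, 1} is a point, so J agrees with 0 or with
      the identity on all exponentials.\<close>
    then have "connected (m ` {0<..})" by (rule connected_continuous_image) simp
    moreover have "finite (m ` {0<..})" by (rule finite_subset[of _ "{0, 1}"]) (use m01 in auto)
    ultimately obtain c where c: "m ` {0<..} = {c}"
      using connected_finite_iff_sing[of "m ` {0<..}"] by (auto simp: image_is_empty)
    have mc: "m x = c" if "x > 0" for x using c that by blast
    have "c = 0 \<or> c = 1" using m01[of 1] mc[of 1] by auto
    then show False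
    proof
      assume "c = 0"
      have "J = zero_operator"
        by (rule eqI[OF Jb zero_operator_bounded[OF p]]) (use m mc \<open>c = 0\<close> in \<open>simp add: zero_operator_def\<close>)
      then show False using ne by blast
    next
      assume "c = 1"
      have "J = id_operator p"
        by (rule eqI[OF Jb id_operator_bounded[OF p]]) (use m mc \<open>c = 1\<close> eH in \<open>simp add: id_operator_def Hardy_ext_def\<close>)
      then show False using ne by blast
    qed
  qed
  ultimately show ?thesis by blast
qed

lemma connected_image_half_line:
  fixes f :: "'a::topological_space \<Rightarrow> real"
  assumes "connected S" "continuous_on S f" "\<And>z. z \<in> S \<Longrightarrow> f z \<noteq> y"
  shows "(\<forall>z\<in>S. f z > y) \<or> (\<forall>z\<in>S. f z < y)"
proof (rule ccontr)
  assume "\<not> ?thesis"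
  then obtain u v where uv: "u \<in> S" "v \<in> S" "f u \<le> y" "y \<le> f v" by fastforce
  have "connected (f ` S)" using assms by (intro connected_continuous_image)
  then have "y \<in> f ` S" using connectedD_interval[of "f ` S" "f u" "f v" y] uv by blast
  then show False using assms(3) by blast
qed

theorem corollary4p6:
  fixes \<phi> :: "real \<Rightarrow> complex \<Rightarrow> complex" and h :: "complex \<Rightarrow> complex"
    and \<Omega> :: "complex set" and p :: real
  assumes "parabolic \<phi>"
    and "koenigs_function \<phi> h" and "\<Omega> = h ` \<D>"
    and "1 \<le> p"
    and "(positive_hyperbolic_step \<phi> \<and> interior (closure \<Omega>) = \<Omega> \<and> connected (- closure \<Omega>)) \<or>
         (zero_hyperbolic_step \<phi> \<and> (\<exists>H. half_plane H \<and> \<Omega> \<subseteq> H) \<and> interior (closure \<Omega>) = \<Omega>)"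
  shows "(\<forall>A\<in>semigroup_commutant p \<phi>. \<forall>B\<in>semigroup_commutant p \<phi>. A \<circ> B = B \<circ> A) \<and>
         \<not> (\<exists>J\<in>semigroup_commutant p \<phi>. nontrivial_idempotent p J)"
proof -
  have sf: "holomorphic_semiflow \<phi>" using assms(1) by (simp add: parabolic_def)
  note koe = assms(2)
  have int: "interior (closure (h ` \<D>)) = h ` \<D>" using assms(3,5) by auto
  have "\<exists>a b. a \<noteq> 0 \<and> h ` \<D> \<subseteq> {w. a \<bullet> w > b} \<and> connected (- closure (h ` \<D>))"
    using assms(5)
  proof (elim disjE conjE exE)
    assume pos: "positive_hyperbolic_step \<phi>" and conn: "connected (- closure \<Omega>)"
    obtain y where y: "\<And>z. z \<in> \<D> \<Longrightarrow> Im (h z) \<noteq> y" using positive_step_Im[OF sf koe pos] by blast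
    have "continuous_on \<D> (\<lambda>z. Im (h z))"
      by (intro continuous_intros holomorphic_on_imp_continuous_on koenigs_hol[OF sf koe])
    then have "(\<forall>z\<in>\<D>. Im (h z) > y) \<or> (\<forall>z\<in>\<D>. Im (h z) < y)"
      using y by (intro connected_image_half_line) auto
    then show ?thesis
    proof
      assume "\<forall>z\<in>\<D>. Im (h z) > y"
      then have "h ` \<D> \<subseteq> {w. \<i> \<bullet> w > y}" by (auto simp: inner_complex_def)
      then show ?thesis using conn assms(3) by (intro exI[of _ \<i>] exI[of _ y]) auto
    next
      assume "\<forall>z\<in>\<D>. Im (h z) < y"
      then have "h ` \<D> \<subseteq> {w. (- \<i>) \<bullet> w > - y}" by (auto simp: inner_complex_def)
      then show ?thesis using conn assms(3) by (intro exI[of _ "- \<i>"] exI[of _ "- y"]) auto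
    qed
  next
    fix H assume zero: "zero_hyperbolic_step \<phi>" and H: "half_plane H" "\<Omega> \<subseteq> H"
    obtain a b where ab: "a \<noteq> 0" "H = {w. a \<bullet> w > b}" using H(1) unfolding half_plane_def by blast
    have half: "h ` \<D> \<subseteq> {w. a \<bullet> w > b}" using H(2) ab(2) assms(3) by simp
    \<comment> \<open>A horizontal boundary line would force positive step.\<close>
    have Re0: "Re a \<noteq> 0"
    proof
      assume Re: "Re a = 0"
      then have Im: "Im a \<noteq> 0" using ab(1) by (simp add: complex_eq_iff)
      have "Im a * Im (h z) > b" if "z \<in> \<D>" for z
      proof -
        have "a \<bullet> h z > b" using half that by blast
        then show ?thesis using Re by (simp add: inner_complex_def)
      qed
      then have *: "sgn (Im a) * Im (h z) > b / \<bar>Im a\<bar>" if "z \<in> \<D>" for z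
        using that Im by (simp add: sgn_real_def field_simps abs_if split: if_splits)
      have "positive_hyperbolic_step \<phi>"
        by (rule horizontal_half_plane_positive_step[OF sf koe _ *]) (use Im in \<open>auto simp: sgn_real_def\<close>)
      then show False using zero by simp
    qed
    then have "Re a > 0" using half_plane_Re_nonneg[OF sf koe half] by simp
    then show ?thesis using connected_Compl_closure[OF sf koe half] half ab(1) by blast
  qed
  then obtain a b where "a \<noteq> 0" "h ` \<D> \<subseteq> {w. a \<bullet> w > b}" "connected (- closure (h ` \<D>))" by blast
  then show ?thesis using commutant_structure[OF sf koe assms(4) _ _ int] by blast
qed

end
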